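(* Let $\mathcal G\leq \mathrm{Diff}^\omega(\mathbb R^2,0)$ be a closed uniform subgroup satisfying property (ICP). Then every $\mathcal G$-homogeneous smooth curve $\gamma\subset\mathbb R^2$ is real-analytic.
   Context: $\mathrm{Diff}^\omega(\mathbb R^2,0)$ is the group of germs at $0$ of real-analytic maps $\psi$ from a neighborhood of $0$ in $\mathbb R^2$ to $\mathbb R^2$ with $\psi(0)=0$ and non-zero Jacobian determinant at $0$. For $q\in\mathbb R^2$, $\tau_q(x)=x+q$. A smooth curve is an (embedded, locally closed) $1$-dimensional $C^\infty$ submanifold of $\mathbb R^2$; it is real-analytic if it is a real-analytic submanifold. Closed: a subgroup $\mathcal G$ is closed if whenever $g:U\to\mathbb R^2$ is a real-analytic map on a neighborhood $U$ of $0$ whose germ at $0$ lies in $\mathrm{Diff}^\omega(\mathbb R^2,0)$, and there are a domain $U'\subset U$ with $0\in U'$ and real-analytic maps $g_j:U'\to\mathbb R^2$ whose germs at $0$ belong to $\mathcal G$ with $g_j\to g$ uniformly on $U'$, then the germ of $g$ at $0$ belongs to $\mathcal G$. Uniform: $\mathcal G$ is uniform if for every domain $U\subset\mathbb R^2$ with $0\in U$, every real-analytic $\psi:U\to\mathbb R^2$ with nowhere vanishing Jacobian determinant whose germ at $0$ belongs to $\mathcal G$, and every $q\in U$, the germ at $0$ of $\tau_{-\psi(q)}\circ\psi\circ\tau_q$ belongs to $\mathcal G$. (ICP): a curve of class $C^\infty$ around $0$ is a closed $1$-dimensional $C^\infty$ submanifold $\lambda$ of an open neighborhood of $0$ in $\mathbb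 R^2$ with $0\in\lambda$; it is invariant under a germ $g$ if $g(q)\in\lambda$ for all $q\in\lambda$ close enough to $0$. $\mathcal G$ satisfies (ICP) if for every $g\in\mathcal G$ with $g\circ g\neq \mathrm{Id}$ and every curve $\lambda$ of class $C^\infty$ around $0$ invariant under $g$, the germ of $\lambda$ at $0$ is real-analytic outside $0$; that is, there is a neighborhood $N$ of $0$ such that every $p\in\lambda\cap N$, $p\ne0$, has a neighborhood $U$ for which $\lambda\cap U$ is a real-analytic curve. $\mathcal G$-homogeneous: $\gamma$ is $\mathcal G$-homogeneous if for any $p,q\in\gamma$ there exist a neighborhood $U$ of $p$ in $\mathbb R^2$ and a real-analytic diffeomorphism $\psi:U\to\psi(U)\subset\mathbb R^2$ such that $\psi(U\cap\gamma)=\gamma\cap\psi(U)$, $\psi(p)=q$, and the germ at $0$ of $\tau_{-q}\circ\psi\circ\tau_p$ belongs to $\mathcal G$. *)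

theory Defs
  imports "HOL-Analysis.Analysis" "HOL-Algebra.Group"
begin

section \<open>Regularity classes\<close>

text \<open>Maps on subsets of the plane are represented by total functions; the two regularity
  predicates below are only meant for open sets \<open>S\<close>, and there they depend only on the
  restriction of the function to \<open>S\<close>.\<close>

definition real_analytic_on :: "(real^2 \<Rightarrow> real^2) \<Rightarrow> (real^2) set \<Rightarrow> bool"
    (infixl "real'_analytic'_on" 50) where
  "f real_analytic_on S \<longleftrightarrow>
    (\<forall>p\<in>S. \<exists>c r. 0 < r \<and> (\<forall>x\<in>ball p r.
       ((\<lambda>(i, j). ((x $ 1 - p $ 1) ^ i * (x $ 2 - p $ 2) ^ j) *\<^sub>R c i j) has_sum f x)
         (UNIV :: (nat \<times> nat) set)))"

primrec Ck_on :: "nat \<Rightarrow> (real^2 \<Rightarrow> real^2) \<Rightarrow> (real^2) set \<Rightarrow> bool" where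
  "Ck_on 0 f S \<longleftrightarrow> continuous_on S f"
| "Ck_on (Suc k) f S \<longleftrightarrow>
     (\<forall>x\<in>S. f differentiable (at x)) \<and> (\<forall>v. Ck_on k (\<lambda>x. frechet_derivative f (at x) v) S)"

definition smooth_on :: "(real^2 \<Rightarrow> real^2) \<Rightarrow> (real^2) set \<Rightarrow> bool"
    (infixl "smooth'_on" 50) where
  "f smooth_on S \<longleftrightarrow> (\<forall>k. Ck_on k f S)"

section \<open>Diffeomorphisms and curves\<close>

text \<open>The regularity class \<open>C\<close> is a parameter, to be instantiated with
  \<^const>\<open>smooth_on\<close> or \<^const>\<open>real_analytic_on\<close>.\<close>

definition diffeo_on ::
    "((real^2 \<Rightarrow> real^2) \<Rightarrow> (real^2) set \<Rightarrow> bool) \<Rightarrow> (real^2 \<Rightarrow> real^2) \<Rightarrow> (real^2) set \<Rightarrow> bool" where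
  "diffeo_on C \<phi> U \<longleftrightarrow> open U \<and> open (\<phi> ` U) \<and> inj_on \<phi> U \<and> C \<phi> U \<and> C (inv_into U \<phi>) (\<phi> ` U)"

text \<open>Embedded one-dimensional submanifolds of the plane, by straightening charts. They need
  not be closed subsets, nor connected.\<close>

definition curve_of_class ::
    "((real^2 \<Rightarrow> real^2) \<Rightarrow> (real^2) set \<Rightarrow> bool) \<Rightarrow> (real^2) set \<Rightarrow> bool" where
  "curve_of_class C \<gamma> \<longleftrightarrow>
    (\<forall>p\<in>\<gamma>. \<exists>U \<phi>. p \<in> U \<and> diffeo_on C \<phi> U \<and> \<phi> ` (U \<inter> \<gamma>) = \<phi> ` U \<inter> {y. y $ 2 = 0})"

abbreviation smooth_curve :: "(real^2) set \<Rightarrow> bool" where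
  "smooth_curve \<equiv> curve_of_class (smooth_on)"

abbreviation real_analytic_curve :: "(real^2) set \<Rightarrow> bool" where
  "real_analytic_curve \<equiv> curve_of_class (real_analytic_on)"

section \<open>Germs at the origin\<close>

type_synonym germ = "(real^2 \<Rightarrow> real^2) set"

definition germ :: "(real^2 \<Rightarrow> real^2) \<Rightarrow> germ" where
  "germ f = {g. \<forall>\<^sub>F x in nhds 0. g x = f x}"

definition local_analytic_diffeo :: "(real^2 \<Rightarrow> real^2) \<Rightarrow> bool" where
  "local_analytic_diffeo \<psi> \<longleftrightarrow>
    (\<exists>U. open U \<and> 0 \<in> U \<and> \<psi> real_analytic_on U) \<and> \<psi> 0 = 0 \<and> det (jacobian \<psi> (at 0)) \<noteq> 0"

definition Diff_omega :: "germ monoid" where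
  "Diff_omega =
    \<lparr>carrier = germ ` {\<psi>. local_analytic_diffeo \<psi>},
     mult = (\<lambda>a b. \<Union>f\<in>a. \<Union>g\<in>b. germ (f \<circ> g)),
     one = germ id\<rparr>"

lemma germ_eq_iff: "germ f = germ g \<longleftrightarrow> (\<forall>\<^sub>F x in nhds 0. f x = g x)"
proof
  assume "germ f = germ g"
  moreover have "f \<in> germ f" by (simp add: germ_def)
  ultimately show "\<forall>\<^sub>F x in nhds 0. f x = g x" by (simp add: germ_def)
next
  assume eq: "\<forall>\<^sub>F x in nhds 0. f x = g x"
  have "(\<forall>\<^sub>F x in nhds 0. h x = f x) \<longleftrightarrow> (\<forall>\<^sub>F x in nhds 0. h x = g x)" for h
    using eq by (intro eventually_subst) (auto elim: eventually_mono)
  then show "germ f = germ g" by (simp add: germ_def)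
qed

text \<open>The union in the definition of the product is a single class.\<close>

lemma Diff_omega_mult_germ:
  assumes "isCont g 0" and "g 0 = 0"
  shows "germ f \<otimes>\<^bsub>Diff_omega\<^esub> germ g = germ (f \<circ> g)"
proof -
  have "germ (f' \<circ> g') = germ (f \<circ> g)" if "f' \<in> germ f" "g' \<in> germ g" for f' g'
  proof -
    have f': "\<forall>\<^sub>F x in nhds 0. f' x = f x" and g': "\<forall>\<^sub>F x in nhds 0. g' x = g x"
      using that by (auto simp: germ_def)
    have "filterlim g (nhds 0) (nhds 0)"
      using assms tendsto_at_iff_tendsto_nhds[of g 0] by (simp add: isCont_def)
    from eventually_compose_filterlim[OF f' this]
    have "\<forall>\<^sub>F x in nhds 0. f' (g x) = f (g x)" .
    with g' have "\<forall>\<^sub>F x in nhds 0. (f' \<circ> g') x = (f \<circ> g) x"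
      by eventually_elim simp
    then show ?thesis by (simp add: germ_eq_iff)
  qed
  moreover have "f \<in> germ f" "g \<in> germ g" by (auto simp: germ_def)
  ultimately have "(\<Union>f'\<in>germ f. \<Union>g'\<in>germ g. germ (f' \<circ> g')) = germ (f \<circ> g)"
    by blast
  then show ?thesis by (simp add: Diff_omega_def)
qed

section \<open>Properties of sets of germs\<close>

definition closed_germs :: "germ set \<Rightarrow> bool" where
  "closed_germs G \<longleftrightarrow>
    (\<forall>g U. open U \<and> 0 \<in> U \<and> g real_analytic_on U \<and> germ g \<in> carrier Diff_omega \<and>
       (\<exists>U' gs. U' \<subseteq> U \<and> open U' \<and> connected U' \<and> 0 \<in> U' \<and>
          (\<forall>j::nat. gs j real_analytic_on U' \<and> germ (gs j) \<in> G) \<and>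
          uniform_limit U' gs g sequentially)
     \<longrightarrow> germ g \<in> G)"

definition uniform_germs :: "germ set \<Rightarrow> bool" where
  "uniform_germs G \<longleftrightarrow>
    (\<forall>U \<psi> q. open U \<and> connected U \<and> 0 \<in> U \<and> \<psi> real_analytic_on U \<and>
       (\<forall>x\<in>U. det (jacobian \<psi> (at x)) \<noteq> 0) \<and> germ \<psi> \<in> G \<and> q \<in> U
     \<longrightarrow> germ ((+) (- \<psi> q) \<circ> \<psi> \<circ> (+) q) \<in> G)"

definition smooth_curve_around_0 :: "(real^2) set \<Rightarrow> bool" where
  "smooth_curve_around_0 \<Lambda> \<longleftrightarrow>
    smooth_curve \<Lambda> \<and> 0 \<in> \<Lambda> \<and> (\<exists>W. open W \<and> 0 \<in> W \<and> closedin (top_of_set W) \<Lambda>)"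

text \<open>The choice of the representative \<open>f\<close> is irrelevant.\<close>

definition invariant_under :: "(real^2) set \<Rightarrow> germ \<Rightarrow> bool" where
  "invariant_under \<Lambda> g \<longleftrightarrow> (\<forall>f\<in>g. \<forall>\<^sub>F q in nhds 0. q \<in> \<Lambda> \<longrightarrow> f q \<in> \<Lambda>)"

definition ICP :: "germ set \<Rightarrow> bool" where
  "ICP G \<longleftrightarrow>
    (\<forall>g\<in>G. \<forall>\<Lambda>. g \<otimes>\<^bsub>Diff_omega\<^esub> g \<noteq> \<one>\<^bsub>Diff_omega\<^esub> \<and> smooth_curve_around_0 \<Lambda> \<and> invariant_under \<Lambda> g
     \<longrightarrow> (\<exists>N. open N \<and> 0 \<in> N \<and>
           (\<forall>p \<in> \<Lambda> \<inter> N. p \<noteq> 0 \<longrightarrow> (\<exists>U. open U \<and> p \<in> U \<and> real_analytic_curve (\<Lambda> \<inter> U)))))"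

definition homogeneous :: "germ set \<Rightarrow> (real^2) set \<Rightarrow> bool" where
  "homogeneous G \<gamma> \<longleftrightarrow>
    (\<forall>p\<in>\<gamma>. \<forall>q\<in>\<gamma>. \<exists>U \<psi>. p \<in> U \<and> diffeo_on (real_analytic_on) \<psi> U \<and>
       \<psi> ` (U \<inter> \<gamma>) = \<gamma> \<inter> \<psi> ` U \<and> \<psi> p = q \<and> germ ((+) (- q) \<circ> \<psi> \<circ> (+) p) \<in> G)"

end

theory Submission
  imports Defs "HOL-Complex_Analysis.Great_Picard"
begin

text \<open>If the curve is real-analytic near one point, homogeneity makes it so everywhere; so suppose
  that it is analytic nowhere. By (ICP) every germ of the group that fixes a point of the curve and
  leaves the curve invariant is then an involution, and an involution close to the identity is
  trivial. Hence the map moving a base point of the curve to a given nearby point is unique among the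
  maps close to the identity. By Baire's theorem and closedness there is a point \<open>p\<close> such that all
  nearby points of the curve are images of \<open>p\<close> under maps defined on a common disc and tending to
  the identity as the point tends to \<open>p\<close>. Iterating such a map \<open>g\<close> until \<open>p\<close> has moved a fixed
  distance, uniqueness (with uniformity of the group) shows that all iterates stay on the disc and
  close to the identity. Averaging the iterates, \<open>H = (1/k) (id + g + \<dots> + g\<^sup>k\<^sup>-\<^sup>1)\<close> satisfies
  \<open>H \<circ> g - H = (1/k) (g\<^sup>k - id)\<close>, so \<open>k (g - id)\<close> is comparable with \<open>g\<^sup>k - id\<close>. As
  \<open>g\<close> tends to the identity these quotients subconverge to an analytic vector field which is tangent to the
  curve and does not vanish at \<open>p\<close>. The curve is an integral curve of it, hence
  analytic near \<open>p\<close>, a contradiction.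

  Analytic maps are handled as absolutely convergent power series on a bidisc. These form a Banach
  algebra, in which composition is again evaluation of a power series, now at elements of the algebra.\<close>

section \<open>Absolutely summable power series in two variables\<close>

text \<open>Compactness and composition both cost part of the disc: bounded sets of the algebra
  become relatively compact only after composition with \<open>half_coords\<close>, and a composite
  \<open>a \<circ> g\<close> is controlled only on a smaller disc. Naive iteration would use up the
  disc after a few steps. Uniqueness repairs this: the composite coincides with the member of the
  family that has the same value at 0, and that member carries its bound on the full disc, so the
  loss does not accumulate. For this reason no iterate is ever formed; the next map is picked from
  the family. The closeness 1/64 is chosen for this purpose: the displacement of such a map has
  Lipschitz constant 1/8, that of a composite of two has 1/8 * 9/8 + 1/8 = 17/64, below the 1/2 that
  uniqueness asks for. Estimates are proved for evaluation in an arbitrary commutative Banach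
  algebra. At a point of the plane they are pointwise bounds; at \<open>half_coords\<close> the same
  estimates bound the whole map on the disc of half the radius.\<close>

lemma summable_on_norm_comparison:
  fixes f :: "'a \<Rightarrow> 'b::real_normed_vector"
  assumes "g summable_on A" and "\<And>x. x \<in> A \<Longrightarrow> norm (f x) \<le> g x"
  shows "(\<lambda>x. norm (f x)) summable_on A"
  by (rule summable_on_comparison_test[OF assms(1)]) (use assms(2) in auto)

lemma norm_product_summable:
  fixes f g :: "'a \<Rightarrow> 'b::{real_normed_algebra,banach}"
  assumes f: "(\<lambda>k. norm (f k)) summable_on UNIV" and g: "(\<lambda>k. norm (g k)) summable_on UNIV"
  shows "(\<lambda>(k, l). norm (f k * g l)) summable_on UNIV \<times> UNIV"
    and "((\<lambda>(k, l). f k * g l) has_sum infsum f UNIV * infsum g UNIV) (UNIV \<times> UNIV)"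
proof -
  have "(\<lambda>(k, l). norm (f k) * norm (g l)) summable_on UNIV \<times> UNIV"
  proof (rule summable_on_SigmaI)
    show "((\<lambda>l. case (k, l) of (k, l) \<Rightarrow> norm (f k) * norm (g l)) has_sum
        norm (f k) * infsum (\<lambda>l. norm (g l)) UNIV) UNIV" for k
      using has_sum_cmult_right[OF has_sum_infsum[OF g], of "norm (f k)"] by simp
    show "(\<lambda>k. norm (f k) * infsum (\<lambda>l. norm (g l)) UNIV) summable_on UNIV"
      by (rule summable_on_cmult_left[OF f])
  qed auto
  then show 1: "(\<lambda>(k, l). norm (f k * g l)) summable_on UNIV \<times> UNIV"
    by (rule summable_on_comparison_test) (auto simp: norm_mult_ineq)
  have "(\<lambda>(k, l). f k * g l) summable_on UNIV \<times> UNIV"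
    by (rule abs_summable_summable) (use 1 in \<open>simp add: case_prod_unfold\<close>)
  then obtain S where S: "((\<lambda>(k, l). f k * g l) has_sum S) (UNIV \<times> UNIV)"
    by (auto simp: summable_on_def)
  have "((\<lambda>k. f k * infsum g UNIV) has_sum S) UNIV"
    by (rule has_sum_SigmaD[OF S])
      (use has_sum_cmult_right[OF has_sum_infsum[OF abs_summable_summable[OF g]]] in auto)
  moreover have "((\<lambda>k. f k * infsum g UNIV) has_sum infsum f UNIV * infsum g UNIV) UNIV"
    by (rule has_sum_cmult_left[OF has_sum_infsum[OF abs_summable_summable[OF f]]])
  ultimately show "((\<lambda>(k, l). f k * g l) has_sum infsum f UNIV * infsum g UNIV) (UNIV \<times> UNIV)"
    using S has_sum_unique by blast
qed

text \<open>Sending (k, l) to (k + l, k) turns the absolutely convergent double series into a series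
  over the finite fibres of n = k + l, and each fibre sums to a coefficient of the product. The last
  claim will be submultiplicativity of the norm.\<close>

lemma Cauchy_product_nat_pairs:
  fixes f g :: "nat \<times> nat \<Rightarrow> 'b::{real_normed_algebra,banach}"
  assumes f: "(\<lambda>k. norm (f k)) summable_on UNIV" and g: "(\<lambda>k. norm (g k)) summable_on UNIV"
  defines "c \<equiv> \<lambda>(i, j). \<Sum>a\<le>i. \<Sum>b\<le>j. f (a, b) * g (i - a, j - b)"
  shows "(\<lambda>n. norm (c n)) summable_on UNIV"
    and "(c has_sum infsum f UNIV * infsum g UNIV) UNIV"
    and "infsum (\<lambda>n. norm (c n)) UNIV
      \<le> infsum (\<lambda>k. norm (f k)) UNIV * infsum (\<lambda>k. norm (g k)) UNIV"
proof -
  let ?I = "\<lambda>n::nat \<times> nat. {..fst n} \<times> {..snd n}"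
  let ?P = "\<lambda>(n::nat \<times> nat, k::nat \<times> nat). f k * g (fst n - fst k, snd n - snd k)"
  let ?Q = "\<lambda>(n::nat \<times> nat, k::nat \<times> nat). norm (f k) * norm (g (fst n - fst k, snd n - snd k))"
  have bij: "bij_betw (\<lambda>(k, l). ((fst k + fst l, snd k + snd l), k)) (UNIV \<times> UNIV) (Sigma UNIV ?I)"
    by (rule bij_betwI[where g = "\<lambda>(n, k). (k, (fst n - fst k, snd n - snd k))"]) auto
  note re = has_sum_reindex_bij_betw[OF bij]
  have "(?P has_sum infsum f UNIV * infsum g UNIV) (Sigma UNIV ?I)"
    unfolding re[symmetric] using norm_product_summable(2)[OF f g] by (simp add: case_prod_beta')
  moreover have c: "((\<lambda>k. ?P (n, k)) has_sum c n) (?I n)" for n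
    by (rule has_sum_finiteI) (auto simp: c_def sum.cartesian_product case_prod_beta)
  ultimately show "(c has_sum infsum f UNIV * infsum g UNIV) UNIV"
    by (rule has_sum_SigmaD) 
  let ?q = "\<lambda>n. \<Sum>k\<in>?I n. ?Q (n, k)"
  have "(?Q has_sum infsum (\<lambda>k. norm (f k)) UNIV * infsum (\<lambda>k. norm (g k)) UNIV) (Sigma UNIV ?I)"
    unfolding re[symmetric]
    using norm_product_summable(2)[of "\<lambda>k. norm (f k)" "\<lambda>k. norm (g k)"] f g by (simp add: case_prod_beta')
  then have q: "(?q has_sum infsum (\<lambda>k. norm (f k)) UNIV * infsum (\<lambda>k. norm (g k)) UNIV) UNIV"
    by (rule has_sum_SigmaD) (rule has_sum_finiteI, auto)
  have le: "norm (c n) \<le> ?q n" for n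
  proof -
    have "c n = (\<Sum>k\<in>?I n. ?P (n, k))"
      by (auto simp: c_def sum.cartesian_product case_prod_beta)
    also have "norm \<dots> \<le> ?q n"
      by (rule order_trans[OF norm_sum]) (auto intro!: sum_mono norm_mult_ineq)
    finally show ?thesis .
  qed
  show s: "(\<lambda>n. norm (c n)) summable_on UNIV"
    by (rule summable_on_norm_comparison[OF has_sum_imp_summable[OF q]]) (rule le)
  show "infsum (\<lambda>n. norm (c n)) UNIV
      \<le> infsum (\<lambda>k. norm (f k)) UNIV * infsum (\<lambda>k. norm (g k)) UNIV"
    by (rule has_sum_mono[OF has_sum_infsum[OF s] q]) (rule le)
qed

section \<open>The Banach algebra of absolutely summable power series\<close>

definition fps2_nth :: "real fps fps \<Rightarrow> nat \<times> nat \<Rightarrow> real" where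
  "fps2_nth f n = fps_nth (fps_nth f (fst n)) (snd n)"

lemma fps2_eqI:
  assumes "\<And>n. fps2_nth f n = fps2_nth g n"
  shows "f = g"
proof (intro fps_ext)
  show "fps_nth (fps_nth f i) j = fps_nth (fps_nth g i) j" for i j
    using assms[of "(i, j)"] by (simp add: fps2_nth_def)
qed

lemma fps2_nth_simps [simp]:
  "fps2_nth 0 n = 0" "fps2_nth (f + g) n = fps2_nth f n + fps2_nth g n"
  "fps2_nth (f - g) n = fps2_nth f n - fps2_nth g n" "fps2_nth (- f) n = - fps2_nth f n"
  "fps2_nth (fps_const (fps_const c) * f) n = c * fps2_nth f n"
  by (simp_all add: fps2_nth_def)

lemma fps2_nth_one: "fps2_nth 1 n = (if n = (0, 0) then 1 else 0)"
  by (cases n) (auto simp: fps2_nth_def)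

lemma fps2_nth_mult:
  "fps2_nth (f * g) = (\<lambda>(i, j). \<Sum>a\<le>i. \<Sum>b\<le>j. fps2_nth f (a, b) * fps2_nth g (i - a, j - b))"
  by (rule ext) (simp add: fps2_nth_def fps_mult_nth fps_sum_nth atMost_atLeast0 case_prod_beta)

definition Abs_fps2 :: "(nat \<times> nat \<Rightarrow> real) \<Rightarrow> real fps fps" where
  "Abs_fps2 c = Abs_fps (\<lambda>i. Abs_fps (\<lambda>j. c (i, j)))"

lemma fps2_nth_Abs: "fps2_nth (Abs_fps2 c) = c"
  by (simp add: fun_eq_iff fps2_nth_def Abs_fps2_def)

text \<open>The Wiener algebra of the unit bidisc, with the l^1 norm of the coefficients. Carving it
  out of \<open>real fps fps\<close> lets the ring laws be transferred, so that only summability and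
  norms need proof. Other radii are reduced to this one by rescaling, see
  \<open>expands\<close>.\<close>

typedef wiener = "{f :: real fps fps. (\<lambda>n. norm (fps2_nth f n)) summable_on UNIV}"
  by (rule exI[of _ 0]) simp

setup_lifting type_definition_wiener

lift_definition coef :: "wiener \<Rightarrow> nat \<times> nat \<Rightarrow> real" is fps2_nth .

lemma wiener_eqI: "(\<And>n. coef F n = coef G n) \<Longrightarrow> F = G"
  by transfer (rule fps2_eqI)

lemma coef_summable: "(\<lambda>n. norm (coef F n)) summable_on UNIV"
  by transfer simp

instantiation wiener :: comm_ring_1
begin

lift_definition zero_wiener :: wiener is 0 by simp
lift_definition one_wiener :: wiener is 1
  by (rule finite_nonzero_values_imp_summable_on, rule finite_subset[of _ "{(0, 0)}"])
    (auto simp: fps2_nth_one)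
lift_definition plus_wiener :: "wiener \<Rightarrow> wiener \<Rightarrow> wiener" is "(+)"
proof -
  fix f g assume "(\<lambda>n. norm (fps2_nth f n)) summable_on UNIV" "(\<lambda>n. norm (fps2_nth g n)) summable_on UNIV"
  from summable_on_add[OF this] show "(\<lambda>n. norm (fps2_nth (f + g) n)) summable_on UNIV"
    by (rule summable_on_norm_comparison) (simp add: abs_triangle_ineq)
qed
lift_definition minus_wiener :: "wiener \<Rightarrow> wiener \<Rightarrow> wiener" is "(-)"
proof -
  fix f g assume "(\<lambda>n. norm (fps2_nth f n)) summable_on UNIV" "(\<lambda>n. norm (fps2_nth g n)) summable_on UNIV"
  from summable_on_add[OF this] show "(\<lambda>n. norm (fps2_nth (f - g) n)) summable_on UNIV"
    by (rule summable_on_norm_comparison) (simp add: abs_triangle_ineq4)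
qed
lift_definition uminus_wiener :: "wiener \<Rightarrow> wiener" is uminus
  by simp
lift_definition times_wiener :: "wiener \<Rightarrow> wiener \<Rightarrow> wiener" is "(*)"
  unfolding fps2_nth_mult by (rule Cauchy_product_nat_pairs(1))

instance
proof
  fix F G H :: wiener
  show "F * G * H = F * (G * H)" by transfer (rule mult.assoc)
  show "F * G = G * F" by transfer (rule mult.commute)
  show "1 * F = F" by transfer (rule mult_1_left)
  show "F + G + H = F + (G + H)" by transfer (rule add.assoc)
  show "F + G = G + F" by transfer (rule add.commute)
  show "0 + F = F" by transfer (rule add_0_left)
  show "- F + F = 0" by transfer (rule left_minus)
  show "F - G = F + - G" by transfer (rule diff_conv_add_uminus)
  show "(F + G) * H = F * H + G * H" by transfer (rule distrib_right)
  show "(0::wiener) \<noteq> 1" by transfer (rule zero_neq_one)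
qed

end

instantiation wiener :: real_algebra_1
begin

lift_definition scaleR_wiener :: "real \<Rightarrow> wiener \<Rightarrow> wiener" is "\<lambda>c f. fps_const (fps_const c) * f"
  by (simp add: abs_mult summable_on_cmult_right)

lemma coef_simps [simp]:
  "coef 0 n = 0" "coef (F + G) n = coef F n + coef G n"
  "coef (F - G) n = coef F n - coef G n" "coef (- F) n = - coef F n"
  "coef (c *\<^sub>R F) n = c * coef F n"
  by (transfer; simp)+

lemma coef_one: "coef 1 n = (if n = (0, 0) then 1 else 0)"
  by transfer (rule fps2_nth_one)

lemma coef_mult: "coef (F * G) = (\<lambda>(i, j). \<Sum>a\<le>i. \<Sum>b\<le>j. coef F (a, b) * coef G (i - a, j - b))"
  by transfer (rule fps2_nth_mult)

instance
proof
  fix F G :: wiener and a b :: real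
  show "a *\<^sub>R (F + G) = a *\<^sub>R F + a *\<^sub>R G" by (rule wiener_eqI) (simp add: distrib_left)
  show "(a + b) *\<^sub>R F = a *\<^sub>R F + b *\<^sub>R F" by (rule wiener_eqI) (simp add: distrib_right)
  show "a *\<^sub>R b *\<^sub>R F = (a * b) *\<^sub>R F" by (rule wiener_eqI) simp
  show "1 *\<^sub>R F = F" by (rule wiener_eqI) simp
  show "a *\<^sub>R F * G = a *\<^sub>R (F * G)" by transfer (rule mult.assoc)
  show "F * a *\<^sub>R G = a *\<^sub>R (F * G)" by transfer (rule mult.left_commute)
qed

end

instantiation wiener :: real_normed_algebra_1
begin

definition norm_wiener :: "wiener \<Rightarrow> real" where "norm F = infsum (\<lambda>n. norm (coef F n)) UNIV"
definition sgn_wiener :: "wiener \<Rightarrow> wiener" where "sgn (F::wiener) = F /\<^sub>R norm F"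
definition dist_wiener :: "wiener \<Rightarrow> wiener \<Rightarrow> real" where "dist (F::wiener) G = norm (F - G)"
definition uniformity_wiener :: "(wiener \<times> wiener) filter" where
  "uniformity_wiener = (INF e\<in>{0<..}. principal {(x, y). dist x y < e})"
definition open_wiener :: "wiener set \<Rightarrow> bool" where
  "open_wiener U = (\<forall>x\<in>U. \<forall>\<^sub>F (x', y) in uniformity. x' = x \<longrightarrow> y \<in> U)"

lemma norm_wiener_has_sum: "((\<lambda>n. \<bar>coef F n\<bar>) has_sum norm F) UNIV"
  using has_sum_infsum[OF coef_summable[of F]] by (simp add: norm_wiener_def)

lemma abs_coef_le_norm: "\<bar>coef F n\<bar> \<le> norm F"
  using finite_sum_le_has_sum[OF norm_wiener_has_sum[of F], of "{n}"] by simp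

instance
proof
  fix F G :: wiener and c :: real
  show "norm (F * G) \<le> norm F * norm G"
    unfolding norm_wiener_def coef_mult by (rule Cauchy_product_nat_pairs(3)[OF coef_summable coef_summable])
  show "norm (1::wiener) = 1"
  proof -
    have "((\<lambda>n. \<bar>coef 1 n\<bar>) has_sum 1) UNIV"
      by (rule has_sum_finite_neutralI[of "{(0,0)}"]) (auto simp: coef_one)
    then show ?thesis using norm_wiener_has_sum has_sum_unique by blast
  qed
  show "(norm F = 0) = (F = 0)"
    using abs_coef_le_norm[of F] by (auto simp: norm_wiener_def intro!: wiener_eqI)
  show "norm (F + G) \<le> norm F + norm G"
    by (rule has_sum_mono[OF norm_wiener_has_sum has_sum_add[OF norm_wiener_has_sum norm_wiener_has_sum]]) auto
  show "norm (c *\<^sub>R F) = \<bar>c\<bar> * norm F"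
    using has_sum_cmult_right[OF norm_wiener_has_sum, of "\<bar>c\<bar>" F] norm_wiener_has_sum[of "c *\<^sub>R F"]
    by (auto simp: abs_mult intro: has_sum_unique)
qed (simp_all add: sgn_wiener_def dist_wiener_def uniformity_wiener_def open_wiener_def)

end

lemma norm_wiener_leI: "(\<And>A. finite A \<Longrightarrow> (\<Sum>n\<in>A. \<bar>coef F n\<bar>) \<le> c) \<Longrightarrow> norm F \<le> c"
  using norm_wiener_has_sum[of F] by (rule has_sum_le_finite_sums) simp

lift_definition series :: "(nat \<times> nat \<Rightarrow> real) \<Rightarrow> wiener" is
  "\<lambda>c. if (\<lambda>n. norm (c n)) summable_on UNIV then Abs_fps2 c else 0"
  by (auto simp: fps2_nth_Abs)

lemma coef_series: "(\<lambda>n. norm (c n)) summable_on UNIV \<Longrightarrow> coef (series c) = c"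
  by transfer (simp add: fps2_nth_Abs)

text \<open>Fatou's lemma for l^1: bounds on finite partial sums survive coefficientwise limits, so
  this supplies the limit both for completeness and for compactness.\<close>

lemma exists_wiener_bounded:
  assumes "\<And>A. finite A \<Longrightarrow> (\<Sum>n\<in>A. \<bar>c n\<bar>) \<le> M"
  obtains F where "coef F = c" "norm F \<le> M"
proof -
  have "(\<lambda>n. norm (c n)) summable_on UNIV"
    by (rule nonneg_bdd_above_summable_on, simp, rule bdd_aboveI2[where M = M]) (simp add: assms)
  then have "coef (series c) = c" by (rule coef_series)
  moreover then have "norm (series c) \<le> M" by (intro norm_wiener_leI) (simp add: assms)
  ultimately show thesis by (rule that)
qed

instance wiener :: banach
proof
  fix X :: "nat \<Rightarrow> wiener"
  assume X: "Cauchy X"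
  have "Cauchy (\<lambda>k. coef (X k) n)" for n
  proof (rule metric_CauchyI)
    fix e :: real assume "e > 0"
    from metric_CauchyD[OF X this] obtain M where "\<forall>m\<ge>M. \<forall>n\<ge>M. dist (X m) (X n) < e" by blast
    moreover have "dist (coef (X a) n) (coef (X b) n) \<le> dist (X a) (X b)" for a b
      using abs_coef_le_norm[of "X a - X b" n] by (simp add: dist_norm)
    ultimately show "\<exists>M. \<forall>a\<ge>M. \<forall>b\<ge>M. dist (coef (X a) n) (coef (X b) n) < e"
      by (meson order_le_less_trans)
  qed
  then have "\<exists>l. (\<lambda>k. coef (X k) n) \<longlonglongrightarrow> l" for n
    using Cauchy_convergent convergent_def by blast
  then obtain c where c: "\<And>n. (\<lambda>k. coef (X k) n) \<longlonglongrightarrow> c n"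
    by metis
  have fin: "(\<Sum>n\<in>A. \<bar>coef (X a) n - c n\<bar>) \<le> e"
    if "finite A" and "\<And>b. b \<ge> N \<Longrightarrow> norm (X a - X b) \<le> e" for A a e N
  proof (rule LIMSEQ_le_const2)
    show "(\<lambda>k. \<Sum>n\<in>A. \<bar>coef (X a) n - coef (X k) n\<bar>) \<longlonglongrightarrow> (\<Sum>n\<in>A. \<bar>coef (X a) n - c n\<bar>)"
      by (intro tendsto_sum tendsto_rabs tendsto_diff tendsto_const c)
    have "(\<Sum>n\<in>A. \<bar>coef (X a) n - coef (X k) n\<bar>) \<le> norm (X a - X k)" for k
      using finite_sum_le_has_sum[OF norm_wiener_has_sum \<open>finite A\<close>, of "X a - X k"] by simp
    then show "\<exists>N. \<forall>k\<ge>N. (\<Sum>n\<in>A. \<bar>coef (X a) n - coef (X k) n\<bar>) \<le> e"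
      using that(2) order_trans by blast
  qed
  have ball: "\<exists>N. \<forall>a\<ge>N. \<forall>b\<ge>N. norm (X a - X b) \<le> e" if "e > 0" for e
    using metric_CauchyD[OF X that] unfolding dist_norm by (meson less_imp_le)
  obtain N0 where N0: "\<forall>a\<ge>N0. \<forall>b\<ge>N0. norm (X a - X b) \<le> 1" using ball[of 1] by auto
  have "(\<Sum>n\<in>A. \<bar>coef (X N0) n - c n\<bar>) \<le> 1" if "finite A" for A
    by (rule fin[OF that, where N = N0]) (use N0 in auto)
  \<comment> \<open>Summability of the limit coefficients \<open>c\<close> is not known yet, but by
    \<open>fin\<close> that of their difference from \<open>X N0\<close> is; so the limit is written
    as \<open>X N0 - D\<close>.\<close>
  from exists_wiener_bounded[OF this] obtain D where D: "coef D = (\<lambda>n. coef (X N0) n - c n)"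
    by blast
  have "X \<longlonglongrightarrow> X N0 - D"
  proof (rule metric_LIMSEQ_I)
    fix e :: real assume "e > 0"
    then obtain N where N: "\<forall>a\<ge>N. \<forall>b\<ge>N. norm (X a - X b) \<le> e / 2" using ball[of "e/2"] by auto
    have "dist (X a) (X N0 - D) < e" if "a \<ge> N" for a
    proof -
      have "norm (X a - (X N0 - D)) \<le> e / 2"
      proof (rule norm_wiener_leI)
        fix A :: "(nat \<times> nat) set" assume "finite A"
        then have "(\<Sum>n\<in>A. \<bar>coef (X a) n - c n\<bar>) \<le> e / 2"
          by (rule fin[where N = N]) (use N that in auto)
        then show "(\<Sum>n\<in>A. \<bar>coef (X a - (X N0 - D)) n\<bar>) \<le> e / 2" by (simp add: D)
      qed
      then show ?thesis using \<open>e > 0\<close> by (simp add: dist_norm del: diff_diff_eq2)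
    qed
    then show "\<exists>N. \<forall>a\<ge>N. dist (X a) (X N0 - D) < e" by blast
  qed
  then show "convergent X" by (auto simp: convergent_def)
qed

section \<open>Evaluation of series in a Banach algebra, and composition\<close>

definition bidisc :: "real \<Rightarrow> ('b::real_normed_vector ^ 2) set" where
  "bidisc \<theta> = {a. norm (a $ 1) \<le> \<theta> \<and> norm (a $ 2) \<le> \<theta>}"

text \<open>The sum norm of a pair: estimates of the two components simply add up.\<close>

definition norm1 :: "'b::real_normed_vector ^ 2 \<Rightarrow> real" where
  "norm1 a = norm (a $ 1) + norm (a $ 2)"

definition mono2 :: "'b::comm_ring_1 ^ 2 \<Rightarrow> nat \<times> nat \<Rightarrow> 'b" where
  "mono2 a n = (a $ 1) ^ fst n * (a $ 2) ^ snd n"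

text \<open>For \<open>'b = real\<close> this is the value at a point; for
  \<open>'b = wiener\<close> it substitutes two series, that is, it composes. General results on
  \<open>'b\<close> serve both.\<close>

definition app :: "wiener \<Rightarrow> 'b::{comm_ring_1,real_normed_algebra_1,banach} ^ 2 \<Rightarrow> 'b" where
  "app F a = (\<Sum>\<^sub>\<infinity>n. coef F n *\<^sub>R mono2 a n)"

definition appv :: "wiener ^ 2 \<Rightarrow> 'b::{comm_ring_1,real_normed_algebra_1,banach} ^ 2 \<Rightarrow> 'b ^ 2" where
  "appv F a = (\<chi> l. app (F $ l) a)"

lemma bidisc_iff: "a \<in> bidisc \<theta> \<longleftrightarrow> (\<forall>l. norm (a $ l) \<le> \<theta>)"
  by (auto simp: bidisc_def forall_2)

lemma bidisc_nth: "a \<in> bidisc \<theta> \<Longrightarrow> norm (a $ l) \<le> \<theta>"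
  by (simp add: bidisc_iff)

lemma bidisc_mono: "a \<in> bidisc \<theta> \<Longrightarrow> \<theta> \<le> \<theta>' \<Longrightarrow> a \<in> bidisc \<theta>'"
  by (auto simp: bidisc_def)

lemma norm_in_bidisc: "norm a \<le> \<theta> \<Longrightarrow> a \<in> bidisc \<theta>"
  using Finite_Cartesian_Product.norm_nth_le[of a] order_trans by (auto simp: bidisc_iff)

lemma norm1_in_bidisc: "norm1 a \<le> \<theta> \<Longrightarrow> a \<in> bidisc \<theta>"
  by (auto simp: bidisc_def norm1_def) (smt (verit) norm_ge_zero)+

lemma norm1_ge_zero [simp]: "0 \<le> norm1 a" by (simp add: norm1_def)

lemma norm1_eq_zero [simp]: "norm1 a = 0 \<longleftrightarrow> a = 0"
  by (auto simp: norm1_def vec_eq_iff forall_2 add_nonneg_eq_0_iff)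

lemma norm1_triangle: "norm1 (a + b) \<le> norm1 a + norm1 b"
  unfolding norm1_def using norm_triangle_ineq[of "a $ 1" "b $ 1"] norm_triangle_ineq[of "a $ 2" "b $ 2"]
  by simp

lemma norm1_minus_commute: "norm1 (a - b) = norm1 (b - a)"
  by (simp add: norm1_def norm_minus_commute)

lemma norm1_scaleR [simp]: "norm1 (c *\<^sub>R a) = \<bar>c\<bar> * norm1 a"
  by (simp add: norm1_def algebra_simps)

lemma norm_le_norm1: "norm a \<le> norm1 a"
  unfolding norm_vec_def norm1_def using L2_set_le_sum[of UNIV "\<lambda>i. norm (a $ i)"] by (simp add: sum_2)

lemma norm1_le_norm: "norm1 a \<le> 2 * norm a"
  using Finite_Cartesian_Product.norm_nth_le[of a 1] Finite_Cartesian_Product.norm_nth_le[of a 2] by (simp add: norm1_def)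

lemma norm_mono2_le:
  fixes a :: "'b::{comm_ring_1,real_normed_algebra_1} ^ 2"
  assumes "a \<in> bidisc \<theta>"
  shows "norm (mono2 a n) \<le> \<theta> ^ (fst n + snd n)"
proof -
  have p: "norm ((a $ l) ^ k) \<le> \<theta> ^ k" for l k
    using norm_power_ineq[of "a $ l" k] power_mono[OF bidisc_nth[OF assms, of l] norm_ge_zero, of k]
    by (rule order_trans)
  have "0 \<le> \<theta>" using bidisc_nth[OF assms, of 1] norm_ge_zero[of "a $ 1"] by linarith
  then have "norm ((a $ 1) ^ fst n) * norm ((a $ 2) ^ snd n) \<le> \<theta> ^ fst n * \<theta> ^ snd n"
    by (intro mult_mono p) auto
  with norm_mult_ineq show ?thesis unfolding mono2_def power_add by (rule order_trans)
qed

lemma norm_mono2_le_1: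
  fixes a :: "'b::{comm_ring_1,real_normed_algebra_1} ^ 2"
  shows "a \<in> bidisc 1 \<Longrightarrow> norm (mono2 a n) \<le> 1"
  using norm_mono2_le[of a 1 n] by simp

lemma app_has_sum:
  fixes a :: "'b::{comm_ring_1,real_normed_algebra_1,banach} ^ 2"
  assumes "a \<in> bidisc 1"
  shows "(\<lambda>n. norm (coef F n *\<^sub>R mono2 a n)) summable_on UNIV"
    and "((\<lambda>n. coef F n *\<^sub>R mono2 a n) has_sum app F a) UNIV"
    and "norm (app F a) \<le> norm F"
proof -
  have le: "norm (coef F n *\<^sub>R mono2 a n) \<le> norm (coef F n)" for n
    using norm_mono2_le_1[OF assms, of n] by (simp add: mult_left_le)
  show 1: "(\<lambda>n. norm (coef F n *\<^sub>R mono2 a n)) summable_on UNIV"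
    by (rule summable_on_norm_comparison[OF coef_summable]) (rule le)
  show "((\<lambda>n. coef F n *\<^sub>R mono2 a n) has_sum app F a) UNIV"
    unfolding app_def by (rule has_sum_infsum, rule abs_summable_summable, rule 1)
  have "norm (app F a) \<le> infsum (\<lambda>n. norm (coef F n *\<^sub>R mono2 a n)) UNIV"
    unfolding app_def by (rule norm_infsum_bound) (use 1 in simp)
  also have "\<dots> \<le> norm F"
    by (rule has_sum_mono[OF has_sum_infsum[OF 1] norm_wiener_has_sum[of F]]) (use le in simp)
  finally show "norm (app F a) \<le> norm F" .
qed

lemma app_add:
  assumes "a \<in> bidisc 1"
  shows "app (F + G) a = app F a + app G a"
  using has_sum_unique[OF app_has_sum(2)[OF assms, of "F + G"]]
    has_sum_add[OF app_has_sum(2)[OF assms, of F] app_has_sum(2)[OF assms, of G]]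
  by (simp add: scaleR_add_left)

lemma app_scaleR:
  assumes "a \<in> bidisc 1"
  shows "app (c *\<^sub>R F) a = c *\<^sub>R app F a"
  using has_sum_unique[OF app_has_sum(2)[OF assms, of "c *\<^sub>R F"]]
    has_sum_bounded_linear[OF bounded_linear_scaleR_right[of c] app_has_sum(2)[OF assms, of F]]
  by simp

lemma bounded_linear_app:
  assumes "a \<in> bidisc 1"
  shows "bounded_linear (\<lambda>F. app F a)"
  by (rule bounded_linear_intro[where K = 1]) (use assms in \<open>auto simp: app_add app_scaleR app_has_sum(3)\<close>)

lemmas app_diff = linear_diff[OF bounded_linear.linear[OF bounded_linear_app]]
  and app_zero = linear_0[OF bounded_linear.linear[OF bounded_linear_app]]

lemma app_one: "app 1 a = 1"
  unfolding app_def
  by (rule infsumI, rule has_sum_finite_neutralI[of "{(0,0)}"]) (auto simp: coef_one mono2_def)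

lemma mono2_add: "mono2 a (fst n + fst m, snd n + snd m) = mono2 a n * mono2 a m"
  by (simp add: mono2_def power_add algebra_simps)

lemma app_mult:
  fixes a :: "'b::{comm_ring_1,real_normed_algebra_1,banach} ^ 2"
  assumes a: "a \<in> bidisc 1"
  shows "app (F * G) a = app F a * app G a"
proof -
  let ?f = "\<lambda>H n. coef H n *\<^sub>R mono2 a n"
  have *: "(\<lambda>(i, j). \<Sum>k\<le>i. \<Sum>l\<le>j. ?f F (k, l) * ?f G (i - k, j - l)) = ?f (F * G)"
  proof
    fix n :: "nat \<times> nat"
    obtain i j where n: "n = (i, j)" by (cases n)
    have mm: "?f F (k, l) * ?f G (i - k, j - l) = (coef F (k, l) * coef G (i - k, j - l)) *\<^sub>R mono2 a n"
      if "k \<le> i" "l \<le> j" for k l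
    proof -
      have "mono2 a (k, l) * mono2 a (i - k, j - l) = mono2 a n"
        using mono2_add[of a "(k, l)" "(i - k, j - l)"] that n by simp
      then show ?thesis by (simp add: mult.commute)
    qed
    have "(\<Sum>k\<le>i. \<Sum>l\<le>j. ?f F (k, l) * ?f G (i - k, j - l))
        = (\<Sum>k\<le>i. \<Sum>l\<le>j. (coef F (k, l) * coef G (i - k, j - l)) *\<^sub>R mono2 a n)"
      by (rule sum.cong[OF refl], rule sum.cong[OF refl], rule mm) auto
    then show "(\<lambda>(i, j). \<Sum>k\<le>i. \<Sum>l\<le>j. ?f F (k, l) * ?f G (i - k, j - l)) n = ?f (F * G) n"
      by (simp only: n coef_mult prod.case scaleR_sum_left)
  qed
  have "(?f (F * G) has_sum app F a * app G a) UNIV"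
    using Cauchy_product_nat_pairs(2)[OF app_has_sum(1)[OF a, of F] app_has_sum(1)[OF a, of G]]
    unfolding * app_def .
  then show ?thesis
    using app_has_sum(2)[OF a] has_sum_unique by blast
qed

text \<open>A bounded unital homomorphism commutes with monomials and with infinite sums. Taking
  evaluation at a pair \<open>b\<close> as \<open>T\<close> gives associativity of substitution:
  composing series and then evaluating is the same as evaluating one after the other.\<close>

lemma hom_app:
  fixes a :: "'b::{comm_ring_1,real_normed_algebra_1,banach} ^ 2"
    and T :: "'b \<Rightarrow> 'c::{comm_ring_1,real_normed_algebra_1,banach}"
  assumes a: "a \<in> bidisc 1" and T: "bounded_linear T" "\<And>x y. T (x * y) = T x * T y" "T 1 = 1"
  shows "T (app F a) = app F (\<chi> l. T (a $ l))"
proof -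
  have pow: "T (x ^ k) = T x ^ k" for x k by (induction k) (auto simp: T)
  have "T (mono2 a n) = mono2 (\<chi> l. T (a $ l)) n" for n
    by (simp add: mono2_def T pow)
  then have "((\<lambda>n. coef F n *\<^sub>R mono2 (\<chi> l. T (a $ l)) n) has_sum T (app F a)) UNIV"
    using has_sum_bounded_linear[OF T(1) app_has_sum(2)[OF a, of F]]
    by (simp add: linear_scale[OF bounded_linear.linear[OF T(1)]])
  then show ?thesis by (simp add: app_def infsumI)
qed

lemma app_app:
  assumes "A \<in> bidisc 1" and "b \<in> bidisc 1"
  shows "app (app F A) b = app F (appv A b)"
  unfolding appv_def by (rule hom_app[OF assms(1) bounded_linear_app[OF assms(2)] app_mult[OF assms(2)] app_one])

lemma appv_nth [simp]: "appv F a $ l = app (F $ l) a"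
  by (simp add: appv_def)

lemma appv_appv: "A \<in> bidisc 1 \<Longrightarrow> b \<in> bidisc 1 \<Longrightarrow> appv (appv F A) b = appv F (appv A b)"
  by (simp add: vec_eq_iff app_app)

lemma norm1_appv_le: "a \<in> bidisc 1 \<Longrightarrow> norm1 (appv F a) \<le> norm1 F"
  by (simp add: norm1_def add_mono app_has_sum(3))

lemma appv_simps:
  assumes "a \<in> bidisc 1"
  shows "appv (F + G) a = appv F a + appv G a" "appv (F - G) a = appv F a - appv G a"
    "appv (c *\<^sub>R F) a = c *\<^sub>R appv F a" "appv 0 a = 0"
  by (simp_all add: vec_eq_iff app_add[OF assms] app_diff[OF assms] app_scaleR[OF assms] app_zero[OF assms])

subsection \<open>Coordinates and rescaling\<close>

lift_definition coord1 :: wiener is "fps_X"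
  by (rule finite_nonzero_values_imp_summable_on, rule finite_subset[of _ "{(1, 0)}"])
    (auto simp: fps2_nth_def fps_X_def split: if_splits)

lift_definition coord2 :: wiener is "fps_const fps_X"
  by (rule finite_nonzero_values_imp_summable_on, rule finite_subset[of _ "{(0, 1)}"])
    (auto simp: fps2_nth_def fps_X_def split: if_splits)

definition coords :: "wiener ^ 2" where "coords = vector [coord1, coord2]"

lemma coords_nth [simp]: "coords $ 1 = coord1" "coords $ 2 = coord2"
  by (simp_all add: coords_def)

lemma coef_coord1_mult: "coef (coord1 * F) n = (if fst n = 0 then 0 else coef F (fst n - 1, snd n))"
  by transfer (simp add: fps2_nth_def)

lemma coef_coord2_mult: "coef (coord2 * F) n = (if snd n = 0 then 0 else coef F (fst n, snd n - 1))"
  by transfer (simp add: fps2_nth_def)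

lemma coef_coord2_power: "coef (coord2 ^ j) n = (if n = (0, j) then 1 else 0)"
  by (induction j arbitrary: n) (auto simp: coef_one coef_coord2_mult prod_eq_iff)

lemma coef_mono2_coords: "coef (mono2 coords m) n = (if n = m then 1 else 0)"
proof -
  have "coef (coord1 ^ i * coord2 ^ j) n = (if n = (i, j) then 1 else 0)" for i j
    by (induction i arbitrary: n) (auto simp: coef_coord2_power coef_coord1_mult prod_eq_iff mult.assoc)
  then show ?thesis by (cases m) (simp add: mono2_def)
qed

lemma mono2_scaleR: "mono2 (s *\<^sub>R a) n = s ^ (fst n + snd n) *\<^sub>R mono2 a n"
  for a :: "'b::{comm_ring_1,real_algebra_1} ^ 2"
proof -
  have "(s *\<^sub>R x) ^ k = s ^ k *\<^sub>R x ^ k" for x :: 'b and k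
    by (induction k) simp_all
  then show ?thesis by (simp add: mono2_def power_add mult.commute)
qed

lemma norm_coord: "norm coord1 = 1" "norm coord2 = 1"
proof -
  have "norm (mono2 coords m) = 1" for m
  proof -
    have "((\<lambda>n. \<bar>coef (mono2 coords m) n\<bar>) has_sum 1) UNIV"
      by (rule has_sum_finite_neutralI[of "{m}"]) (auto simp: coef_mono2_coords)
    then show ?thesis using norm_wiener_has_sum has_sum_unique by blast
  qed
  from this[of "(1, 0)"] this[of "(0, 1)"] show "norm coord1 = 1" "norm coord2 = 1"
    by (simp_all add: mono2_def)
qed

lemma scaled_coords_in_bidisc: "\<bar>s\<bar> \<le> \<theta> \<Longrightarrow> s *\<^sub>R coords \<in> bidisc \<theta>"
  by (simp add: bidisc_def norm_coord)

lemma norm1_coords [simp]: "norm1 coords = 2"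
  by (simp add: norm1_def norm_coord)

lemma coef_eq_bounded_linear: "bounded_linear (\<lambda>F. coef F n)"
  by (rule bounded_linear_intro[where K = 1]) (auto simp: abs_coef_le_norm)

text \<open>Monomials in \<open>s *\<^sub>R coords\<close> are scaled monomials, so the coefficients
  of total degree d are damped by the factor s^d. This damping is the source of compactness.\<close>

lemma coef_app_scaled_coords:
  assumes "\<bar>s\<bar> \<le> 1"
  shows "coef (app F (s *\<^sub>R coords)) n = s ^ (fst n + snd n) * coef F n"
proof -
  have "((\<lambda>m. coef (coef F m *\<^sub>R mono2 (s *\<^sub>R coords) m) n) has_sum coef (app F (s *\<^sub>R coords)) n) UNIV"
    by (rule has_sum_bounded_linear[OF coef_eq_bounded_linear app_has_sum(2)[OF scaled_coords_in_bidisc[OF assms]]])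
  moreover have "((\<lambda>m. coef (coef F m *\<^sub>R mono2 (s *\<^sub>R coords) m) n) has_sum s ^ (fst n + snd n) * coef F n) UNIV"
    by (rule has_sum_finite_neutralI[of "{n}"]) (auto simp: mono2_scaleR coef_mono2_coords)
  ultimately show ?thesis by (rule has_sum_unique)
qed

lemma app_coords [simp]: "app F coords = F"
  using coef_app_scaled_coords[of 1 F] by (intro wiener_eqI) simp

lemma appv_coords [simp]: "appv F coords = F"
  by (simp add: vec_eq_iff)

lemma app_coord [simp]: "app coord1 a = a $ 1" "app coord2 a = a $ 2"
proof -
  have "coef (mono2 coords (1, 0)) = coef coord1" "coef (mono2 coords (0, 1)) = coef coord2"
    by (simp_all add: mono2_def)
  then have c: "coef coord1 = (\<lambda>n. if n = (1, 0) then 1 else 0)"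
      "coef coord2 = (\<lambda>n. if n = (0, 1) then 1 else 0)"
    by (auto simp: coef_mono2_coords fun_eq_iff)
  show "app coord1 a = a $ 1" unfolding app_def
    by (rule infsumI, rule has_sum_finite_neutralI[of "{(1, 0)}"]) (auto simp: c mono2_def)
  show "app coord2 a = a $ 2" unfolding app_def
    by (rule infsumI, rule has_sum_finite_neutralI[of "{(0, 1)}"]) (auto simp: c mono2_def)
qed

lemma appv_scaled_coords: "a \<in> bidisc 1 \<Longrightarrow> appv (s *\<^sub>R coords) a = s *\<^sub>R a"
  by (simp add: vec_eq_iff forall_2 app_scaleR)

lemma norm_power_le_1:
  fixes x :: "'b::real_normed_algebra_1"
  assumes "norm x \<le> 1"
  shows "norm (x ^ k) \<le> 1"
  by (rule order_trans[OF norm_power_ineq]) (simp add: power_le_one assms)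

text \<open>The constant 4 = 1 / (1 - 3/4) solves c = 3/4 * c + 1 and so closes the induction. It
  does not depend on the exponent, hence the bound sums against the coefficients of any
  series.\<close>

lemma norm_power_diff_le:
  fixes a b :: "'b::{comm_ring_1,real_normed_algebra_1}"
  assumes "norm a \<le> 3/4" "norm b \<le> 3/4"
  shows "norm (a ^ n - b ^ n) \<le> 4 * norm (a - b)"
proof (induction n)
  case (Suc n)
  have b: "norm (b ^ n) \<le> 1"
    using assms(2) by (intro norm_power_le_1) simp
  have "a ^ Suc n - b ^ Suc n = a * (a ^ n - b ^ n) + (a - b) * b ^ n"
    by (simp add: algebra_simps)
  also have "norm \<dots> \<le> norm a * norm (a ^ n - b ^ n) + norm (a - b) * norm (b ^ n)"
    by (intro norm_triangle_le add_mono norm_mult_ineq)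
  also have "\<dots> \<le> 3/4 * (4 * norm (a - b)) + norm (a - b) * 1"
    by (intro add_mono mult_mono) (use assms b Suc in auto)
  finally show ?case by simp
qed simp

lemma norm_app_diff_le:
  fixes a b :: "'b::{comm_ring_1,real_normed_algebra_1,banach} ^ 2"
  assumes "a \<in> bidisc (3/4)" "b \<in> bidisc (3/4)"
  shows "norm (app F a - app F b) \<le> 4 * norm F * norm1 (a - b)"
proof -
  have a1: "a \<in> bidisc 1" and b1: "b \<in> bidisc 1" using assms by (auto intro: bidisc_mono)
  have pow: "norm (x ^ k) \<le> 1" if "norm x \<le> 3/4" for x :: 'b and k
    using that by (intro norm_power_le_1) simp
  have m: "norm (mono2 a n - mono2 b n) \<le> 4 * norm1 (a - b)" for n
  proof -
    have "mono2 a n - mono2 b n = ((a $ 1) ^ fst n - (b $ 1) ^ fst n) * (a $ 2) ^ snd n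
        + (b $ 1) ^ fst n * ((a $ 2) ^ snd n - (b $ 2) ^ snd n)"
      by (simp add: mono2_def algebra_simps)
    also have "norm \<dots> \<le> norm ((a $ 1) ^ fst n - (b $ 1) ^ fst n) * norm ((a $ 2) ^ snd n)
        + norm ((b $ 1) ^ fst n) * norm ((a $ 2) ^ snd n - (b $ 2) ^ snd n)"
      by (intro norm_triangle_le add_mono norm_mult_ineq)
    also have "\<dots> \<le> 4 * norm (a $ 1 - b $ 1) * 1 + 1 * (4 * norm (a $ 2 - b $ 2))"
      by (intro add_mono mult_mono norm_power_diff_le pow) (use assms in \<open>auto simp: bidisc_def\<close>)
    finally show ?thesis by (simp add: norm1_def)
  qed
  have "((\<lambda>n. coef F n *\<^sub>R mono2 a n - coef F n *\<^sub>R mono2 b n) has_sum app F a - app F b) UNIV"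
    using has_sum_add[OF app_has_sum(2)[OF a1] has_sum_uminusI[OF app_has_sum(2)[OF b1]]]
    by simp
  moreover have "((\<lambda>n. \<bar>coef F n\<bar> * (4 * norm1 (a - b))) has_sum norm F * (4 * norm1 (a - b))) UNIV"
    by (rule has_sum_cmult_left[OF norm_wiener_has_sum])
  ultimately have "norm (app F a - app F b) \<le> norm F * (4 * norm1 (a - b))"
  proof (rule norm_infsum_le)
    show "norm (coef F n *\<^sub>R mono2 a n - coef F n *\<^sub>R mono2 b n) \<le> \<bar>coef F n\<bar> * (4 * norm1 (a - b))" for n
      using mult_left_mono[OF m, of "\<bar>coef F n\<bar>"] by (simp add: scaleR_diff_right[symmetric] del: scaleR_diff_right)
  qed
  then show ?thesis by (simp add: algebra_simps)
qed

subsection \<open>Identity theorem and compactness\<close>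

text \<open>Once the lower coefficients vanish, divide the series by x^n and let x tend to
  0.\<close>

lemma power_series_zero_coeffs:
  fixes a :: "nat \<Rightarrow> real"
  assumes "0 < r" and z: "\<And>x. \<bar>x\<bar> < r \<Longrightarrow> ((\<lambda>i. a i * x ^ i) has_sum 0) UNIV"
  shows "a n = 0"
proof (induction n rule: less_induct)
  case (less n)
  have "((\<lambda>x. 0) \<longlongrightarrow> a (0 + n)) (at (0::real))"
  proof (rule powser_limit_0_strong[OF \<open>0 < r\<close>])
    fix x :: real assume x: "x \<noteq> 0" "norm x < r"
    have "(\<lambda>i. a i * x ^ i) sums 0"
      by (rule has_sum_imp_sums[OF z]) (use x in simp)
    moreover have "a i * x ^ i = 0" if "i < n" for i using less[OF that] by simp
    ultimately have "(\<lambda>i. a (i + n) * x ^ (i + n)) sums 0"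
      using sums_zero_iff_shift[of n "\<lambda>i. a i * x ^ i" 0] by blast
    from sums_mult[OF this, of "inverse (x ^ n)"]
    have "(\<lambda>i. inverse (x ^ n) * (a (i + n) * x ^ (i + n))) sums 0" by simp
    moreover have "inverse (x ^ n) * (a (i + n) * x ^ (i + n)) = a (i + n) * x ^ i" for i
      using x by (simp add: power_add)
    ultimately show "(\<lambda>i. a (i + n) * x ^ i) sums 0" by simp
  qed
  from LIM_unique[OF tendsto_const this] show ?case by simp
qed

text \<open>The one-variable statement is used twice: for fixed \<open>t\<close> in the first
  variable, where the coefficients are the values \<open>b i t\<close>, and then for each
  \<open>b i\<close> as a series in \<open>t\<close>.\<close>

lemma wiener_identity:
  assumes "\<forall>\<^sub>F x in nhds (0 :: real ^ 2). app F x = app G x"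
  shows "F = G"
proof (rule wiener_eqI)
  fix n :: "nat \<times> nat"
  obtain i0 j0 where n: "n = (i0, j0)" by (cases n)
  define D where "D = F - G"
  obtain r where r: "0 < r" "\<And>x :: real ^ 2. dist x 0 < r \<Longrightarrow> app F x = app G x"
    using assms by (auto simp: eventually_nhds_metric)
  define e where "e = min (r / 2) 1"
  have e: "0 < e" "e \<le> 1" "e \<le> r / 2" using r by (auto simp: e_def)
  have c: "(\<lambda>j. norm (coef D (i, j))) summable_on UNIV" for i
    using summable_on_SigmaD1[of "\<lambda>i j. norm (coef D (i, j))" UNIV "\<lambda>_. UNIV" i] coef_summable[of D]
    by (simp add: case_prod_unfold)
  define b where "b i t = (\<Sum>\<^sub>\<infinity>j. coef D (i, j) * t ^ j)" for i t
  have b: "((\<lambda>j. coef D (i, j) * t ^ j) has_sum b i t) UNIV" if "\<bar>t\<bar> < e" for i t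
    unfolding b_def
    by (rule has_sum_infsum, rule abs_summable_summable, rule summable_on_norm_comparison[OF c[of i]])
      (use that e in \<open>auto simp: abs_mult power_abs intro!: mult_left_le power_le_one\<close>)
  have b0: "b i t = 0" if t: "\<bar>t\<bar> < e" for i t
  proof (rule power_series_zero_coeffs[OF \<open>0 < e\<close>])
    fix s :: real assume s: "\<bar>s\<bar> < e"
    define x :: "real ^ 2" where "x = vector [s, t]"
    have x: "x $ 1 = s" "x $ 2 = t" by (simp_all add: x_def)
    have "norm x \<le> \<bar>s\<bar> + \<bar>t\<bar>" using norm_le_norm1[of x] by (simp add: norm1_def x)
    then have "norm x < r" using s t e by linarith
    have "x \<in> bidisc 1" using s t e by (simp add: bidisc_def x)
    then have "app D x = 0" using r(2)[of x] \<open>norm x < r\<close> by (simp add: D_def app_diff)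
    with app_has_sum(2)[OF \<open>x \<in> bidisc 1\<close>, of D]
    have "((\<lambda>n. coef D n * (s ^ fst n * t ^ snd n)) has_sum 0) (UNIV \<times> UNIV)"
      by (simp add: mono2_def x)
    then show "((\<lambda>i. b i t * s ^ i) has_sum 0) UNIV"
      by (rule has_sum_SigmaD) (use has_sum_cmult_left[OF b[OF t]] in \<open>simp add: algebra_simps\<close>)
  qed
  have "coef D (i0, j0) = 0"
  proof (rule power_series_zero_coeffs[OF \<open>0 < e\<close>, of "\<lambda>j. coef D (i0, j)"])
    show "((\<lambda>j. coef D (i0, j) * t ^ j) has_sum 0) UNIV" if "\<bar>t\<bar> < e" for t
      using b[OF that, of i0] b0[OF that, of i0] by simp
  qed
  then show "coef F n = coef G n" by (simp add: D_def n)
qed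

abbreviation half_coords :: "wiener ^ 2" where "half_coords \<equiv> (1/2) *\<^sub>R coords"

text \<open>Outside the square the total degree is at least \<open>K\<close>, so halving damps by
  (1/2)^K; inside it only finitely many coefficients remain. Thus bounded coefficientwise
  convergence becomes norm convergence after halving.\<close>

lemma norm_app_half_coords_le:
  assumes "norm D \<le> M"
  shows "norm (app D half_coords) \<le> (\<Sum>n\<in>{..<K} \<times> {..<K}. \<bar>coef D n\<bar>) + M * (1/2) ^ K"
proof (rule norm_wiener_leI)
  fix A :: "(nat \<times> nat) set" assume A: "finite A"
  let ?B = "{..<K} \<times> {..<K}"
  have "\<bar>coef (app D half_coords) n\<bar> \<le> (if n \<in> ?B then \<bar>coef D n\<bar> else 0) + (1/2) ^ K * \<bar>coef D n\<bar>" for n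
  proof (cases "n \<in> ?B")
    case True
    have "(1/2 :: real) ^ (fst n + snd n) * \<bar>coef D n\<bar> \<le> 1 * \<bar>coef D n\<bar>"
      by (intro mult_right_mono power_le_one) auto
    moreover have "0 \<le> (1/2 :: real) ^ K * \<bar>coef D n\<bar>" by (intro mult_nonneg_nonneg) auto
    moreover have "\<bar>coef (app D half_coords) n\<bar> = (1/2) ^ (fst n + snd n) * \<bar>coef D n\<bar>"
      by (simp add: coef_app_scaled_coords abs_mult)
    ultimately show ?thesis using True by (simp only: if_True)
  next
    case False
    then have "K \<le> fst n + snd n" by (auto simp: mem_Times_iff)
    then have "(1/2 :: real) ^ (fst n + snd n) \<le> (1/2) ^ K" by (intro power_decreasing) auto
    with False show ?thesis
      by (simp add: coef_app_scaled_coords abs_mult mult_right_mono del: power_add)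
  qed
  then have "(\<Sum>n\<in>A. \<bar>coef (app D half_coords) n\<bar>)
      \<le> (\<Sum>n\<in>A. (if n \<in> ?B then \<bar>coef D n\<bar> else 0) + (1/2) ^ K * \<bar>coef D n\<bar>)"
    by (intro sum_mono)
  also have "\<dots> = (\<Sum>n\<in>A. if n \<in> ?B then \<bar>coef D n\<bar> else 0) + (1/2) ^ K * (\<Sum>n\<in>A. \<bar>coef D n\<bar>)"
    by (simp only: sum.distrib sum_distrib_left)
  also have "\<dots> \<le> (\<Sum>n\<in>?B. \<bar>coef D n\<bar>) + (1/2) ^ K * M"
  proof (intro add_mono mult_left_mono)
    have "(\<Sum>n\<in>A. if n \<in> ?B then \<bar>coef D n\<bar> else 0) = (\<Sum>n\<in>A \<inter> ?B. \<bar>coef D n\<bar>)"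
      by (rule sum.inter_restrict[OF A, symmetric])
    also have "\<dots> \<le> (\<Sum>n\<in>?B. \<bar>coef D n\<bar>)" by (rule sum_mono2) auto
    finally show "(\<Sum>n\<in>A. if n \<in> ?B then \<bar>coef D n\<bar> else 0) \<le> (\<Sum>n\<in>?B. \<bar>coef D n\<bar>)" .
    show "(\<Sum>n\<in>A. \<bar>coef D n\<bar>) \<le> M"
      using finite_sum_le_has_sum[OF norm_wiener_has_sum A, of D] assms by simp
  qed auto
  finally show "(\<Sum>n\<in>A. \<bar>coef (app D half_coords) n\<bar>) \<le> (\<Sum>n\<in>?B. \<bar>coef D n\<bar>) + M * (1/2) ^ K"
    by (simp add: mult.commute)
qed

text \<open>A form of Montel's theorem: a subsequence converges coefficientwise, the limit is in the
  algebra by \<open>exists_wiener_bounded\<close>, and halving the disc upgrades the convergence to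
  the norm.\<close>

lemma wiener_bounded_imp_convergent_subsequence:
  assumes M: "\<And>n::nat. norm (F n) \<le> M"
  obtains r L where "strict_mono r" "norm L \<le> M"
    "(\<lambda>n. app (F (r n)) half_coords) \<longlonglongrightarrow> app L half_coords"
proof -
  have M': "norm (coef (F n) x) \<le> M" for n x
    using abs_coef_le_norm[of "F n" x] M[of n] by simp
  obtain r where r: "strict_mono (r :: nat \<Rightarrow> nat)" "\<And>x. x \<in> UNIV \<Longrightarrow> \<exists>l. (\<lambda>n. coef (F (r n)) x) \<longlonglongrightarrow> l"
    using function_convergent_subsequence[OF countableI_type[of UNIV], of "\<lambda>n. coef (F n)" M, OF M'] by blast
  have "\<forall>x. \<exists>l. (\<lambda>n. coef (F (r n)) x) \<longlonglongrightarrow> l" using r(2) by blast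
  from choice[OF this] obtain c where c: "\<And>x. (\<lambda>n. coef (F (r n)) x) \<longlonglongrightarrow> c x" by blast
  have "(\<Sum>n\<in>A. \<bar>c n\<bar>) \<le> M" if "finite A" for A
  proof (rule LIMSEQ_le_const2)
    show "(\<lambda>k. \<Sum>n\<in>A. \<bar>coef (F (r k)) n\<bar>) \<longlonglongrightarrow> (\<Sum>n\<in>A. \<bar>c n\<bar>)"
      by (intro tendsto_sum tendsto_rabs c)
    have "(\<Sum>n\<in>A. \<bar>coef (F (r k)) n\<bar>) \<le> M" for k
      using finite_sum_le_has_sum[OF norm_wiener_has_sum that, of "F (r k)"] M[of "r k"] by simp
    then show "\<exists>N. \<forall>k\<ge>N. (\<Sum>n\<in>A. \<bar>coef (F (r k)) n\<bar>) \<le> M" by blast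
  qed
  from exists_wiener_bounded[OF this] obtain L where L: "coef L = c" "norm L \<le> M" by blast
  have "(\<lambda>n. app (F (r n)) half_coords) \<longlonglongrightarrow> app L half_coords"
  proof (rule tendsto_norm_zero_cancel[THEN LIM_zero_cancel], rule order_tendstoI)
    fix e :: real
    show "\<forall>\<^sub>F n in sequentially. e < norm (app (F (r n)) half_coords - app L half_coords)" if "e < 0"
      using that by (intro always_eventually allI) (smt (verit) norm_ge_zero)
    assume "0 < e"
    have "0 \<le> M" using M[of 0] norm_ge_zero[of "F 0"] by linarith
    have "(\<lambda>K. (2 * M) * (1/2 :: real) ^ K) \<longlonglongrightarrow> (2 * M) * 0"
      by (intro tendsto_mult tendsto_const LIMSEQ_realpow_zero) auto
    then have "\<forall>\<^sub>F K in sequentially. (2 * M) * (1/2 :: real) ^ K < e / 2"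
      using \<open>0 < e\<close> by (intro order_tendstoD(2)) auto
    then obtain K where K: "(2 * M) * (1/2 :: real) ^ K < e / 2"
      by (auto simp: eventually_sequentially)
    have "(\<lambda>k. \<Sum>n\<in>{..<K} \<times> {..<K}. \<bar>coef (F (r k)) n - c n\<bar>) \<longlonglongrightarrow> (\<Sum>n\<in>{..<K} \<times> {..<K}. \<bar>c n - c n\<bar>)"
      by (intro tendsto_sum tendsto_rabs tendsto_diff tendsto_const c)
    then have "\<forall>\<^sub>F k in sequentially. (\<Sum>n\<in>{..<K} \<times> {..<K}. \<bar>coef (F (r k)) n - c n\<bar>) < e / 2"
      using \<open>0 < e\<close> by (intro order_tendstoD(2)) auto
    then show "\<forall>\<^sub>F n in sequentially. norm (app (F (r n)) half_coords - app L half_coords) < e"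
    proof eventually_elim
      case (elim k)
      have h: "half_coords \<in> bidisc 1" by (rule scaled_coords_in_bidisc) simp
      have "norm (F (r k) - L) \<le> 2 * M"
        using norm_triangle_ineq4[of "F (r k)" L] M[of "r k"] L(2) by linarith
      from norm_app_half_coords_le[OF this, of K] elim K show ?case
        by (simp add: app_diff[OF h] L(1))
    qed
  qed
  with r(1) L(2) show thesis by (rule that)
qed

lemma wiener_vec_bounded_imp_convergent_subsequence:
  assumes M: "\<And>n::nat. norm1 (F n) \<le> M"
  obtains r L where "strict_mono r" "norm1 L \<le> 2 * M"
    "(\<lambda>n. appv (F (r n)) half_coords) \<longlonglongrightarrow> appv L half_coords"
proof -
  have M1: "norm (F n $ 1) \<le> M" and M2: "norm (F n $ 2) \<le> M" for n
    using M[of n] norm_ge_zero[of "F n $ 1"] norm_ge_zero[of "F n $ 2"] unfolding norm1_def by linarith+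
  obtain r1 L1 where 1: "strict_mono r1" "norm L1 \<le> M"
    "(\<lambda>n. app (F (r1 n) $ 1) half_coords) \<longlonglongrightarrow> app L1 half_coords"
    using wiener_bounded_imp_convergent_subsequence[of "\<lambda>n. F n $ 1", OF M1] by blast
  obtain r2 L2 where 2: "strict_mono r2" "norm L2 \<le> M"
    "(\<lambda>n. app (F (r1 (r2 n)) $ 2) half_coords) \<longlonglongrightarrow> app L2 half_coords"
    using wiener_bounded_imp_convergent_subsequence[of "\<lambda>n. F (r1 n) $ 2", OF M2] by blast
  have "(\<lambda>n. app (F (r1 (r2 n)) $ 1) half_coords) \<longlonglongrightarrow> app L1 half_coords"
    using LIMSEQ_subseq_LIMSEQ[OF 1(3) 2(1)] by (simp add: o_def)
  then have "(\<lambda>n. appv (F ((r1 \<circ> r2) n)) half_coords) \<longlonglongrightarrow> appv (vector [L1, L2]) half_coords"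
  proof (intro vec_tendstoI)
    fix i :: 2
    show "(\<lambda>n. appv (F ((r1 \<circ> r2) n)) half_coords $ i) \<longlonglongrightarrow> appv (vector [L1, L2]) half_coords $ i"
      using exhaust_2[of i] 2(3) \<open>(\<lambda>n. app (F (r1 (r2 n)) $ 1) half_coords) \<longlonglongrightarrow> app L1 half_coords\<close>
      by (elim disjE) simp_all
  qed
  moreover have "norm1 (vector [L1, L2] :: wiener ^ 2) \<le> 2 * M"
    using 1(2) 2(2) by (simp add: norm1_def)
  ultimately show thesis
    using that strict_mono_o[OF 1(1) 2(1)] by blast
qed

lemma tendsto_norm1: "(f \<longlongrightarrow> l) F \<Longrightarrow> ((\<lambda>x. norm1 (f x - l)) \<longlongrightarrow> 0) F"
proof -
  assume f: "(f \<longlongrightarrow> l) F"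
  have "((\<lambda>x. norm1 (f x - l)) \<longlongrightarrow> norm1 (l - l)) F"
    unfolding norm1_def by (intro tendsto_intros f)
  then show ?thesis by (simp add: norm1_def)
qed

section \<open>Real-analytic maps of the plane\<close>

text \<open>The radius is scaled out of argument and value alike. The identity therefore has
  expansion \<open>coords\<close> on every disc, and \<open>norm1 (F - coords)\<close> measures
  closeness to it relative to \<rho>.\<close>

definition expands :: "(real ^ 2 \<Rightarrow> real ^ 2) \<Rightarrow> real \<Rightarrow> wiener ^ 2 \<Rightarrow> bool" where
  "expands f \<rho> F \<longleftrightarrow> 0 < \<rho> \<and> (\<forall>x. norm x \<le> \<rho> \<longrightarrow> f x = \<rho> *\<^sub>R appv F (x /\<^sub>R \<rho>))"

definition ranalytic_at :: "(real ^ 2 \<Rightarrow> real ^ 2) \<Rightarrow> real ^ 2 \<Rightarrow> bool" where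
  "ranalytic_at f p \<longleftrightarrow> (\<exists>\<rho> F. expands (\<lambda>x. f (p + x)) \<rho> F)"

definition constv :: "real ^ 2 \<Rightarrow> 'b::real_algebra_1 ^ 2" where
  "constv v = (\<chi> l. v $ l *\<^sub>R 1)"

lemma appv_constv: "appv (constv v) a = constv v"
proof -
  have "app (c *\<^sub>R 1) a = c *\<^sub>R 1" for c
    unfolding app_def
    by (rule infsumI, rule has_sum_finite_neutralI[of "{(0, 0)}"])
      (auto simp: coef_one mono2_def prod_eq_iff split: if_split_asm)
  then show ?thesis by (simp add: vec_eq_iff constv_def)
qed

lemma appv_coords_left [simp]: "appv coords a = a"
  by (simp add: vec_eq_iff forall_2)

lemma constv_real [simp]: "constv v = (v :: real ^ 2)"
  by (simp add: vec_eq_iff constv_def)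

lemma norm1_constv: "norm1 (constv v :: 'b::real_normed_algebra_1 ^ 2) = norm1 v"
  by (simp add: constv_def norm1_def)

lemma app_at_0: "app F 0 = coef F (0, 0) *\<^sub>R 1"
  unfolding app_def
  by (rule infsumI, rule has_sum_finite_neutralI[of "{(0, 0)}"])
    (auto simp: mono2_def power_0_left prod_eq_iff)

lemma norm_scaled_le: "0 < \<rho> \<Longrightarrow> norm x \<le> \<theta> * \<rho> \<Longrightarrow> norm (x /\<^sub>R \<rho>) \<le> \<theta>"
  by (simp add: field_simps)

lemma scaled_in_bidisc: "0 < \<rho> \<Longrightarrow> norm x \<le> \<theta> * \<rho> \<Longrightarrow> x /\<^sub>R \<rho> \<in> bidisc \<theta>"
  by (rule norm_in_bidisc) (rule norm_scaled_le)

lemma norm1_appv_diff_le: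
  assumes "a \<in> bidisc (3/4)" "b \<in> bidisc (3/4)"
  shows "norm1 (appv F a - appv F b) \<le> 4 * norm1 F * norm1 (a - b)"
  using norm_app_diff_le[OF assms, of "F $ 1"] norm_app_diff_le[OF assms, of "F $ 2"]
  by (simp add: norm1_def[of "appv F a - appv F b"] norm1_def[of F] algebra_simps)

lemma expandsD: "expands f \<rho> F \<Longrightarrow> norm x \<le> \<rho> \<Longrightarrow> f x = \<rho> *\<^sub>R appv F (x /\<^sub>R \<rho>)"
  and expands_pos: "expands f \<rho> F \<Longrightarrow> 0 < \<rho>"
  by (auto simp: expands_def)

lemma expands_shrink:
  assumes f: "expands f \<rho> F" and s: "0 < s" "s \<le> 1"
  shows "expands f (s * \<rho>) ((1 / s) *\<^sub>R appv F (s *\<^sub>R coords))"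
  unfolding expands_def
proof (intro conjI allI impI)
  have \<rho>: "0 < \<rho>" using f by (rule expands_pos)
  show "0 < s * \<rho>" using s \<rho> by simp
  fix x :: "real ^ 2" assume x: "norm x \<le> s * \<rho>"
  define \<xi> where "\<xi> = x /\<^sub>R (s * \<rho>)"
  have \<xi>: "\<xi> \<in> bidisc 1" unfolding \<xi>_def
    by (rule scaled_in_bidisc) (use x s \<rho> in simp_all)
  have x': "x /\<^sub>R \<rho> = s *\<^sub>R \<xi>" using s \<rho> by (simp add: \<xi>_def)
  have "s * \<rho> \<le> \<rho>" using s \<rho> by simp
  with x have "f x = \<rho> *\<^sub>R appv F (s *\<^sub>R \<xi>)"
    using expandsD[OF f, of x] x' by simp
  also have "appv F (s *\<^sub>R \<xi>) = appv (appv F (s *\<^sub>R coords)) \<xi>"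
    using appv_appv[OF scaled_coords_in_bidisc[of s 1] \<xi>, of F] appv_scaled_coords[OF \<xi>, of s] s by simp
  finally show "f x = (s * \<rho>) *\<^sub>R appv ((1 / s) *\<^sub>R appv F (s *\<^sub>R coords)) (x /\<^sub>R (s * \<rho>))"
    unfolding \<xi>_def[symmetric] using s by (simp add: appv_simps[OF \<xi>])
qed

lemma ranalytic_at_cong:
  assumes "ranalytic_at f p" and "\<forall>\<^sub>F x in nhds p. f x = g x"
  shows "ranalytic_at g p"
proof -
  obtain \<rho> F where F: "expands (\<lambda>x. f (p + x)) \<rho> F" using assms(1) by (auto simp: ranalytic_at_def)
  obtain e where e: "0 < e" "\<And>x. dist x p < e \<Longrightarrow> f x = g x"
    using assms(2) by (auto simp: eventually_nhds_metric)
  have \<rho>: "0 < \<rho>" using F by (rule expands_pos)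
  define s where "s = min 1 (e / (2 * \<rho>))"
  have s: "0 < s" "s \<le> 1" "s * \<rho> < e"
    using e \<rho> by (auto simp: s_def min_def field_simps)
  from expands_shrink[OF F s(1,2)]
  have "expands (\<lambda>x. g (p + x)) (s * \<rho>) ((1 / s) *\<^sub>R appv F (s *\<^sub>R coords))"
    unfolding expands_def using e(2)[of "p + x" for x] s(3) by (auto simp: dist_norm)
  then show ?thesis by (auto simp: ranalytic_at_def)
qed

text \<open>Re-expansion at \<open>q\<close> is composition with
  \<open>constv a + \<sigma> *\<^sub>R coords\<close>; the choice \<sigma> = 1 -
  \<open>norm a\<close> keeps this pair in the unit bidisc of the algebra, so no double series has
  to be rearranged.\<close>

lemma expands_imp_ranalytic_at:
  assumes f: "expands (\<lambda>x. f (p + x)) \<rho> F" and a: "norm (q - p) < \<rho>"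
  shows "ranalytic_at f q"
proof -
  have \<rho>: "0 < \<rho>" using f by (rule expands_pos)
  define a where "a = (q - p) /\<^sub>R \<rho>"
  have na: "norm a < 1" using assms(2) \<rho> unfolding a_def norm_scaleR by (simp add: field_simps)
  define \<sigma> where "\<sigma> = 1 - norm a"
  have \<sigma>: "0 < \<sigma>" using na by (simp add: \<sigma>_def)
  define A :: "wiener ^ 2" where "A = constv a + \<sigma> *\<^sub>R coords"
  have "norm (A $ l) \<le> 1" for l
  proof -
    have "norm (A $ l) \<le> \<bar>a $ l\<bar> + \<sigma> * norm (coords $ l)"
      using \<sigma> norm_triangle_ineq[of "constv a $ l" "(\<sigma> *\<^sub>R coords) $ l"] by (simp add: A_def constv_def)
    also have "norm (coords $ l) \<le> 1" using exhaust_2[of l] by (auto simp: norm_coord)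
    finally show ?thesis using \<sigma> Finite_Cartesian_Product.norm_nth_le[of a l] by (simp add: \<sigma>_def)
  qed
  then have A: "A \<in> bidisc 1" by (simp add: bidisc_iff)
  have "expands (\<lambda>x. f (q + x)) (\<rho> * \<sigma>) ((1 / \<sigma>) *\<^sub>R appv F A)"
    unfolding expands_def
  proof (intro conjI allI impI)
    show "0 < \<rho> * \<sigma>" using \<rho> \<sigma> by simp
    fix x :: "real ^ 2" assume x: "norm x \<le> \<rho> * \<sigma>"
    define \<xi> where "\<xi> = x /\<^sub>R (\<rho> * \<sigma>)"
    have \<xi>: "\<xi> \<in> bidisc 1" unfolding \<xi>_def
      by (rule scaled_in_bidisc) (use x \<sigma> \<rho> in simp_all)
    have eq: "(q - p + x) /\<^sub>R \<rho> = a + \<sigma> *\<^sub>R \<xi>"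
      using \<rho> \<sigma> by (simp add: a_def \<xi>_def algebra_simps)
    have "norm (q - p) = \<rho> * norm a" using \<rho> by (simp add: a_def)
    then have "norm (q - p + x) \<le> \<rho>"
      using norm_triangle_ineq[of "q - p" x] x by (simp add: \<sigma>_def algebra_simps)
    then have "f (q + x) = \<rho> *\<^sub>R appv F (a + \<sigma> *\<^sub>R \<xi>)"
      using expandsD[OF f, of "q - p + x"] eq by (simp add: algebra_simps)
    also have "appv F (a + \<sigma> *\<^sub>R \<xi>) = appv (appv F A) \<xi>"
      using appv_appv[OF A \<xi>, of F]
      by (simp add: A_def appv_simps[OF \<xi>] appv_constv)
    finally show "f (q + x) = (\<rho> * \<sigma>) *\<^sub>R appv ((1 / \<sigma>) *\<^sub>R appv F A) (x /\<^sub>R (\<rho> * \<sigma>))"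
      unfolding \<xi>_def[symmetric] using \<sigma> by (simp add: appv_simps[OF \<xi>])
  qed
  then show ?thesis by (auto simp: ranalytic_at_def)
qed

lemma ranalytic_at_open:
  assumes "ranalytic_at f p"
  shows "\<forall>\<^sub>F q in nhds p. ranalytic_at f q"
proof -
  obtain \<rho> F where F: "expands (\<lambda>x. f (p + x)) \<rho> F" using assms by (auto simp: ranalytic_at_def)
  then show ?thesis
    using expands_imp_ranalytic_at[OF F] expands_pos[OF F]
    by (auto simp: eventually_nhds_metric dist_norm)
qed

lemma ranalytic_at_id: "ranalytic_at (\<lambda>x. x) p"
proof -
  have "expands (\<lambda>x. p + x) 1 (constv p + coords)"
    unfolding expands_def
    by (auto simp: appv_simps norm_in_bidisc appv_constv appv_scaled_coords[of _ 1, simplified])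
  then show ?thesis by (auto simp: ranalytic_at_def)
qed

lemma ranalytic_at_translate_left:
  assumes "ranalytic_at f p"
  shows "ranalytic_at (\<lambda>x. c + f x) p"
proof -
  obtain \<rho> F where F: "expands (\<lambda>x. f (p + x)) \<rho> F" using assms by (auto simp: ranalytic_at_def)
  have \<rho>: "0 < \<rho>" using F by (rule expands_pos)
  have "expands (\<lambda>x. c + f (p + x)) \<rho> (constv (c /\<^sub>R \<rho>) + F)"
    unfolding expands_def
  proof (intro conjI allI impI)
    fix x :: "real ^ 2" assume x: "norm x \<le> \<rho>"
    have "x /\<^sub>R \<rho> \<in> bidisc 1" using scaled_in_bidisc[OF \<rho>, of x 1] x by simp
    from appv_simps(1)[OF this] show "c + f (p + x) = \<rho> *\<^sub>R appv (constv (c /\<^sub>R \<rho>) + F) (x /\<^sub>R \<rho>)"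
      using expandsD[OF F x] \<rho> by (simp add: appv_constv scaleR_add_right)
  qed (rule \<rho>)
  then show ?thesis by (auto simp: ranalytic_at_def)
qed

lemma ranalytic_at_shift: "ranalytic_at f (a + p) \<Longrightarrow> ranalytic_at (\<lambda>x. f (a + x)) p"
  by (simp add: ranalytic_at_def add.assoc)

text \<open>After removal of the constant term, \<open>g\<close> is small on a small disc. Shrinking
  by \<open>s\<close> brings it, rescaled to the disc of \<open>f\<close>, into the unit bidisc of
  the algebra, where \<open>F\<close> can be evaluated at it.\<close>

lemma ranalytic_at_compose:
  assumes g: "ranalytic_at g p" and f: "ranalytic_at f (g p)"
  shows "ranalytic_at (\<lambda>x. f (g x)) p"
proof -
  obtain \<rho> G where G: "expands (\<lambda>x. g (p + x)) \<rho> G" using g by (auto simp: ranalytic_at_def)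
  obtain \<sigma> F where F: "expands (\<lambda>y. f (g p + y)) \<sigma> F" using f by (auto simp: ranalytic_at_def)
  have \<rho>: "0 < \<rho>" and \<sigma>: "0 < \<sigma>" using F G expands_pos by auto
  define G0 where "G0 = G - constv (appv G 0)"
  have z: "(0 :: wiener ^ 2) \<in> bidisc \<theta>" if "0 \<le> \<theta>" for \<theta>
    using that by (simp add: bidisc_def)
  have G00: "appv G0 (0 :: wiener ^ 2) = 0"
    using z[of 1] by (simp add: G0_def appv_simps appv_constv vec_eq_iff constv_def app_at_0 coef_one)
  \<comment> \<open>The Lipschitz estimate bounds the shrunk series by 8 * s *
    \<open>norm1 G0\<close>, and this must not exceed \<sigma> / \<rho>. The summand 1 avoids
    division by zero.\<close>
  define s where "s = min (3/4) (\<sigma> / (8 * \<rho> * (norm1 G0 + 1)))"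
  have n0: "0 < norm1 G0 + 1" using norm1_ge_zero[of G0] by linarith
  have s: "0 < s" "s \<le> 3/4" using \<rho> \<sigma> n0 by (auto simp: s_def)
  define B where "B = (\<rho> / \<sigma>) *\<^sub>R appv G0 (s *\<^sub>R coords)"
  have "norm1 (appv G0 (s *\<^sub>R coords) - appv G0 0) \<le> 4 * norm1 G0 * norm1 (s *\<^sub>R coords - 0)"
    by (rule norm1_appv_diff_le) (use s z in \<open>auto intro!: scaled_coords_in_bidisc\<close>)
  then have "norm1 (appv G0 (s *\<^sub>R coords)) \<le> 8 * s * norm1 G0"
    using s by (simp add: G00 algebra_simps)
  also have "\<dots> \<le> 8 * s * (norm1 G0 + 1)" using s by simp
  also have "\<dots> \<le> 8 * (\<sigma> / (8 * \<rho> * (norm1 G0 + 1))) * (norm1 G0 + 1)"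
    using n0 by (intro mult_right_mono mult_left_mono) (auto simp: s_def)
  also have "\<dots> = \<sigma> / \<rho>"
  proof -
    have "8 * (\<sigma> / (8 * \<rho> * n)) * n = \<sigma> / \<rho>" if "0 < n" for n :: real
      using that \<rho> by (simp add: field_simps)
    from this[OF n0] show ?thesis .
  qed
  finally have "norm1 B \<le> 1" using \<rho> \<sigma> by (simp add: B_def field_simps)
  then have B: "B \<in> bidisc 1" by (rule norm1_in_bidisc)
  have "expands (\<lambda>x. f (g (p + x))) (\<rho> * s) ((\<sigma> / (\<rho> * s)) *\<^sub>R appv F B)"
    unfolding expands_def
  proof (intro conjI allI impI)
    show "0 < \<rho> * s" using \<rho> s by simp
    fix x :: "real ^ 2" assume x: "norm x \<le> \<rho> * s"
    define \<xi> where "\<xi> = x /\<^sub>R (\<rho> * s)"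
    have \<xi>: "\<xi> \<in> bidisc 1" unfolding \<xi>_def
      by (rule scaled_in_bidisc) (use x s \<rho> in simp_all)
    have "\<rho> * s \<le> \<rho> * 1" using s \<rho> by (intro mult_left_mono) auto
    then have x1: "norm x \<le> \<rho>" using x by simp
    then have x2: "x /\<^sub>R \<rho> \<in> bidisc 1" using scaled_in_bidisc[OF \<rho>, of x 1] by simp
    have x3: "x /\<^sub>R \<rho> = s *\<^sub>R \<xi>" using s \<rho> by (simp add: \<xi>_def)
    have gp: "g p = \<rho> *\<^sub>R appv G 0" using expandsD[OF G, of 0] \<rho> by simp
    have Bx: "\<sigma> *\<^sub>R appv B \<xi> = \<rho> *\<^sub>R (appv G (x /\<^sub>R \<rho>) - appv G 0)"
    proof -
      have "appv B \<xi> = (\<rho> / \<sigma>) *\<^sub>R appv G0 (s *\<^sub>R \<xi>)"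
        using appv_appv[OF scaled_coords_in_bidisc[of s 1] \<xi>, of G0] s
        by (simp add: B_def appv_simps[OF \<xi>] appv_scaled_coords[OF \<xi>])
      also have "appv G0 (s *\<^sub>R \<xi>) = appv G (x /\<^sub>R \<rho>) - appv G 0"
        unfolding x3[symmetric] by (simp add: G0_def appv_simps[OF x2] appv_constv)
      finally show ?thesis using \<sigma> by simp
    qed
    then have geq: "g (p + x) = g p + \<sigma> *\<^sub>R appv B \<xi>"
      using expandsD[OF G x1] gp by (simp add: algebra_simps)
    have "norm (appv B \<xi>) \<le> 1"
      using norm_le_norm1[of "appv B \<xi>"] norm1_appv_le[OF \<xi>, of B] \<open>norm1 B \<le> 1\<close> by linarith
    then have "norm (\<sigma> *\<^sub>R appv B \<xi>) \<le> \<sigma>" using \<sigma> by (simp add: mult_left_le)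
    from expandsD[OF F this] have "f (g (p + x)) = \<sigma> *\<^sub>R appv F (appv B \<xi>)"
      using \<sigma> by (simp add: geq)
    then show "f (g (p + x)) = (\<rho> * s) *\<^sub>R appv ((\<sigma> / (\<rho> * s)) *\<^sub>R appv F B) (x /\<^sub>R (\<rho> * s))"
      unfolding \<xi>_def[symmetric] using \<rho> s by (simp add: appv_simps[OF \<xi>] appv_appv[OF B \<xi>])
  qed
  then show ?thesis by (auto simp: ranalytic_at_def)
qed

lemma has_sum_vecI:
  fixes f :: "'a \<Rightarrow> 'b::{comm_monoid_add,topological_space} ^ 'n"
  assumes "\<And>l. ((\<lambda>n. f n $ l) has_sum s $ l) A"
  shows "(f has_sum s) A"
  unfolding has_sum_def by (rule vec_tendstoI) (use assms in \<open>simp add: has_sum_def\<close>)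

lemma real_analytic_on_iff: "f real_analytic_on S \<longleftrightarrow> (\<forall>p\<in>S. ranalytic_at f p)"
proof (intro iffI ballI)
  fix p assume "f real_analytic_on S" "p \<in> S"
  then obtain c r where r: "0 < r" and c: "\<And>x. x \<in> ball p r \<Longrightarrow>
      ((\<lambda>(i, j). ((x $ 1 - p $ 1) ^ i * (x $ 2 - p $ 2) ^ j) *\<^sub>R c i j) has_sum f x) UNIV"
    unfolding real_analytic_on_def by meson
  \<comment> \<open>The corner (\<rho>, \<rho>) has norm at most 2 * \<rho> < r, so the given series
    converges there; this is absolute summability of the rescaled coefficients.\<close>
  define \<rho> where "\<rho> = r / 4"
  have \<rho>: "0 < \<rho>" using r by (simp add: \<rho>_def)
  have cl: "((\<lambda>n. (x $ 1 ^ fst n * x $ 2 ^ snd n) * c (fst n) (snd n) $ l) has_sum f (p + x) $ l) UNIV"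
    if "norm x < r" for x l
    using has_sum_bounded_linear[OF bounded_linear_vec_nth c, of "p + x" l] that
    by (simp add: case_prod_unfold dist_norm)
  define F :: "wiener ^ 2" where "F = (\<chi> l. series (\<lambda>n. \<rho> ^ (fst n + snd n) * c (fst n) (snd n) $ l / \<rho>))"
  have coefF: "coef (F $ l) n = \<rho> ^ (fst n + snd n) * c (fst n) (snd n) $ l / \<rho>" for l n
  proof -
    define x :: "real ^ 2" where "x = vector [\<rho>, \<rho>]"
    have "norm x < r" using norm_le_norm1[of x] \<rho> r by (simp add: norm1_def x_def \<rho>_def)
    from has_sum_imp_summable[OF cl[OF this, of l]]
    have "(\<lambda>n. norm (\<rho> ^ (fst n + snd n) * c (fst n) (snd n) $ l)) summable_on UNIV"
      by (subst (asm) summable_on_iff_abs_summable_on_real) (simp add: x_def power_add)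
    from summable_on_cmult_left[OF this, of "1 / \<rho>"]
    have "(\<lambda>n. norm (\<rho> ^ (fst n + snd n) * c (fst n) (snd n) $ l / \<rho>)) summable_on UNIV"
      using \<rho> by (simp add: abs_mult)
    from coef_series[OF this] show ?thesis by (simp add: F_def)
  qed
  have "expands (\<lambda>x. f (p + x)) \<rho> F"
    unfolding expands_def
  proof (intro conjI allI impI)
    fix x :: "real ^ 2" assume x: "norm x \<le> \<rho>"
    have xb: "x /\<^sub>R \<rho> \<in> bidisc 1" using scaled_in_bidisc[OF \<rho>, of x 1] x by simp
    have "f (p + x) $ l = \<rho> * app (F $ l) (x /\<^sub>R \<rho>)" for l
    proof (rule has_sum_unique)
      show "((\<lambda>n. (x $ 1 ^ fst n * x $ 2 ^ snd n) * c (fst n) (snd n) $ l) has_sum f (p + x) $ l) UNIV"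
        using x r by (intro cl) (simp add: \<rho>_def)
      have "((\<lambda>n. \<rho> * (coef (F $ l) n *\<^sub>R mono2 (x /\<^sub>R \<rho>) n)) has_sum \<rho> * app (F $ l) (x /\<^sub>R \<rho>)) UNIV"
        by (rule has_sum_cmult_right[OF app_has_sum(2)[OF xb]])
      moreover have "\<rho> * (coef (F $ l) n *\<^sub>R mono2 (x /\<^sub>R \<rho>) n)
          = (x $ 1 ^ fst n * x $ 2 ^ snd n) * c (fst n) (snd n) $ l" for n
        using \<rho> unfolding mono2_scaleR by (simp add: coefF mono2_def power_inverse)
      ultimately show "((\<lambda>n. (x $ 1 ^ fst n * x $ 2 ^ snd n) * c (fst n) (snd n) $ l)
          has_sum \<rho> * app (F $ l) (x /\<^sub>R \<rho>)) UNIV" by simp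
    qed
    then show "f (p + x) = \<rho> *\<^sub>R appv F (x /\<^sub>R \<rho>)" by (simp add: vec_eq_iff)
  qed (rule \<rho>)
  then show "ranalytic_at f p" by (auto simp: ranalytic_at_def)
next
  assume a: "\<forall>p\<in>S. ranalytic_at f p"
  show "f real_analytic_on S"
    unfolding real_analytic_on_def
  proof (intro ballI)
    fix p assume "p \<in> S"
    then obtain \<rho> F where F: "expands (\<lambda>x. f (p + x)) \<rho> F" using a by (auto simp: ranalytic_at_def)
    have \<rho>: "0 < \<rho>" using F by (rule expands_pos)
    define c :: "nat \<Rightarrow> nat \<Rightarrow> real ^ 2" where "c i j = (\<chi> l. \<rho> * coef (F $ l) (i, j) / \<rho> ^ (i + j))" for i j
    have "((\<lambda>(i, j). ((y $ 1 - p $ 1) ^ i * (y $ 2 - p $ 2) ^ j) *\<^sub>R c i j) has_sum f y) UNIV"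
      if y: "y \<in> ball p \<rho>" for y
    proof (rule has_sum_vecI)
      fix l
      define x where "x = y - p"
      have nx: "norm x \<le> \<rho>" using y by (simp add: x_def dist_norm norm_minus_commute)
      have xb: "x /\<^sub>R \<rho> \<in> bidisc 1" using scaled_in_bidisc[OF \<rho>, of x 1] nx by simp
      have "((\<lambda>n. \<rho> * (coef (F $ l) n *\<^sub>R mono2 (x /\<^sub>R \<rho>) n)) has_sum \<rho> * app (F $ l) (x /\<^sub>R \<rho>)) UNIV"
        by (rule has_sum_cmult_right[OF app_has_sum(2)[OF xb]])
      moreover have "\<rho> * app (F $ l) (x /\<^sub>R \<rho>) = f y $ l"
        using expandsD[OF F nx] by (simp add: x_def)
      moreover have "\<rho> * (coef (F $ l) n *\<^sub>R mono2 (x /\<^sub>R \<rho>) n)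
          = (case n of (i, j) \<Rightarrow> ((y $ 1 - p $ 1) ^ i * (y $ 2 - p $ 2) ^ j) *\<^sub>R c i j) $ l" for n
        using \<rho> unfolding mono2_scaleR
        by (simp add: c_def mono2_def x_def case_prod_unfold field_simps power_inverse)
      ultimately show "((\<lambda>n. (case n of (i, j) \<Rightarrow> ((y $ 1 - p $ 1) ^ i * (y $ 2 - p $ 2) ^ j) *\<^sub>R c i j) $ l)
          has_sum f y $ l) UNIV" by simp
    qed
    with \<rho> show "\<exists>c r. 0 < r \<and> (\<forall>x\<in>ball p r. ((\<lambda>(i, j). ((x $ 1 - p $ 1) ^ i * (x $ 2 - p $ 2) ^ j) *\<^sub>R c i j)
        has_sum f x) UNIV)" by blast
  qed
qed

text \<open>\<open>R\<close> drops all terms of degree below 2. Its norm is at most that of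
  \<open>F\<close> plus three coefficients of \<open>F\<close>, hence the factor 4.\<close>

lemma app_quadratic_remainder:
  fixes \<xi> :: "real ^ 2"
  assumes "\<xi> \<in> bidisc 1"
  shows "\<bar>app F \<xi> - coef F (0, 0) - (coef F (1, 0) * \<xi> $ 1 + coef F (0, 1) * \<xi> $ 2)\<bar>
    \<le> (norm \<xi>)\<^sup>2 * (4 * norm F)"
proof -
  define R where "R = F - coef F (0, 0) *\<^sub>R 1 - coef F (1, 0) *\<^sub>R coord1 - coef F (0, 1) *\<^sub>R coord2"
  have cc: "coef coord1 n = (if n = (1, 0) then 1 else 0)" "coef coord2 n = (if n = (0, 1) then 1 else 0)" for n
    using coef_mono2_coords[of "(1, 0)" n] coef_mono2_coords[of "(0, 1)" n] by (simp_all add: mono2_def)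
  have R: "coef R n = 0" if "fst n + snd n < 2" for n
  proof -
    have "n = (0, 0) \<or> n = (1, 0) \<or> n = (0, 1)" using that by (cases n) auto
    then show ?thesis by (auto simp: R_def coef_one cc)
  qed
  have "norm R \<le> norm (F - coef F (0, 0) *\<^sub>R 1 - coef F (1, 0) *\<^sub>R coord1) + norm (coef F (0, 1) *\<^sub>R coord2)"
    unfolding R_def by (rule norm_triangle_ineq4)
  also have "\<dots> \<le> norm (F - coef F (0, 0) *\<^sub>R 1) + norm (coef F (1, 0) *\<^sub>R coord1) + norm (coef F (0, 1) *\<^sub>R coord2)"
    by (intro add_right_mono norm_triangle_ineq4)
  also have "\<dots> \<le> norm F + norm (coef F (0, 0) *\<^sub>R (1 :: wiener)) + norm (coef F (1, 0) *\<^sub>R coord1) + norm (coef F (0, 1) *\<^sub>R coord2)"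
    by (intro add_right_mono norm_triangle_ineq4)
  also have "\<dots> \<le> 4 * norm F"
    using abs_coef_le_norm[of F "(0,0)"] abs_coef_le_norm[of F "(1,0)"] abs_coef_le_norm[of F "(0,1)"]
    by (simp add: norm_coord)
  finally have nR: "norm R \<le> 4 * norm F" .
  have le: "norm (coef R n *\<^sub>R mono2 \<xi> n) \<le> \<bar>coef R n\<bar> * (norm \<xi>)\<^sup>2" for n
  proof (cases "fst n + snd n < 2")
    case False
    show ?thesis
    proof (cases "norm \<xi> \<le> 1")
      case True
      have "norm (mono2 \<xi> n) \<le> norm \<xi> ^ (fst n + snd n)"
        by (rule norm_mono2_le[OF norm_in_bidisc]) simp
      also have "\<dots> \<le> (norm \<xi>)\<^sup>2" using False True by (intro power_decreasing) auto
      finally show ?thesis by (simp add: abs_mult mult_left_mono)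
    next
      \<comment> \<open>A point of the bidisc may have Euclidean norm above 1; then the trivial
        bound 1 is enough.\<close>
      case False
      have "norm (mono2 \<xi> n) \<le> 1" by (rule norm_mono2_le_1[OF assms])
      also have "\<dots> \<le> (norm \<xi>)\<^sup>2" using False by (simp add: one_le_power)
      finally show ?thesis by (simp add: abs_mult mult_left_mono)
    qed
  qed (simp add: R)
  have "norm (app R \<xi>) \<le> norm R * (norm \<xi>)\<^sup>2"
    by (rule norm_infsum_le[OF app_has_sum(2)[OF assms] has_sum_cmult_left[OF norm_wiener_has_sum]]) (rule le)
  also have "\<dots> \<le> 4 * norm F * (norm \<xi>)\<^sup>2" using nR by (intro mult_right_mono) auto
  also have "app R \<xi> = app F \<xi> - coef F (0, 0) - coef F (1, 0) * \<xi> $ 1 - coef F (0, 1) * \<xi> $ 2"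
    by (simp add: R_def app_diff[OF assms] app_scaleR[OF assms] app_one)
  finally show ?thesis by (simp add: algebra_simps)
qed

lemma ranalytic_at_imp_differentiable:
  assumes "ranalytic_at f p"
  shows "f differentiable (at p)"
proof -
  obtain \<rho> F where F: "expands (\<lambda>x. f (p + x)) \<rho> F" using assms by (auto simp: ranalytic_at_def)
  have \<rho>: "0 < \<rho>" using F by (rule expands_pos)
  define D :: "real ^ 2 \<Rightarrow> real ^ 2" where
    "D x = (\<chi> l. coef (F $ l) (1, 0) * x $ 1 + coef (F $ l) (0, 1) * x $ 2)" for x
  have "linear D" by (intro linearI) (simp_all add: D_def vec_eq_iff algebra_simps)
  then have D: "bounded_linear D" by (simp add: linear_conv_bounded_linear)
  define C where "C = 4 * (norm (F $ 1) + norm (F $ 2)) / \<rho>"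
  have "(f has_derivative D) (at p)"
  proof (rule has_derivativeI_sandwich[OF \<rho> D])
    show "((\<lambda>y. C * norm (y - p)) \<longlongrightarrow> 0) (at p)"
      by (rule tendsto_eq_intros | simp)+
    fix y assume y: "y \<noteq> p" "dist y p < \<rho>"
    define \<xi> where "\<xi> = (y - p) /\<^sub>R \<rho>"
    have nx: "norm (y - p) \<le> \<rho>" using y by (simp add: dist_norm)
    have \<xi>: "\<xi> \<in> bidisc 1" unfolding \<xi>_def using scaled_in_bidisc[OF \<rho>, of "y - p" 1] nx by simp
    have z: "(0 :: real ^ 2) /\<^sub>R \<rho> = 0" by simp
    have "f y - f p - D (y - p) = \<rho> *\<^sub>R (appv F \<xi> - appv F 0 - D \<xi>)"
      using expandsD[OF F nx] expandsD[OF F, of 0] \<rho> linear_scale[OF \<open>linear D\<close>, of \<rho> \<xi>]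
      by (simp add: \<xi>_def algebra_simps)
    also have "norm \<dots> \<le> \<rho> * norm1 (appv F \<xi> - appv F 0 - D \<xi>)"
      using \<rho> norm_le_norm1 by (simp add: mult_left_mono)
    also have "\<dots> \<le> \<rho> * ((norm \<xi>)\<^sup>2 * (4 * norm (F $ 1)) + (norm \<xi>)\<^sup>2 * (4 * norm (F $ 2)))"
      using \<rho> app_quadratic_remainder[OF \<xi>, of "F $ 1"] app_quadratic_remainder[OF \<xi>, of "F $ 2"]
      by (intro mult_left_mono) (simp_all add: norm1_def D_def app_at_0)
    also have "\<dots> = C * norm (y - p) * norm (y - p)"
    proof -
      have "norm \<xi> = norm (y - p) / \<rho>" using \<rho> unfolding \<xi>_def norm_scaleR by (simp add: divide_inverse mult.commute)
      then show ?thesis using \<rho> by (simp only: C_def power2_eq_square) (simp add: field_simps)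
    qed
    finally show "norm (f y - f p - D (y - p)) / norm (y - p) \<le> C * norm (y - p)"
      using y by (simp add: field_simps)
  qed
  then show ?thesis by (auto simp: differentiable_def)
qed

lemma ranalytic_at_imp_isCont: "ranalytic_at f p \<Longrightarrow> isCont f p"
  using ranalytic_at_imp_differentiable differentiable_imp_continuous_within by blast

section \<open>Germs\<close>

lemma jacobian_eqI: "(f has_derivative D) (at x) \<Longrightarrow> jacobian f (at x) = matrix D"
  by (simp add: jacobian_def frechet_derivative_at[symmetric])

lemma det_jacobian_neq_0I:
  fixes f k :: "real ^ 2 \<Rightarrow> real ^ 2"
  assumes "f differentiable (at x)" "k differentiable (at (f x))" "\<forall>\<^sub>F y in nhds x. k (f y) = y"
  shows "det (jacobian f (at x)) \<noteq> 0"
proof -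
  obtain D where D: "(f has_derivative D) (at x)" using assms(1) by (auto simp: differentiable_def)
  obtain E where E: "(k has_derivative E) (at (f x))" using assms(2) by (auto simp: differentiable_def)
  have "((\<lambda>y. k (f y)) has_derivative (\<lambda>y. E (D y))) (at x)"
    by (rule has_derivative_compose[OF D E])
  moreover have "((\<lambda>y. k (f y)) has_derivative (\<lambda>y. y)) (at x)"
    by (rule has_derivative_transform_eventually[OF has_derivative_ident])
      (use assms(3) eventually_nhds_x_imp_x[OF assms(3)] in \<open>auto simp: eventually_at_filter elim: eventually_mono\<close>)
  ultimately have "(\<lambda>y. E (D y)) = (\<lambda>y. y)" by (rule has_derivative_unique)
  then have "matrix E ** matrix D = mat 1"
    using matrix_compose[of D E] has_derivative_linear[OF D] has_derivative_linear[OF E]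
    by (simp add: o_def matrix_id_mat_1[unfolded id_def])
  then have "det (matrix E) * det (matrix D) = 1"
    by (metis det_mul det_I)
  then show ?thesis by (auto simp: jacobian_eqI[OF D])
qed

text \<open>Value, derivative and analyticity at 0 depend on the germ only, so membership can be
  tested on any representative.\<close>

lemma germ_in_Diff_omega_iff:
  "germ f \<in> carrier Diff_omega \<longleftrightarrow> f 0 = 0 \<and> ranalytic_at f 0 \<and> det (jacobian f (at 0)) \<noteq> 0"
proof
  assume "germ f \<in> carrier Diff_omega"
  then obtain \<psi> where \<psi>: "local_analytic_diffeo \<psi>" "germ f = germ \<psi>"
    by (auto simp: Diff_omega_def)
  have ev: "\<forall>\<^sub>F x in nhds 0. \<psi> x = f x" using \<psi>(2) by (simp add: germ_eq_iff eq_commute)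
  have 0: "\<psi> 0 = f 0" by (rule eventually_nhds_x_imp_x[OF ev])
  have an: "ranalytic_at \<psi> 0" using \<psi>(1) by (auto simp: local_analytic_diffeo_def real_analytic_on_iff)
  obtain D where D: "(\<psi> has_derivative D) (at 0)"
    using ranalytic_at_imp_differentiable[OF an] by (auto simp: differentiable_def)
  have "(f has_derivative D) (at 0)"
    by (rule has_derivative_transform_eventually[OF D])
      (use ev 0 in \<open>auto simp: eventually_at_filter elim: eventually_mono\<close>)
  with D have "jacobian f (at 0) = jacobian \<psi> (at 0)" by (simp add: jacobian_eqI)
  then show "f 0 = 0 \<and> ranalytic_at f 0 \<and> det (jacobian f (at 0)) \<noteq> 0"
    using \<psi>(1) 0 ranalytic_at_cong[OF an ev] by (simp add: local_analytic_diffeo_def)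
next
  assume f: "f 0 = 0 \<and> ranalytic_at f 0 \<and> det (jacobian f (at 0)) \<noteq> 0"
  then have "\<forall>\<^sub>F q in nhds 0. ranalytic_at f q" using ranalytic_at_open by blast
  then obtain U where "open U" "0 \<in> U" "\<forall>x\<in>U. ranalytic_at f x" by (auto simp: eventually_nhds)
  then have "local_analytic_diffeo f" using f by (auto simp: local_analytic_diffeo_def real_analytic_on_iff)
  then show "germ f \<in> carrier Diff_omega" by (simp add: Diff_omega_def)
qed

lemma eventually_compose_isCont:
  assumes "isCont g 0" "g 0 = 0" "\<forall>\<^sub>F y in nhds 0. P y"
  shows "\<forall>\<^sub>F x in nhds 0. P (g x)"
proof -
  have "filterlim g (nhds 0) (nhds 0)"
    using assms(1,2) tendsto_at_iff_tendsto_nhds[of g 0] by (simp add: isCont_def)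
  from eventually_compose_filterlim[OF assms(3) this] show ?thesis .
qed

section \<open>Subgroups of the group of germs\<close>

locale germ_group =
  fixes G :: "germ set"
  assumes subgroup: "subgroup G Diff_omega"
begin

lemma germ_memD:
  assumes "germ f \<in> G"
  shows "f 0 = 0" "ranalytic_at f 0" "det (jacobian f (at 0)) \<noteq> 0" "isCont f 0"
  using assms subgroup.mem_carrier[OF subgroup] germ_in_Diff_omega_iff ranalytic_at_imp_isCont by blast+

lemma germ_mem_cong: "germ f \<in> G \<Longrightarrow> \<forall>\<^sub>F x in nhds 0. f x = g x \<Longrightarrow> germ g \<in> G"
  using germ_eq_iff[of f g] by simp

lemma germ_mem_id: "germ (\<lambda>x. x) \<in> G"
  using subgroup.one_closed[OF subgroup] by (simp add: Diff_omega_def id_def)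

lemma germ_mem_compose:
  assumes "germ f \<in> G" "germ g \<in> G"
  shows "germ (\<lambda>x. f (g x)) \<in> G"
  using subgroup.m_closed[OF subgroup assms] Diff_omega_mult_germ[of g f] germ_memD[OF assms(2)]
  by (simp add: o_def)

lemma eventually_compose_germ:
  "germ g \<in> G \<Longrightarrow> \<forall>\<^sub>F y in nhds 0. P y \<Longrightarrow> \<forall>\<^sub>F x in nhds 0. P (g x)"
  by (rule eventually_compose_isCont) (auto dest: germ_memD)

text \<open>The group inverse is identified through its definite description: any inverse germ
  \<open>k'\<close> satisfies \<open>k' (f x) = x\<close>, and substituting \<open>k x\<close> for
  \<open>x\<close> gives \<open>k' = k\<close> near 0.\<close>

lemma germ_mem_inverse:
  assumes f: "germ f \<in> G" and k: "ranalytic_at k 0" "k 0 = 0"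
    and kf: "\<forall>\<^sub>F x in nhds 0. k (f x) = x" and fk: "\<forall>\<^sub>F x in nhds 0. f (k x) = x"
  shows "germ k \<in> G"
proof -
  note f' = germ_memD[OF f]
  have "det (jacobian k (at 0)) \<noteq> 0"
    by (rule det_jacobian_neq_0I[where k = f])
      (use k f' fk in \<open>auto intro: ranalytic_at_imp_differentiable\<close>)
  then have kc: "germ k \<in> carrier Diff_omega" using k by (simp add: germ_in_Diff_omega_iff)
  have ck: "isCont k 0" using k(1) by (rule ranalytic_at_imp_isCont)
  have one: "\<one>\<^bsub>Diff_omega\<^esub> = germ (\<lambda>x. x)" by (simp add: Diff_omega_def id_def)
  have "inv\<^bsub>Diff_omega\<^esub> (germ f) = germ k"
    unfolding m_inv_def
  proof (rule the_equality)
    show "germ k \<in> carrier Diff_omega \<and> germ f \<otimes>\<^bsub>Diff_omega\<^esub> germ k = \<one>\<^bsub>Diff_omega\<^esub> \<and>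
        germ k \<otimes>\<^bsub>Diff_omega\<^esub> germ f = \<one>\<^bsub>Diff_omega\<^esub>"
      using kc kf fk f' ck k(2) by (simp add: Diff_omega_mult_germ one germ_eq_iff)
  next
    fix y assume y: "y \<in> carrier Diff_omega \<and> germ f \<otimes>\<^bsub>Diff_omega\<^esub> y = \<one>\<^bsub>Diff_omega\<^esub> \<and>
        y \<otimes>\<^bsub>Diff_omega\<^esub> germ f = \<one>\<^bsub>Diff_omega\<^esub>"
    then obtain k' where k': "y = germ k'" by (auto simp: Diff_omega_def)
    have "\<forall>\<^sub>F x in nhds 0. k' (f x) = x"
      using y f' by (simp add: k' Diff_omega_mult_germ one germ_eq_iff)
    from eventually_compose_isCont[OF ck k(2) this] fk have "\<forall>\<^sub>F x in nhds 0. k' x = k x"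
      by eventually_elim simp
    then show "y = germ k" by (simp add: k' germ_eq_iff)
  qed
  then show ?thesis using subgroup.m_inv_closed[OF subgroup f] by simp
qed

lemma germ_mem_limit:
  assumes closed: "closed_germs G" and r: "0 < r"
    and f: "\<And>n x. norm x < r \<Longrightarrow> ranalytic_at (f n) x" "\<And>n. germ (f n) \<in> G"
    and g: "\<And>x. norm x < r \<Longrightarrow> ranalytic_at g x" "g 0 = 0" "det (jacobian g (at 0)) \<noteq> 0"
    and lim: "uniform_limit (ball 0 r) f g sequentially"
  shows "germ g \<in> G"
proof -
  have "germ g \<in> carrier Diff_omega" using g r by (simp add: germ_in_Diff_omega_iff)
  moreover have "g real_analytic_on ball 0 r" "\<And>n. f n real_analytic_on ball 0 r"
    using f(1) g(1) by (auto simp: real_analytic_on_iff)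
  ultimately show ?thesis
    using closed[unfolded closed_germs_def, rule_format, of "ball 0 r" g] r lim f(2)
    by (metis centre_in_ball connected_ball open_ball order_refl)
qed

lemma germ_mem_translate:
  assumes unif: "uniform_germs G" and f: "germ f \<in> G"
    and an: "\<And>x. norm x < r \<Longrightarrow> ranalytic_at f x" "\<And>x. norm x < r \<Longrightarrow> det (jacobian f (at x)) \<noteq> 0"
    and q: "norm q < r"
  shows "germ (\<lambda>x. f (q + x) - f q) \<in> G"
proof -
  have "0 < r" using q norm_ge_zero[of q] by linarith
  then have "germ ((+) (- f q) \<circ> f \<circ> (+) q) \<in> G"
    using f q an by (intro unif[unfolded uniform_germs_def, rule_format, of "ball 0 r"])
      (auto simp: real_analytic_on_iff)
  then show ?thesis by (simp add: o_def)
qed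

end

section \<open>Charts\<close>

text \<open>The condition at a single point from the definition of
  \<open>real_analytic_curve\<close>, isolated so that it can be transported by diffeomorphisms and
  refuted pointwise.\<close>

definition analytic_point :: "(real ^ 2) set \<Rightarrow> real ^ 2 \<Rightarrow> bool" where
  "analytic_point \<gamma> p \<longleftrightarrow> (\<exists>U \<phi>. p \<in> U \<and> diffeo_on (real_analytic_on) \<phi> U \<and>
    \<phi> ` (U \<inter> \<gamma>) = \<phi> ` U \<inter> {y. y $ 2 = 0})"

lemma diffeo_onI:
  assumes "open U" "open (\<phi> ` U)" and \<phi>: "\<And>x. x \<in> U \<Longrightarrow> ranalytic_at \<phi> x"
    and \<kappa>: "\<And>x. x \<in> U \<Longrightarrow> \<kappa> (\<phi> x) = x" "\<And>x. x \<in> U \<Longrightarrow> ranalytic_at \<kappa> (\<phi> x)"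
  shows "diffeo_on (real_analytic_on) \<phi> U"
proof -
  have inj: "inj_on \<phi> U" using \<kappa>(1) by (rule inj_on_inverseI)
  have "ranalytic_at (inv_into U \<phi>) (\<phi> x)" if x: "x \<in> U" for x
  proof (rule ranalytic_at_cong[OF \<kappa>(2)[OF x]])
    have "\<forall>\<^sub>F y in nhds (\<phi> x). y \<in> \<phi> ` U"
      using assms(2) x by (intro eventually_nhds_in_open) auto
    then show "\<forall>\<^sub>F y in nhds (\<phi> x). \<kappa> y = inv_into U \<phi> y"
      by eventually_elim (auto simp: \<kappa>(1) inv_into_f_f[OF inj])
  qed
  then show ?thesis using assms inj by (auto simp: diffeo_on_def real_analytic_on_iff)
qed

lemma diffeo_onE:
  assumes "diffeo_on (real_analytic_on) \<phi> U"
  obtains \<kappa> where "open U" "open (\<phi> ` U)" "\<And>x. x \<in> U \<Longrightarrow> ranalytic_at \<phi> x"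
    "\<And>x. x \<in> U \<Longrightarrow> \<kappa> (\<phi> x) = x" "\<And>x. x \<in> U \<Longrightarrow> ranalytic_at \<kappa> (\<phi> x)"
  by (rule that[of "inv_into U \<phi>"]) (use assms in \<open>auto simp: diffeo_on_def real_analytic_on_iff\<close>)

lemma diffeo_on_open_image:
  assumes "diffeo_on (real_analytic_on) \<phi> U" "open V" "V \<subseteq> U"
  shows "open (\<phi> ` V)"
proof -
  obtain \<kappa> where U: "open U" "open (\<phi> ` U)" and \<kappa>: "\<And>x. x \<in> U \<Longrightarrow> \<kappa> (\<phi> x) = x"
    "\<And>x. x \<in> U \<Longrightarrow> ranalytic_at \<kappa> (\<phi> x)"
    using assms(1) by (rule diffeo_onE) blast
  have "continuous_on (\<phi> ` U) \<kappa>"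
    by (intro continuous_at_imp_continuous_on ballI) (use \<kappa>(2) ranalytic_at_imp_isCont in blast)
  then have "open (\<phi> ` U \<inter> \<kappa> -` V)" using U(2) assms(2) by (rule continuous_open_preimage)
  moreover have "\<phi> ` U \<inter> \<kappa> -` V = \<phi> ` V" using \<kappa>(1) assms(3) by force
  ultimately show ?thesis by simp
qed

lemma straightens_iff:
  assumes "inj_on \<phi> U" "\<phi> ` (U \<inter> \<gamma>) = \<phi> ` U \<inter> {y. y $ 2 = 0}" "x \<in> U"
  shows "x \<in> \<gamma> \<longleftrightarrow> \<phi> x $ 2 = 0"
proof
  assume "x \<in> \<gamma>"
  then have "\<phi> x \<in> \<phi> ` (U \<inter> \<gamma>)" using assms(3) by blast
  then show "\<phi> x $ 2 = 0" using assms(2) by blast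
next
  assume "\<phi> x $ 2 = 0"
  then have "\<phi> x \<in> \<phi> ` (U \<inter> \<gamma>)" using assms(2,3) by blast
  then show "x \<in> \<gamma>" using assms(1,3) by (auto dest: inj_onD)
qed

lemma analytic_pointI:
  assumes "p \<in> U" "open U" "open (\<phi> ` U)" "\<And>x. x \<in> U \<Longrightarrow> ranalytic_at \<phi> x"
    "\<And>x. x \<in> U \<Longrightarrow> \<kappa> (\<phi> x) = x" "\<And>x. x \<in> U \<Longrightarrow> ranalytic_at \<kappa> (\<phi> x)"
    "\<And>x. x \<in> U \<Longrightarrow> x \<in> \<gamma> \<longleftrightarrow> \<phi> x $ 2 = 0"
  shows "analytic_point \<gamma> p"
  unfolding analytic_point_def
proof (intro exI conjI)
  show "p \<in> U" by fact
  show "diffeo_on (real_analytic_on) \<phi> U" by (rule diffeo_onI[where \<kappa> = \<kappa>]) (use assms in auto)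
  show "\<phi> ` (U \<inter> \<gamma>) = \<phi> ` U \<inter> {y. y $ 2 = 0}" using assms(7) by auto
qed

lemma analytic_pointE:
  assumes "analytic_point \<gamma> p"
  obtains U \<phi> \<kappa> where "p \<in> U" "diffeo_on (real_analytic_on) \<phi> U" "open U"
    "\<And>x. x \<in> U \<Longrightarrow> ranalytic_at \<phi> x"
    "\<And>x. x \<in> U \<Longrightarrow> \<kappa> (\<phi> x) = x" "\<And>x. x \<in> U \<Longrightarrow> ranalytic_at \<kappa> (\<phi> x)"
    "\<And>x. x \<in> U \<Longrightarrow> x \<in> \<gamma> \<longleftrightarrow> \<phi> x $ 2 = 0"
proof -
  obtain U \<phi> where U: "p \<in> U" "diffeo_on (real_analytic_on) \<phi> U"
    "\<phi> ` (U \<inter> \<gamma>) = \<phi> ` U \<inter> {y. y $ 2 = 0}"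
    using assms by (auto simp: analytic_point_def)
  obtain \<kappa> where \<kappa>: "open U" "open (\<phi> ` U)" "\<And>x. x \<in> U \<Longrightarrow> ranalytic_at \<phi> x"
    "\<And>x. x \<in> U \<Longrightarrow> \<kappa> (\<phi> x) = x" "\<And>x. x \<in> U \<Longrightarrow> ranalytic_at \<kappa> (\<phi> x)"
    using U(2) by (rule diffeo_onE) blast
  have "inj_on \<phi> U" using U(2) by (simp add: diffeo_on_def)
  from straightens_iff[OF this U(3)] show thesis
    by (intro that[of U \<phi> \<kappa>]) (use U(1,2) \<kappa> in auto)
qed

lemma analytic_point_of_restriction:
  assumes "analytic_point (\<gamma> \<inter> V) p" "open V" "p \<in> V"
  shows "analytic_point \<gamma> p"
proof -
  obtain U \<phi> \<kappa> where U: "p \<in> U" "diffeo_on (real_analytic_on) \<phi> U" "open U"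
    "\<And>x. x \<in> U \<Longrightarrow> ranalytic_at \<phi> x"
    "\<And>x. x \<in> U \<Longrightarrow> \<kappa> (\<phi> x) = x" "\<And>x. x \<in> U \<Longrightarrow> ranalytic_at \<kappa> (\<phi> x)"
    "\<And>x. x \<in> U \<Longrightarrow> x \<in> \<gamma> \<inter> V \<longleftrightarrow> \<phi> x $ 2 = 0"
    using assms(1) by (rule analytic_pointE) blast
  have "open (\<phi> ` (U \<inter> V))" by (rule diffeo_on_open_image[OF U(2)]) (use U assms in auto)
  then show ?thesis
    by (intro analytic_pointI[of p "U \<inter> V" \<phi> \<kappa>]) (use U assms in auto)
qed

lemma analytic_point_image:
  assumes "analytic_point \<gamma> p" "p \<in> U" "diffeo_on (real_analytic_on) \<psi> U"
    and \<psi>\<gamma>: "\<And>x. x \<in> U \<Longrightarrow> \<psi> x \<in> \<gamma>' \<longleftrightarrow> x \<in> \<gamma>"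
  shows "analytic_point \<gamma>' (\<psi> p)"
proof -
  obtain V \<phi> \<kappa> where V: "p \<in> V" "diffeo_on (real_analytic_on) \<phi> V" "open V"
    "\<And>x. x \<in> V \<Longrightarrow> ranalytic_at \<phi> x"
    "\<And>x. x \<in> V \<Longrightarrow> \<kappa> (\<phi> x) = x" "\<And>x. x \<in> V \<Longrightarrow> ranalytic_at \<kappa> (\<phi> x)"
    "\<And>x. x \<in> V \<Longrightarrow> x \<in> \<gamma> \<longleftrightarrow> \<phi> x $ 2 = 0"
    using assms(1) by (rule analytic_pointE) blast
  obtain \<theta> where U: "open U" "\<And>x. x \<in> U \<Longrightarrow> ranalytic_at \<psi> x"
    "\<And>x. x \<in> U \<Longrightarrow> \<theta> (\<psi> x) = x" "\<And>x. x \<in> U \<Longrightarrow> ranalytic_at \<theta> (\<psi> x)"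
    using assms(3) by (rule diffeo_onE) blast
  have UV: "open (U \<inter> V)" using U V by auto
  show ?thesis
  proof (rule analytic_pointI[of _ "\<psi> ` (U \<inter> V)" "\<lambda>y. \<phi> (\<theta> y)" "\<lambda>z. \<psi> (\<kappa> z)"])
    show "open (\<psi> ` (U \<inter> V))" by (rule diffeo_on_open_image[OF assms(3) UV]) auto
    have "(\<lambda>y. \<phi> (\<theta> y)) ` \<psi> ` (U \<inter> V) = \<phi> ` (U \<inter> V)" unfolding image_image using U(3) by (intro image_cong) auto
    then show "open ((\<lambda>y. \<phi> (\<theta> y)) ` \<psi> ` (U \<inter> V))"
      using diffeo_on_open_image[OF V(2) UV] by auto
    fix y assume "y \<in> \<psi> ` (U \<inter> V)"
    then obtain x where x: "x \<in> U" "x \<in> V" "y = \<psi> x" by auto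
    show "ranalytic_at (\<lambda>y. \<phi> (\<theta> y)) y"
      by (rule ranalytic_at_compose) (use U(3,4) V(4) x in auto)
    show "ranalytic_at (\<lambda>z. \<psi> (\<kappa> z)) (\<phi> (\<theta> y))"
      by (rule ranalytic_at_compose) (use U(2,3) V(5,6) x in auto)
    show "\<psi> (\<kappa> (\<phi> (\<theta> y))) = y" using U(3) V(5) x by simp
    show "y \<in> \<gamma>' \<longleftrightarrow> \<phi> (\<theta> y) $ 2 = 0" using U(3) V(7) \<psi>\<gamma> x by simp
  qed (use V(1) assms(2) in auto)
qed

lemma diffeo_on_translation: "diffeo_on (real_analytic_on) (\<lambda>x. a + x) UNIV"
proof (rule diffeo_onI[where \<kappa> = "\<lambda>x. - a + x"])
  show "open ((\<lambda>x. a + x) ` UNIV)" using surj_plus[of a] by simp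
  show "ranalytic_at (\<lambda>x. - a + x) (a + x)" for x
    by (rule ranalytic_at_translate_left[OF ranalytic_at_id])
qed (auto intro!: ranalytic_at_translate_left ranalytic_at_id)

subsection \<open>Smooth curves\<close>

lemma Ck_on_cong:
  "open S \<Longrightarrow> (\<And>x. x \<in> S \<Longrightarrow> f x = g x) \<Longrightarrow> Ck_on k f S \<Longrightarrow> Ck_on k g S"
proof (induction k arbitrary: f g)
  case (Suc k)
  have ev: "\<forall>\<^sub>F y in at x. f y = g y" if "x \<in> S" for x
    using eventually_at_in_open'[OF Suc.prems(1) that] by eventually_elim (rule Suc.prems(2))
  have der: "(f has_derivative D) (at x) \<longleftrightarrow> (g has_derivative D) (at x)" if x: "x \<in> S" for x D
  proof
    show "(g has_derivative D) (at x)" if "(f has_derivative D) (at x)"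
      by (rule has_derivative_transform_eventually[OF that ev[OF x]]) (simp_all add: Suc.prems(2)[OF x])
    have "\<forall>\<^sub>F y in at x. g y = f y" using ev[OF x] by eventually_elim simp
    then show "(f has_derivative D) (at x)" if "(g has_derivative D) (at x)"
      by (rule has_derivative_transform_eventually[OF that]) (simp_all add: Suc.prems(2)[OF x])
  qed
  have "frechet_derivative f (at x) = frechet_derivative g (at x)" if "x \<in> S" for x
    using der[OF that] by (simp add: frechet_derivative_def)
  then have fr: "frechet_derivative f (at x) v = frechet_derivative g (at x) v" if "x \<in> S" for x v
    using that by simp
  have "Ck_on k (\<lambda>x. frechet_derivative g (at x) v) S" for v
    by (rule Suc.IH[OF Suc.prems(1), of "\<lambda>x. frechet_derivative f (at x) v"]) (use Suc.prems(3) fr in simp_all)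
  moreover have "g differentiable (at x)" if "x \<in> S" for x
  proof -
    have "f differentiable (at x)" using Suc.prems(3) that by simp
    then show ?thesis unfolding differentiable_def der[OF that] .
  qed
  ultimately show ?case by simp
next
  case 0
  then show ?case using continuous_on_cong[of S S f g] by simp
qed

lemma Ck_on_shift: "Ck_on k f S \<Longrightarrow> Ck_on k (\<lambda>x. f (a + x)) {x. a + x \<in> S}"
proof (induction k arbitrary: f)
  case 0
  then have "continuous_on S f" by simp
  then have "continuous_on {x. a + x \<in> S} (f \<circ> (\<lambda>x. a + x))"
    by (intro continuous_on_compose continuous_intros) (auto elim: continuous_on_subset)
  then show ?case by (simp add: o_def)
next
  case (Suc k)
  have der: "((\<lambda>x. f (a + x)) has_derivative D) (at x) \<longleftrightarrow> (f has_derivative D) (at (a + x))" for D x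
  proof
    have sh: "((\<lambda>x. b + x) has_derivative (\<lambda>x. x)) (at x)" for b x :: "real ^ 2"
      using has_derivative_add[OF has_derivative_const has_derivative_ident, of b] by simp
    show "((\<lambda>x. f (a + x)) has_derivative D) (at x)" if "(f has_derivative D) (at (a + x))"
      by (rule has_derivative_compose[OF sh that])
    show "(f has_derivative D) (at (a + x))" if "((\<lambda>x. f (a + x)) has_derivative D) (at x)"
      using has_derivative_compose[OF sh[of "- a" "a + x"], of "\<lambda>x. f (a + x)" D] that by simp
  qed
  have "frechet_derivative (\<lambda>x. f (a + x)) (at x) = frechet_derivative f (at (a + x))" for x
    using der by (simp add: frechet_derivative_def)
  moreover have "Ck_on k (\<lambda>x. frechet_derivative f (at (a + x)) v) {x. a + x \<in> S}" for v
    using Suc.IH[of "\<lambda>x. frechet_derivative f (at x) v"] Suc.prems by simp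
  moreover have "(\<lambda>x. f (a + x)) differentiable (at x)" if "a + x \<in> S" for x
  proof -
    have "f differentiable (at (a + x))" using Suc.prems that by simp
    then show ?thesis unfolding differentiable_def der .
  qed
  ultimately show ?case by simp
qed

lemma has_derivative_translate_left_iff:
  "((\<lambda>x. a + f x) has_derivative D) F \<longleftrightarrow> (f has_derivative D) F"
proof
  show "((\<lambda>x. a + f x) has_derivative D) F" if "(f has_derivative D) F"
    using has_derivative_add[OF has_derivative_const[where c = a] that] by simp
  show "(f has_derivative D) F" if "((\<lambda>x. a + f x) has_derivative D) F"
    using has_derivative_add[OF has_derivative_const[where c = "- a"] that] by simp
qed

lemma Ck_on_translate_left:
  assumes "Ck_on k f S"
  shows "Ck_on k (\<lambda>x. a + f x) S"
proof (cases k)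
  case 0
  with assms show ?thesis by (auto intro: continuous_intros)
next
  case (Suc j)
  have "frechet_derivative (\<lambda>x. a + f x) (at x) = frechet_derivative f (at x)" for x
    unfolding frechet_derivative_def has_derivative_translate_left_iff ..
  with Suc assms show ?thesis
    unfolding Suc Ck_on.simps differentiable_def has_derivative_translate_left_iff by simp
qed

lemma smooth_onD:
  assumes "f smooth_on S"
  shows "\<And>x. x \<in> S \<Longrightarrow> f differentiable (at x)" "continuous_on S f"
    "\<And>v. continuous_on S (\<lambda>x. frechet_derivative f (at x) v)"
  using assms[unfolded smooth_on_def, rule_format, of 0] assms[unfolded smooth_on_def, rule_format, of 1]
  by auto

text \<open>(ICP) speaks of curves through the origin, so a point of the curve has to be moved
  there. The \<open>inv_into\<close> of the translated chart agrees with the translated inverse only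
  on the image, whence \<open>Ck_on_cong\<close>.\<close>

lemma smooth_curve_translate:
  assumes "smooth_curve \<gamma>"
  shows "smooth_curve {x. p + x \<in> \<gamma>}"
  unfolding curve_of_class_def
proof (intro ballI)
  fix x assume "x \<in> {x. p + x \<in> \<gamma>}"
  then obtain U \<phi> where U: "p + x \<in> U" "diffeo_on (smooth_on) \<phi> U"
    "\<phi> ` (U \<inter> \<gamma>) = \<phi> ` U \<inter> {y. y $ 2 = 0}"
    using assms by (auto simp: curve_of_class_def)
  let ?U = "{x. p + x \<in> U}" and ?\<phi> = "\<lambda>x. \<phi> (p + x)"
  have pre: "{x. p + x \<in> A} = (\<lambda>x. - p + x) ` A" for A
  proof (intro equalityI subsetI)
    fix z assume "z \<in> {x. p + x \<in> A}"
    then show "z \<in> (\<lambda>x. - p + x) ` A" by (intro image_eqI[of _ _ "p + z"]) auto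
  qed auto
  have im: "?\<phi> ` {x. p + x \<in> A} = \<phi> ` A" for A unfolding pre by (simp add: image_image)
  have inj: "inj_on \<phi> U" using U(2) by (simp add: diffeo_on_def)
  have inj': "inj_on ?\<phi> ?U" by (rule inj_onI) (use inj in \<open>auto dest: inj_onD\<close>)
  have "(\<lambda>y. - p + inv_into U \<phi> y) smooth_on (\<phi> ` U)"
    unfolding smooth_on_def
    by (intro allI Ck_on_translate_left) (use U(2) in \<open>auto simp: diffeo_on_def smooth_on_def\<close>)
  moreover have "- p + inv_into U \<phi> y = inv_into ?U ?\<phi> y" if "y \<in> \<phi> ` U" for y
  proof -
    from that obtain u where u: "u \<in> U" "y = \<phi> u" by auto
    have "inv_into ?U ?\<phi> (?\<phi> (- p + u)) = - p + u" by (rule inv_into_f_f[OF inj']) (use u in simp)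
    then show ?thesis using u inv_into_f_f[OF inj u(1)] by simp
  qed
  moreover have "open (\<phi> ` U)" using U(2) by (simp add: diffeo_on_def)
  ultimately have "(inv_into ?U ?\<phi>) smooth_on (\<phi> ` U)"
    unfolding smooth_on_def using Ck_on_cong[of "\<phi> ` U" "\<lambda>y. - p + inv_into U \<phi> y" "inv_into ?U ?\<phi>"] by blast
  moreover have "?\<phi> smooth_on ?U"
    using U(2) by (auto simp: diffeo_on_def smooth_on_def intro: Ck_on_shift)
  moreover have "open ?U" unfolding pre by (rule open_translation) (use U(2) in \<open>simp add: diffeo_on_def\<close>)
  ultimately have "diffeo_on (smooth_on) ?\<phi> ?U"
    using U(2) inj' by (simp add: diffeo_on_def im)
  moreover have "?\<phi> ` (?U \<inter> {x. p + x \<in> \<gamma>}) = \<phi> ` (U \<inter> \<gamma>)"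
    using im[of "U \<inter> \<gamma>"] by (simp add: Collect_conj_eq)
  ultimately show "\<exists>U \<phi>. x \<in> U \<and> diffeo_on (smooth_on) \<phi> U \<and>
      \<phi> ` (U \<inter> {x. p + x \<in> \<gamma>}) = \<phi> ` U \<inter> {y. y $ 2 = 0}"
    using U(1,3) im[of U] by (intro exI[of _ ?U] exI[of _ ?\<phi>]) simp
qed

lemma smooth_chartE:
  assumes "smooth_curve \<gamma>" "p \<in> \<gamma>"
  obtains U and \<phi> \<kappa> :: "real ^ 2 \<Rightarrow> real ^ 2" where "p \<in> U" "open U" "open (\<phi> ` U)" "continuous_on U \<phi>"
    "\<And>x. x \<in> U \<Longrightarrow> \<phi> differentiable (at x)"
    "\<And>y. y \<in> \<phi> ` U \<Longrightarrow> \<kappa> differentiable (at y)" "continuous_on (\<phi> ` U) \<kappa>"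
    "\<And>v. continuous_on (\<phi> ` U) (\<lambda>x. frechet_derivative \<kappa> (at x) v)"
    "\<And>x. x \<in> U \<Longrightarrow> \<kappa> (\<phi> x) = x" "\<And>x. x \<in> U \<Longrightarrow> x \<in> \<gamma> \<longleftrightarrow> \<phi> x $ 2 = 0"
proof -
  obtain U \<phi> where U: "p \<in> U" "diffeo_on (smooth_on) \<phi> U"
    "\<phi> ` (U \<inter> \<gamma>) = \<phi> ` U \<inter> {y. y $ 2 = 0}"
    using assms by (auto simp: curve_of_class_def)
  have inj: "inj_on \<phi> U" and s: "\<phi> smooth_on U" "(inv_into U \<phi>) smooth_on (\<phi> ` U)"
    using U(2) by (auto simp: diffeo_on_def)
  show thesis
  proof (rule that[of U \<phi> "inv_into U \<phi>"])
    show "open U" "open (\<phi> ` U)" using U(2) by (auto simp: diffeo_on_def)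
    show "x \<in> \<gamma> \<longleftrightarrow> \<phi> x $ 2 = 0" if "x \<in> U" for x by (rule straightens_iff[OF inj U(3) that])
    show "inv_into U \<phi> (\<phi> x) = x" if "x \<in> U" for x by (rule inv_into_f_f[OF inj that])
  qed (fact U(1) smooth_onD[OF s(1)] smooth_onD[OF s(2)])+
qed

text \<open>Charts show that each point of \<gamma> has a neighbourhood in \<open>\<U>\<close>, and
  \<gamma> is closed in the union of \<open>\<U>\<close>. Both (ICP) and the Baire argument require
  such a neighbourhood.\<close>

lemma smooth_curve_locally_closed:
  assumes "smooth_curve \<gamma>"
  obtains W where "open W" "\<gamma> \<subseteq> W" "closedin (top_of_set W) \<gamma>"
proof -
  define \<U> where "\<U> = {U. open U \<and> open (U - \<gamma>)}"
  have "\<exists>U\<in>\<U>. p \<in> U" if p: "p \<in> \<gamma>" for p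
  proof -
    obtain U and \<phi> :: "real ^ 2 \<Rightarrow> real ^ 2" where U: "p \<in> U" "open U" "continuous_on U \<phi>"
      and \<gamma>: "\<And>x. x \<in> U \<Longrightarrow> x \<in> \<gamma> \<longleftrightarrow> \<phi> x $ 2 = 0"
      using assms p by (rule smooth_chartE) blast
    have "U - \<gamma> = U \<inter> (\<lambda>x. \<phi> x $ 2) -` (- {0})" using \<gamma> by auto
    moreover have "open (U \<inter> (\<lambda>x. \<phi> x $ 2) -` (- {0}))"
      by (rule continuous_open_preimage) (use U in \<open>auto intro: continuous_intros\<close>)
    ultimately show ?thesis using U by (auto simp: \<U>_def)
  qed
  then have sub: "\<gamma> \<subseteq> \<Union>\<U>" by auto
  have op: "open (\<Union>\<U>)" by (auto simp: \<U>_def)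
  have "\<Union>\<U> - \<gamma> = (\<Union>U\<in>\<U>. U - \<gamma>)" by auto
  moreover have "open (\<Union>U\<in>\<U>. U - \<gamma>)" by (intro open_UN ballI) (simp add: \<U>_def)
  ultimately have "open (\<Union>\<U> - \<gamma>)" by simp
  then have "closedin (top_of_set (\<Union>\<U>)) \<gamma>"
    using sub op by (auto simp: closedin_def openin_open_eq)
  with op sub show thesis by (rule that)
qed

lemma smooth_curve_not_isolated:
  assumes "smooth_curve \<gamma>" "p \<in> \<gamma>" "open N" "p \<in> N"
  obtains q where "q \<in> \<gamma>" "q \<in> N" "q \<noteq> p"
proof -
  obtain U and \<phi> \<kappa> :: "real ^ 2 \<Rightarrow> real ^ 2"
    where U: "p \<in> U" "open U" "open (\<phi> ` U)" "continuous_on (\<phi> ` U) \<kappa>"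
    "\<And>x. x \<in> U \<Longrightarrow> \<kappa> (\<phi> x) = x" "\<And>x. x \<in> U \<Longrightarrow> x \<in> \<gamma> \<longleftrightarrow> \<phi> x $ 2 = 0"
    using assms(1,2) by (rule smooth_chartE) blast
  have "open (\<phi> ` U \<inter> \<kappa> -` N)" by (rule continuous_open_preimage[OF U(4,3) assms(3)])
  moreover have "\<phi> p \<in> \<phi> ` U \<inter> \<kappa> -` N" using U(1,5) assms(4) by simp
  ultimately obtain e where e: "0 < e" "ball (\<phi> p) e \<subseteq> \<phi> ` U \<inter> \<kappa> -` N"
    by (meson open_contains_ball)
  define y where "y = \<phi> p + (e / 2) *\<^sub>R axis 1 1"
  have "y \<in> ball (\<phi> p) e" using e(1) by (simp add: y_def dist_norm norm_axis_1)
  then obtain q where q: "q \<in> U" "y = \<phi> q" "q \<in> N" using e(2) U(5) by force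
  have "y $ 2 = 0" using U(6)[OF U(1)] assms(2) by (simp add: y_def axis_def)
  moreover have "y $ 1 \<noteq> \<phi> p $ 1" using e(1) by (simp add: y_def axis_def)
  then have "y \<noteq> \<phi> p" by auto
  ultimately show thesis using that[of q] q U(6) by auto
qed

text \<open>If \<open>h \<circ> h\<close> were not the identity, (ICP) would make the curve analytic
  at all its points near \<open>p\<close> except possibly \<open>p\<close>. A curve has no isolated
  points, so there is such a point, against the assumption.\<close>

lemma (in germ_group) involution_of_ICP:
  assumes \<gamma>: "smooth_curve \<gamma>" "ICP G" "\<And>q. q \<in> \<gamma> \<Longrightarrow> \<not> analytic_point \<gamma> q" "p \<in> \<gamma>"
    and h: "germ h \<in> G" "\<forall>\<^sub>F x in nhds 0. p + x \<in> \<gamma> \<longrightarrow> p + h x \<in> \<gamma>"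
  shows "\<forall>\<^sub>F x in nhds 0. h (h x) = x"
proof (rule ccontr)
  assume *: "\<not> ?thesis"
  let ?\<Lambda> = "{x. p + x \<in> \<gamma>}"
  note h' = germ_memD[OF h(1)]
  have "germ h \<otimes>\<^bsub>Diff_omega\<^esub> germ h \<noteq> \<one>\<^bsub>Diff_omega\<^esub>"
    using * h' by (simp add: Diff_omega_mult_germ) (simp add: Diff_omega_def germ_eq_iff)
  moreover have sc: "smooth_curve ?\<Lambda>" by (rule smooth_curve_translate[OF \<gamma>(1)])
  then have "smooth_curve_around_0 ?\<Lambda>"
    using smooth_curve_locally_closed[OF sc] \<gamma>(4) unfolding smooth_curve_around_0_def
    by (metis (no_types, lifting) add.right_neutral mem_Collect_eq subsetD)
  moreover have "invariant_under ?\<Lambda> (germ h)"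
    unfolding invariant_under_def
  proof
    fix f assume "f \<in> germ h"
    then have "\<forall>\<^sub>F x in nhds 0. f x = h x" by (simp add: germ_def)
    with h(2) show "\<forall>\<^sub>F q in nhds 0. q \<in> ?\<Lambda> \<longrightarrow> f q \<in> ?\<Lambda>"
      by eventually_elim simp
  qed
  ultimately obtain N where N: "open N" "0 \<in> N"
    "\<And>x. x \<in> ?\<Lambda> \<inter> N \<Longrightarrow> x \<noteq> 0 \<Longrightarrow> \<exists>U. open U \<and> x \<in> U \<and> real_analytic_curve (?\<Lambda> \<inter> U)"
    using \<gamma>(2) h(1) unfolding ICP_def by meson
  have "0 \<in> ?\<Lambda>" using \<gamma>(4) by simp
  from smooth_curve_not_isolated[OF sc this N(1,2)]
  obtain x where x: "x \<in> ?\<Lambda>" "x \<in> N" "x \<noteq> 0" by blast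
  then obtain U where U: "open U" "x \<in> U" "real_analytic_curve (?\<Lambda> \<inter> U)" using N(3) by blast
  have "analytic_point (?\<Lambda> \<inter> U) x"
    using U(2,3) x(1) by (simp add: curve_of_class_def analytic_point_def)
  then have "analytic_point ?\<Lambda> x" by (rule analytic_point_of_restriction) (use U in auto)
  then have "analytic_point \<gamma> (p + x)"
    by (rule analytic_point_image[OF _ _ diffeo_on_translation]) auto
  then show False using \<gamma>(3) x(1) by simp
qed

section \<open>Curves tangent to an analytic vector field\<close>

text \<open>Limits of secants with arbitrary real scalars, possibly zero or negative. Scaled
  displacements of curve points under maps preserving the curve have this form, and no
  parametrization is involved.\<close>

definition tangent_to :: "(real ^ 2) set \<Rightarrow> real ^ 2 \<Rightarrow> real ^ 2 \<Rightarrow> bool" where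
  "tangent_to \<gamma> x v \<longleftrightarrow> (\<exists>y k. (\<forall>n::nat. y n \<in> \<gamma>) \<and> y \<longlonglongrightarrow> x \<and> (\<lambda>n. k n *\<^sub>R (y n - x)) \<longlonglongrightarrow> v)"

lemma tangent_to_imp_derivative_zero:
  fixes D :: "real ^ 2 \<Rightarrow> real ^ 2"
  assumes v: "tangent_to \<gamma> x v" and D: "(\<phi> has_derivative D) (at x)"
    and z: "\<forall>\<^sub>F y in nhds x. y \<in> \<gamma> \<longrightarrow> \<phi> y $ 2 = \<phi> x $ 2"
  shows "D v $ 2 = 0"
proof -
  obtain y k where y: "\<And>n::nat. y n \<in> \<gamma>" "y \<longlonglongrightarrow> x" and k: "(\<lambda>n. k n *\<^sub>R (y n - x)) \<longlonglongrightarrow> v"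
    using v by (auto simp: tangent_to_def)
  have lin: "linear D" and bl: "bounded_linear D"
    using D has_derivative_linear has_derivative_bounded_linear by blast+
  have "\<bar>D v $ 2\<bar> \<le> 0 + e" if e: "0 < e" for e
  proof -
    define e' where "e' = e / (norm v + 1)"
    have nv: "0 < norm v + 1" using norm_ge_zero[of v] by linarith
    then have e': "0 < e'" using e by (simp add: e'_def)
    obtain d where d: "0 < d" "\<And>y. norm (y - x) < d \<Longrightarrow> norm (\<phi> y - \<phi> x - D (y - x)) \<le> e' * norm (y - x)"
      using D e' unfolding has_derivative_at_alt by blast
    have "\<forall>\<^sub>F n in sequentially. dist (y n) x < d" by (rule tendstoD[OF y(2) d(1)])
    moreover have "\<forall>\<^sub>F n in sequentially. y n \<in> \<gamma> \<longrightarrow> \<phi> (y n) $ 2 = \<phi> x $ 2"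
      by (rule eventually_compose_filterlim[OF z y(2)])
    moreover have "\<forall>\<^sub>F n in sequentially. norm (k n *\<^sub>R (y n - x)) < norm v + 1"
      by (rule order_tendstoD(2)[OF tendsto_norm[OF k]]) simp
    ultimately have "\<forall>\<^sub>F n in sequentially. \<bar>D (k n *\<^sub>R (y n - x)) $ 2\<bar> \<le> e"
    proof eventually_elim
      case (elim n)
      have "\<bar>D (y n - x) $ 2\<bar> = \<bar>(\<phi> (y n) - \<phi> x - D (y n - x)) $ 2\<bar>"
        using elim(2) y(1) by simp
      also have "\<dots> \<le> norm (\<phi> (y n) - \<phi> x - D (y n - x))" by (rule component_le_norm_cart)
      also have "\<dots> \<le> e' * norm (y n - x)" using d(2) elim(1) by (simp add: dist_norm)
      finally have "\<bar>k n\<bar> * \<bar>D (y n - x) $ 2\<bar> \<le> \<bar>k n\<bar> * (e' * norm (y n - x))"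
        by (rule mult_left_mono) simp
      also have "\<dots> = e' * norm (k n *\<^sub>R (y n - x))" by simp
      also have "\<dots> \<le> e' * (norm v + 1)" using elim(3) e' by (intro mult_left_mono) auto
      also have "\<dots> = e" using nv by (simp add: e'_def)
      finally show ?case by (simp add: linear_scale[OF lin] abs_mult)
    qed
    moreover have "(\<lambda>n. \<bar>D (k n *\<^sub>R (y n - x)) $ 2\<bar>) \<longlonglongrightarrow> \<bar>D v $ 2\<bar>"
      by (intro tendsto_rabs tendsto_vec_nth bounded_linear.tendsto[OF bl] k)
    ultimately show ?thesis
      using tendsto_upperbound[of _ _ sequentially e] by simp
  qed
  then have "\<bar>D v $ 2\<bar> \<le> 0" by (rule field_le_epsilon)
  then show ?thesis by simp
qed

text \<open>A non-zero functional on the plane has a one-dimensional kernel, so \<open>u\<close> and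
  \<open>v\<close> are proportional; \<open>w\<close> witnesses that the functional is
  non-zero.\<close>

lemma linear_functional_kernel:
  fixes D :: "real ^ 2 \<Rightarrow> real ^ 2"
  assumes "linear D" "D u $ 2 = 0" "D v $ 2 = 0" "D w $ 2 \<noteq> 0"
  shows "u $ 1 * v $ 2 = u $ 2 * v $ 1"
proof -
  define \<alpha> where "\<alpha> = D (axis 1 1) $ 2"
  define \<beta> where "\<beta> = D (axis 2 1) $ 2"
  have rep: "D z $ 2 = \<alpha> * z $ 1 + \<beta> * z $ 2" for z
  proof -
    have "z = z $ 1 *\<^sub>R axis 1 1 + z $ 2 *\<^sub>R axis 2 1"
      by (simp add: vec_eq_iff forall_2 axis_def)
    then have "D z = z $ 1 *\<^sub>R D (axis 1 1) + z $ 2 *\<^sub>R D (axis 2 1)"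
      by (metis linear_add[OF assms(1)] linear_scale[OF assms(1)])
    then show ?thesis by (simp add: \<alpha>_def \<beta>_def)
  qed
  have u: "\<alpha> * u $ 1 = - \<beta> * u $ 2" and v: "\<alpha> * v $ 1 = - \<beta> * v $ 2"
    using assms(2,3) rep[of u] rep[of v] by linarith+
  have "\<alpha> * (u $ 1 * v $ 2 - u $ 2 * v $ 1) = (\<alpha> * u $ 1) * v $ 2 - u $ 2 * (\<alpha> * v $ 1)"
    by (simp add: algebra_simps)
  also have "\<dots> = 0" unfolding u v by (simp add: algebra_simps)
  finally have 1: "\<alpha> = 0 \<or> u $ 1 * v $ 2 = u $ 2 * v $ 1" by simp
  have "\<beta> * (u $ 1 * v $ 2 - u $ 2 * v $ 1) = u $ 1 * (\<beta> * v $ 2) - (\<beta> * u $ 2) * v $ 1"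
    by (simp add: algebra_simps)
  also have "\<beta> * v $ 2 = - (\<alpha> * v $ 1)" using v by simp
  also have "\<beta> * u $ 2 = - (\<alpha> * u $ 1)" using u by simp
  finally have "\<beta> = 0 \<or> u $ 1 * v $ 2 = u $ 2 * v $ 1" by (simp add: algebra_simps)
  with 1 show ?thesis using assms(4) rep[of w] by auto
qed

text \<open>\<open>c\<close> is the inverse chart along the horizontal axis. The last property says
  that tangent vectors are proportional to the velocity, as both are killed by the derivative of the
  second chart coordinate.\<close>

lemma smooth_curve_parametrization:
  assumes "smooth_curve \<gamma>" "p \<in> \<gamma>"
  obtains c c' :: "real \<Rightarrow> real ^ 2" and r where "0 < r" "c 0 = p"
    "\<And>t. \<bar>t\<bar> < r \<Longrightarrow> (c has_vector_derivative c' t) (at t)" "isCont c' 0" "c' 0 \<noteq> 0"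
    "\<And>t. \<bar>t\<bar> < r \<Longrightarrow> c t \<in> \<gamma>"
    "\<And>d. 0 < d \<Longrightarrow> \<exists>N. open N \<and> p \<in> N \<and> \<gamma> \<inter> N \<subseteq> c ` {-d<..<d}"
    "\<And>t v. \<bar>t\<bar> < r \<Longrightarrow> tangent_to \<gamma> (c t) v \<Longrightarrow> v $ 1 * c' t $ 2 = v $ 2 * c' t $ 1"
proof -
  obtain U and \<phi> \<kappa> :: "real ^ 2 \<Rightarrow> real ^ 2" where U: "p \<in> U" "open U" "open (\<phi> ` U)" "continuous_on U \<phi>"
    and \<phi>: "\<And>x. x \<in> U \<Longrightarrow> \<phi> differentiable (at x)"
    and \<kappa>: "\<And>y. y \<in> \<phi> ` U \<Longrightarrow> \<kappa> differentiable (at y)" "continuous_on (\<phi> ` U) \<kappa>"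
      "\<And>v. continuous_on (\<phi> ` U) (\<lambda>x. frechet_derivative \<kappa> (at x) v)"
    and \<kappa>\<phi>: "\<And>x. x \<in> U \<Longrightarrow> \<kappa> (\<phi> x) = x" and \<gamma>: "\<And>x. x \<in> U \<Longrightarrow> x \<in> \<gamma> \<longleftrightarrow> \<phi> x $ 2 = 0"
    using assms by (rule smooth_chartE) blast
  have "\<phi> p \<in> \<phi> ` U" using U(1) by simp
  with U(3) obtain r where r: "0 < r" "ball (\<phi> p) r \<subseteq> \<phi> ` U" by (meson open_contains_ball)
  have p2: "\<phi> p $ 2 = 0" using \<gamma>[OF U(1)] assms(2) by simp
  define y where "y t = \<phi> p + t *\<^sub>R axis 1 1" for t :: real
  define c where "c t = \<kappa> (y t)" for t
  define c' where "c' t = frechet_derivative \<kappa> (at (y t)) (axis 1 1)" for t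
  have y: "y t \<in> \<phi> ` U" if "\<bar>t\<bar> < r" for t
    using that r(2) by (auto simp: y_def dist_norm norm_axis_1 intro!: subsetD[OF r(2)])
  have \<phi>\<kappa>: "\<phi> (\<kappa> z) = z" if "z \<in> \<phi> ` U" for z using that \<kappa>\<phi> by auto
  have c: "c t \<in> U" "\<phi> (c t) = y t" if "\<bar>t\<bar> < r" for t
    using y[OF that] \<kappa>\<phi> by (auto simp: c_def)
  have y2: "y t $ 2 = 0" for t using p2 by (simp add: y_def axis_def)
  have dy: "(y has_derivative (\<lambda>h. h *\<^sub>R axis 1 1)) (at t)" for t
    unfolding y_def by (auto intro!: derivative_eq_intros)
  have dc: "(c has_vector_derivative c' t) (at t)" if t: "\<bar>t\<bar> < r" for t
  proof -
    have d\<kappa>: "(\<kappa> has_derivative frechet_derivative \<kappa> (at (y t))) (at (y t))"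
      using \<kappa>(1)[OF y[OF t]] by (simp add: frechet_derivative_works)
    from has_derivative_compose[OF dy d\<kappa>] show ?thesis
      using linear_scale[OF has_derivative_linear[OF d\<kappa>]]
      by (simp add: has_vector_derivative_def c_def[abs_def] c'_def)
  qed
  have inv: "frechet_derivative \<phi> (at (c t)) (frechet_derivative \<kappa> (at (y t)) v) = v" if t: "\<bar>t\<bar> < r" for t v
  proof -
    have d\<kappa>: "(\<kappa> has_derivative frechet_derivative \<kappa> (at (y t))) (at (y t))"
      using \<kappa>(1)[OF y[OF t]] by (simp add: frechet_derivative_works)
    have d\<phi>: "(\<phi> has_derivative frechet_derivative \<phi> (at (c t))) (at (\<kappa> (y t)))"
      using \<phi>[OF c(1)[OF t]] by (simp add: frechet_derivative_works c_def)
    have "((\<lambda>z. \<phi> (\<kappa> z)) has_derivative (\<lambda>z. z)) (at (y t))"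
      by (rule has_derivative_transform_within_open[OF has_derivative_ident U(3) y[OF t]]) (simp add: \<phi>\<kappa>)
    from has_derivative_unique[OF has_derivative_compose[OF d\<kappa> d\<phi>] this] show ?thesis by (rule fun_cong)
  qed
  show thesis
  proof (rule that[of r c c'])
    show "0 < r" by (rule r(1))
    show "c 0 = p" using \<kappa>\<phi>[OF U(1)] by (simp add: c_def y_def)
    show "(c has_vector_derivative c' t) (at t)" if "\<bar>t\<bar> < r" for t by (rule dc[OF that])
    have "isCont y 0" using dy by (rule has_derivative_continuous)
    moreover have "isCont (\<lambda>x. frechet_derivative \<kappa> (at x) (axis 1 1)) (y 0)"
      by (rule bspec[OF continuous_on_eq_continuous_at[OF U(3), THEN iffD1, OF \<kappa>(3)]]) (use y[of 0] r(1) in simp)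
    ultimately show "isCont c' 0" unfolding c'_def[abs_def] by (rule isCont_o2)
    have "linear (frechet_derivative \<phi> (at (c 0)))"
      using \<phi>[OF c(1)[of 0]] r(1) by (intro linear_frechet_derivative) simp
    then show "c' 0 \<noteq> 0"
      using inv[of 0 "axis 1 1"] r(1) linear_0[of "frechet_derivative \<phi> (at (c 0))"]
      by (auto simp: c'_def axis_eq_0_iff)
    show "c t \<in> \<gamma>" if "\<bar>t\<bar> < r" for t using \<gamma>[OF c(1)[OF that]] c(2)[OF that] y2 by simp
    show "\<exists>N. open N \<and> p \<in> N \<and> \<gamma> \<inter> N \<subseteq> c ` {-d<..<d}" if d: "0 < d" for d
    proof (intro exI[of _ "U \<inter> \<phi> -` ball (\<phi> p) d"] conjI)
      show "open (U \<inter> \<phi> -` ball (\<phi> p) d)" by (rule continuous_open_preimage[OF U(4,2)]) simp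
      show "p \<in> U \<inter> \<phi> -` ball (\<phi> p) d" using U(1) d by simp
      show "\<gamma> \<inter> (U \<inter> \<phi> -` ball (\<phi> p) d) \<subseteq> c ` {-d<..<d}"
      proof
        fix x assume x: "x \<in> \<gamma> \<inter> (U \<inter> \<phi> -` ball (\<phi> p) d)"
        define t where "t = \<phi> x $ 1 - \<phi> p $ 1"
        have "\<phi> x $ 2 = 0" using \<gamma> x by auto
        then have "y t = \<phi> x" using p2 by (simp add: y_def t_def vec_eq_iff forall_2 axis_def)
        then have "c t = x" using x \<kappa>\<phi> by (simp add: c_def)
        moreover have "\<bar>t\<bar> < d"
          using x component_le_norm_cart[of "\<phi> x - \<phi> p" 1] by (simp add: t_def dist_norm norm_minus_commute)
        ultimately show "x \<in> c ` {-d<..<d}" by (auto simp: abs_less_iff intro!: image_eqI[of _ _ t])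
      qed
    qed
    show "v $ 1 * c' t $ 2 = v $ 2 * c' t $ 1" if t: "\<bar>t\<bar> < r" and v: "tangent_to \<gamma> (c t) v" for t v
    proof (rule linear_functional_kernel[where D = "frechet_derivative \<phi> (at (c t))"])
      have d\<phi>: "(\<phi> has_derivative frechet_derivative \<phi> (at (c t))) (at (c t))"
        using \<phi>[OF c(1)[OF t]] by (simp add: frechet_derivative_works)
      then show "linear (frechet_derivative \<phi> (at (c t)))" by (rule has_derivative_linear)
      have "\<forall>\<^sub>F z in nhds (c t). z \<in> U" using U(2) c(1)[OF t] by (rule eventually_nhds_in_open)
      then have "\<forall>\<^sub>F z in nhds (c t). z \<in> \<gamma> \<longrightarrow> \<phi> z $ 2 = \<phi> (c t) $ 2"
        by eventually_elim (simp add: \<gamma> c(2)[OF t] y2)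
      from tangent_to_imp_derivative_zero[OF v d\<phi> this]
      show "frechet_derivative \<phi> (at (c t)) v $ 2 = 0" .
      show "frechet_derivative \<phi> (at (c t)) (c' t) $ 2 = 0"
        using inv[OF t] by (simp add: c'_def axis_def)
      show "frechet_derivative \<phi> (at (c t)) (frechet_derivative \<kappa> (at (y t)) (axis 2 1)) $ 2 \<noteq> 0"
        using inv[OF t] by (simp add: axis_def)
    qed
  qed
qed

subsection \<open>Analytic solutions of scalar differential equations\<close>

text \<open>Integration from 0 in the first variable: multiply by the variable and divide by the new
  exponent. At exponent 0 the numerator vanishes too, so the division by zero gives the right value
  0.\<close>

definition integ :: "wiener \<Rightarrow> wiener" where
  "integ g = series (\<lambda>n. coef (coord1 * g) n / real (fst n))"

lemma abs_coef_divide_le: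
  "\<bar>coef (coord1 * g) n / real (fst n)\<bar> \<le> \<bar>coef (coord1 * g) n\<bar>"
proof (cases "fst n = 0")
  case False
  then have "1 \<le> real (fst n)" by simp
  then have "\<bar>coef (coord1 * g) n\<bar> * 1 \<le> \<bar>coef (coord1 * g) n\<bar> * real (fst n)" by (intro mult_left_mono) auto
  then show ?thesis using False by (simp add: abs_divide field_simps)
qed simp

lemma coef_integ: "coef (integ g) n = coef (coord1 * g) n / real (fst n)"
proof -
  have "(\<lambda>n. norm (coef (coord1 * g) n / real (fst n))) summable_on UNIV"
    by (rule summable_on_norm_comparison[OF coef_summable[of "coord1 * g"]]) (simp add: abs_coef_divide_le del: abs_divide)
  then show ?thesis by (simp add: integ_def coef_series)
qed

lemma norm_integ_le: "norm (integ g) \<le> norm g"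
proof -
  have "norm (integ g) \<le> norm (coord1 * g)"
    by (rule has_sum_mono[OF norm_wiener_has_sum norm_wiener_has_sum]) (simp add: coef_integ abs_coef_divide_le del: abs_divide)
  also have "\<dots> \<le> norm coord1 * norm g" by (rule norm_mult_ineq)
  finally show ?thesis by (simp add: norm_coord)
qed

lemma integ_diff: "integ g - integ h = integ (g - h)"
  by (rule wiener_eqI) (simp add: coef_integ right_diff_distrib diff_divide_distrib)

text \<open>Evaluation at \<open>line1\<close> restricts a series to the first axis, where it is an
  ordinary power series in one variable.\<close>

definition line1 :: "'b \<Rightarrow> 'b::zero ^ 2" where "line1 s = vector [s, 0]"

lemma line1_nth [simp]: "line1 s $ 1 = s" "line1 s $ 2 = 0" by (simp_all add: line1_def)

lemma line1_in_bidisc: "norm s \<le> \<theta> \<Longrightarrow> line1 s \<in> bidisc \<theta>" for s :: "'b::real_normed_vector"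
  using norm_ge_zero[of s] order_trans[OF norm_ge_zero[of s], of \<theta>] by (simp add: bidisc_def)

lemma app_line1_sums:
  fixes s :: real
  assumes "\<bar>s\<bar> \<le> 1"
  shows "(\<lambda>m. coef F (m, 0) * s ^ m) sums app F (line1 s)"
proof -
  have "((\<lambda>n. coef F n *\<^sub>R mono2 (line1 s) n) has_sum app F (line1 s)) UNIV"
    by (rule app_has_sum(2)) (use assms line1_in_bidisc[of s 1] in simp)
  then have "((\<lambda>n. coef F n *\<^sub>R mono2 (line1 s) n) has_sum app F (line1 s)) (range (\<lambda>m. (m, 0)))"
    by (rule has_sum_cong_neutral[THEN iffD1, rotated -1]) (auto simp: mono2_def power_0_left)
  then have "((\<lambda>m. coef F (m, 0) * s ^ m) has_sum app F (line1 s)) UNIV"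
    by (subst (asm) has_sum_reindex) (auto simp: inj_on_def o_def mono2_def)
  then show ?thesis by (rule has_sum_imp_sums)
qed

lemma app_integ_has_derivative:
  fixes s :: real
  assumes "\<bar>s\<bar> < 1"
  shows "((\<lambda>s. app (integ g) (line1 s)) has_real_derivative app g (line1 s)) (at s)"
proof -
  let ?c = "\<lambda>m. coef (integ g) (m, 0)"
  have "((\<lambda>z. \<Sum>n. ?c n * z ^ n) has_field_derivative (\<Sum>n. diffs ?c n * s ^ n)) (at s)"
    by (rule termdiffs_strong'[of 1]) (use assms app_line1_sums[of _ "integ g"] in \<open>auto simp: sums_iff\<close>)
  moreover have "diffs ?c n = coef g (n, 0)" for n
    by (simp add: diffs_def coef_integ coef_coord1_mult)
  then have "(\<Sum>n. diffs ?c n * s ^ n) = app g (line1 s)"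
    using app_line1_sums[of s g] assms by (simp add: sums_iff)
  ultimately have "((\<lambda>z. \<Sum>n. ?c n * z ^ n) has_field_derivative app g (line1 s)) (at s)" by simp
  then show ?thesis
    by (rule has_field_derivative_transform_within_open[where S = "{-1<..<1}"])
      (use assms app_line1_sums[of _ "integ g"] in \<open>auto simp: sums_iff abs_less_iff\<close>)
qed

text \<open>The point whose \<open>i\<close>-th coordinate is \<open>a\<close> and whose other coordinate is \<open>b\<close>: keeping \<open>i\<close>
  arbitrary treats graphs over either axis at once.\<close>

definition point :: "2 \<Rightarrow> 'b \<Rightarrow> 'b \<Rightarrow> 'b ^ 2" where
  "point i a b = (\<chi> l. if l = i then a else b)"

lemma norm1_point_diff: "norm1 (point i a b - point i a b') = norm (b - b')"
  by (cases "i = 1") (use exhaust_2[of i] in \<open>auto simp: norm1_def point_def\<close>)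

lemma point_in_bidisc: "norm a \<le> \<theta> \<Longrightarrow> norm b \<le> \<theta> \<Longrightarrow> point i a b \<in> bidisc \<theta>"
  by (simp add: bidisc_iff point_def)

text \<open>Picard iteration inside the algebra: \<open>w\<close> is the fixed point of the
  contraction \<open>T\<close> on the ball of radius 1/2, so the solution is analytic by
  construction. Time is scaled by \<tau> to make it a series on the unit bidisc, of which only the
  values on \<open>line1\<close> count.\<close>

lemma analytic_ode_solution:
  fixes Q :: wiener
  obtains w \<tau> where "0 < \<tau>" "\<tau> \<le> 1/2" "norm w \<le> 1/2" "coef w (0, 0) = 0"
    "\<And>t. \<bar>t\<bar> < \<tau> \<Longrightarrow> ((\<lambda>t. app w (line1 (t / \<tau>))) has_real_derivative
        app Q (point i t (app w (line1 (t / \<tau>))))) (at t)"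
proof -
  \<comment> \<open>This gives 4 * \<tau> * \<open>norm Q\<close> \<le> 1/2, the contraction
    constant of \<open>T\<close>, and \<tau> \<le> 1/2, so that \<open>P w\<close> stays in the
    bidisc of radius 3/4 where the Lipschitz bound holds.\<close>
  define \<tau> where "\<tau> = 1 / (8 * norm Q + 2)"
  have n: "0 < 8 * norm Q + 2" using norm_ge_zero[of Q] by linarith
  have \<tau>: "0 < \<tau>" "\<tau> \<le> 1/2" "4 * \<tau> * norm Q \<le> 1/2"
  proof -
    have "0 < 1 / N \<and> 1 / N \<le> 1/2 \<and> 4 * (1 / N) * x \<le> 1/2" if "N = 8 * x + 2" "0 \<le> x" for N x :: real
      using that by (simp add: divide_le_eq)
    from this[OF refl norm_ge_zero[of Q]]
    show "0 < \<tau>" "\<tau> \<le> 1/2" "4 * \<tau> * norm Q \<le> 1/2" unfolding \<tau>_def by blast+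
  qed
  define P :: "wiener \<Rightarrow> wiener ^ 2" where "P w = point i (\<tau> *\<^sub>R coord1) w" for w
  define T where "T w = \<tau> *\<^sub>R integ (app Q (P w))" for w
  let ?S = "cball (0 :: wiener) (1/2)"
  have P: "P w \<in> bidisc (3/4)" "P w \<in> bidisc 1" if "w \<in> ?S" for w
    using that \<tau> by (auto simp: P_def norm_coord intro!: point_in_bidisc)
  have T_in: "norm (T w) \<le> 1/2" if "w \<in> ?S" for w
  proof -
    have "norm (T w) \<le> \<tau> * norm Q"
      using norm_integ_le[of "app Q (P w)"] app_has_sum(3)[OF P(2)[OF that], of Q] \<tau>(1)
      by (simp add: T_def mult_left_mono)
    also have "\<dots> \<le> 1/2" using \<tau> norm_ge_zero[of Q] mult_nonneg_nonneg[of \<tau> "norm Q"] by linarith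
    finally show ?thesis .
  qed
  have "\<exists>!w\<in>?S. T w = w"
  proof (rule Banach_fix)
    show "complete ?S" by (intro complete_eq_closed[THEN iffD2] closed_cball)
    show "?S \<noteq> {}" "0 \<le> (1/2 :: real)" "(1/2 :: real) < 1" by auto
    show "T ` ?S \<subseteq> ?S" using T_in by auto
    show "dist (T w) (T w') \<le> 1/2 * dist w w'" if "w \<in> ?S" "w' \<in> ?S" for w w'
    proof -
      have "dist (T w) (T w') = \<tau> * norm (integ (app Q (P w) - app Q (P w')))"
        using \<tau>(1) by (simp add: dist_norm T_def scaleR_diff_right[symmetric] integ_diff)
      also have "\<dots> \<le> \<tau> * (4 * norm Q * norm1 (P w - P w'))"
        using \<tau>(1) order_trans[OF norm_integ_le norm_app_diff_le[OF P(1)[OF that(1)] P(1)[OF that(2)], of Q]]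
        by (intro mult_left_mono) auto
      also have "\<dots> = (4 * \<tau> * norm Q) * dist w w'" by (simp add: P_def norm1_point_diff dist_norm)
      also have "\<dots> \<le> 1/2 * dist w w'" using \<tau>(3) by (intro mult_right_mono) auto
      finally show ?thesis .
    qed
  qed
  then obtain w where w: "w \<in> ?S" "T w = w" by blast
  show thesis
  proof (rule that[of \<tau> w])
    show "norm w \<le> 1/2" using w(1) by simp
    have "coef w (0, 0) = coef (T w) (0, 0)" using w(2) by simp
    also have "\<dots> = 0" by (simp add: T_def coef_integ)
    finally show "coef w (0, 0) = 0" .
    fix t :: real assume t: "\<bar>t\<bar> < \<tau>"
    have s: "\<bar>t / \<tau>\<bar> < 1" using t \<tau>(1) by simp
    let ?g = "app Q (P w)"
    have b: "line1 (s / \<tau>) \<in> bidisc 1" if "\<bar>s\<bar> < \<tau>" for s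
      using that \<tau>(1) by (intro line1_in_bidisc) simp
    have eq: "app w (line1 (s / \<tau>)) = \<tau> * app (integ ?g) (line1 (s / \<tau>))" if "\<bar>s\<bar> < \<tau>" for s
      using arg_cong[OF w(2), of "\<lambda>w. app w (line1 (s / \<tau>))"] app_scaleR[OF b[OF that], of \<tau> "integ ?g"]
      by (simp add: T_def)
    have "((\<lambda>s. \<tau> * app (integ ?g) (line1 (s / \<tau>))) has_real_derivative
        \<tau> * (app ?g (line1 (t / \<tau>)) * (1 / \<tau>))) (at t)"
      by (intro DERIV_cmult DERIV_chain2[where f = "\<lambda>s. app (integ ?g) (line1 s)" and g = "\<lambda>s. s / \<tau>",
            OF app_integ_has_derivative[OF s]])
        (use \<tau>(1) in \<open>auto intro!: derivative_eq_intros\<close>)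
    moreover have "\<tau> * (app ?g (line1 (t / \<tau>)) * (1 / \<tau>)) = app Q (point i t (app w (line1 (t / \<tau>))))"
    proof -
      have "appv (P w) (line1 (t / \<tau>)) = point i t (app w (line1 (t / \<tau>)))"
        using \<tau>(1) app_scaleR[OF b[OF t], of \<tau> coord1] by (simp add: vec_eq_iff P_def point_def)
      then show ?thesis using app_app[OF P(2)[OF w(1)] b[OF t], of Q] \<tau>(1) by simp
    qed
    ultimately have "((\<lambda>s. \<tau> * app (integ ?g) (line1 (s / \<tau>))) has_real_derivative
        app Q (point i t (app w (line1 (t / \<tau>))))) (at t)" by simp
    then show "((\<lambda>t. app w (line1 (t / \<tau>))) has_real_derivative app Q (point i t (app w (line1 (t / \<tau>))))) (at t)"
      by (rule has_field_derivative_transform_within_open[where S = "{-\<tau><..<\<tau>}"])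
        (use t eq in \<open>auto simp: abs_less_iff\<close>)
  qed (use \<tau> in auto)
qed

text \<open>The inverse is the Neumann series in \<open>1 - A\<close>.\<close>

lemma wiener_inverse:
  assumes "norm (1 - A) < 1"
  obtains V :: wiener where "A * V = 1"
proof -
  let ?w = "1 - A"
  have s: "summable (\<lambda>n. ?w ^ n)" by (rule complete_algebra_summable_geometric[OF assms])
  have "(\<Sum>n. ?w ^ n) = 1 + (\<Sum>n. ?w ^ Suc n)"
    using suminf_split_head[OF s] by simp
  also have "(\<Sum>n. ?w ^ Suc n) = ?w * (\<Sum>n. ?w ^ n)"
    using suminf_mult[OF s, of ?w] by simp
  finally have "A * (\<Sum>n. ?w ^ n) = 1" by (simp add: algebra_simps)
  then show thesis by (rule that)
qed

text \<open>A Gronwall argument on an interval so short that C * d' \<le> 1/2: at a maximum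
  \<open>m\<close> of \<open>\<bar>e\<bar>\<close>, the mean value inequality bounds
  \<open>\<bar>e m\<bar>\<close> by half of itself.\<close>

lemma linear_differential_inequality_imp_zero:
  fixes e e' :: "real \<Rightarrow> real"
  assumes d: "0 < d" and e: "\<And>t. \<bar>t\<bar> < d \<Longrightarrow> (e has_real_derivative e' t) (at t)"
    and le: "\<And>t. \<bar>t\<bar> < d \<Longrightarrow> \<bar>e' t\<bar> \<le> C * \<bar>e t\<bar>" and 0: "e 0 = 0" and C: "0 \<le> C"
  obtains d' where "0 < d'" "d' \<le> d" "\<And>t. \<bar>t\<bar> < d' \<Longrightarrow> e t = 0"
proof -
  define d' where "d' = min (d / 2) (1 / (2 * (C + 1)))"
  have d': "0 < d'" "d' < d" "C * d' \<le> 1/2"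
  proof -
    show "0 < d'" "d' < d" using d C by (auto simp: d'_def)
    have "C * d' \<le> C * (1 / (2 * (C + 1)))" using C by (intro mult_left_mono) (auto simp: d'_def)
    also have "\<dots> \<le> 1/2" using C by (simp add: field_simps)
    finally show "C * d' \<le> 1/2" .
  qed
  let ?I = "{-d'..d'}"
  have I: "\<bar>t\<bar> < d" if "t \<in> ?I" for t using that d' by (auto simp: abs_less_iff)
  have cont: "continuous_on ?I (\<lambda>t. \<bar>e t\<bar>)"
    by (intro continuous_on_rabs continuous_at_imp_continuous_on ballI) (use e I DERIV_isCont in blast)
  have "?I \<noteq> {}" using d'(1) by simp
  from continuous_attains_sup[OF compact_Icc this cont]
  obtain m where m: "m \<in> ?I" "\<And>t. t \<in> ?I \<Longrightarrow> \<bar>e t\<bar> \<le> \<bar>e m\<bar>" by blast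
  have "norm (e m - e 0) \<le> (C * \<bar>e m\<bar>) * norm (m - 0)"
  proof (rule field_differentiable_bound[where S = ?I and f' = e'])
    show "(e has_field_derivative e' z) (at z within ?I)" if "z \<in> ?I" for z
      using e[OF I[OF that]] by (rule DERIV_subset) simp
    show "norm (e' z) \<le> C * \<bar>e m\<bar>" if "z \<in> ?I" for z
      using le[OF I[OF that]] mult_left_mono[OF m(2)[OF that] C] by simp
  qed (use m(1) d' in auto)
  also have "\<dots> \<le> (C * \<bar>e m\<bar>) * d'" using m(1) C by (intro mult_left_mono) (auto simp: abs_le_iff)
  also have "\<dots> = (C * d') * \<bar>e m\<bar>" by simp
  also have "\<dots> \<le> 1/2 * \<bar>e m\<bar>" using d'(3) by (intro mult_right_mono) auto
  finally have "e m = 0" by (simp add: 0)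
  then have "e t = 0" if "\<bar>t\<bar> < d'" for t using m(2)[of t] that by (auto simp: abs_less_iff)
  with d' show thesis by (intro that[of d']) auto
qed

text \<open>The derivative forces opposite signs on the two sides of 0, and connectedness fills in
  the values between. This will show that the curve projects onto a neighbourhood in the
  axis.\<close>

lemma covers_neighbourhood_of_pos_deriv:
  fixes f :: "real \<Rightarrow> real"
  assumes d: "0 < d" and cont: "continuous_on {-d<..<d} f" and f: "f 0 = 0" "(f has_real_derivative D) (at 0)" and D: "0 < D"
  shows "\<exists>\<mu>>0. {-\<mu><..<\<mu>} \<subseteq> f ` {-d<..<d}"
proof -
  obtain h1 where h1: "0 < h1" "\<And>h. 0 < h \<Longrightarrow> h < h1 \<Longrightarrow> f 0 < f (0 + h)"
    using DERIV_pos_inc_right[OF f(2) D] by blast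
  obtain h2 where h2: "0 < h2" "\<And>h. 0 < h \<Longrightarrow> h < h2 \<Longrightarrow> f (0 - h) < f 0"
    using DERIV_pos_inc_left[OF f(2) D] by blast
  define h where "h = min (d / 2) (min (h1 / 2) (h2 / 2))"
  have h: "0 < h" "h < d" "h < h1" "h < h2" using d h1(1) h2(1) by (auto simp: h_def)
  have pos: "0 < f h" and neg: "f (- h) < 0" using h1(2)[OF h(1,3)] h2(2)[OF h(1,4)] f(1) by simp_all
  have con: "connected (f ` {-d<..<d})" by (rule connected_continuous_image[OF cont]) simp
  have "{f (- h)..f h} \<subseteq> f ` {-d<..<d}"
    by (rule connected_contains_Icc[OF con]) (use h in auto)
  then have "{- min (f h) (- f (- h))<..<min (f h) (- f (- h))} \<subseteq> f ` {-d<..<d}" by force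
  then show ?thesis using pos neg by (intro exI[of _ "min (f h) (- f (- h))"]) auto
qed

lemma covers_neighbourhood:
  fixes f :: "real \<Rightarrow> real"
  assumes d: "0 < d" and cont: "continuous_on {-d<..<d} f" and f: "f 0 = 0" "(f has_real_derivative D) (at 0)" and D: "D \<noteq> 0"
  shows "\<exists>\<mu>>0. {-\<mu><..<\<mu>} \<subseteq> f ` {-d<..<d}"
proof (cases "0 < D")
  case True
  then show ?thesis using covers_neighbourhood_of_pos_deriv assms by blast
next
  case False
  have "\<exists>\<mu>>0. {-\<mu><..<\<mu>} \<subseteq> (\<lambda>t. - f t) ` {-d<..<d}"
    by (rule covers_neighbourhood_of_pos_deriv[where D = "- D"])
      (use False D f d cont in \<open>auto intro!: continuous_on_minus DERIV_minus\<close>)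
  then obtain \<mu> where \<mu>: "0 < \<mu>" "{-\<mu><..<\<mu>} \<subseteq> (\<lambda>t. - f t) ` {-d<..<d}" by blast
  have "u \<in> f ` {-d<..<d}" if "u \<in> {-\<mu><..<\<mu>}" for u
  proof -
    have "- u \<in> (\<lambda>t. - f t) ` {-d<..<d}" using that by (intro subsetD[OF \<mu>(2)]) auto
    then show ?thesis by auto
  qed
  with \<mu>(1) show ?thesis by blast
qed

section \<open>Graph charts and curves tangent to an analytic field\<close>

definition graph_chart :: "real ^ 2 \<Rightarrow> real \<Rightarrow> 2 \<Rightarrow> 2 \<Rightarrow> (real \<Rightarrow> real) \<Rightarrow> real ^ 2 \<Rightarrow> real ^ 2" where
  "graph_chart p r i j v x = vector [(x - p) $ i / r, (x - p) $ j / r - v ((x - p) $ i / r)]"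

definition graph_unchart :: "real ^ 2 \<Rightarrow> real \<Rightarrow> 2 \<Rightarrow> (real \<Rightarrow> real) \<Rightarrow> real ^ 2 \<Rightarrow> real ^ 2" where
  "graph_unchart p r i v y = p + r *\<^sub>R point i (y $ 1) (y $ 2 + v (y $ 1))"

text \<open>The chart divides by \<open>r\<close> and \<open>v\<close> is a series in t / \<tau>,
  hence the radius r * \<tau>. Substituting \<open>line1 (coords $ i)\<close> turns the one-variable
  series into a function of coordinate \<open>i\<close> of the plane.\<close>

lemma graph_chart_analytic:
  assumes v: "\<And>t. v t = app w (line1 (t / \<tau>))" and \<tau>: "0 < \<tau>" and r: "0 < r" and x: "norm (x - p) < r * \<tau>"
    and ij: "i \<noteq> j"
  shows "ranalytic_at (graph_chart p r i j v) x"
proof (rule expands_imp_ranalytic_at[OF _ x])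
  have l: "line1 (coords $ i) \<in> bidisc 1" by (rule line1_in_bidisc) (use exhaust_2[of i] in \<open>auto simp: norm_coord\<close>)
  define E :: "wiener ^ 2" where
    "E = vector [\<tau> *\<^sub>R coords $ i, \<tau> *\<^sub>R coords $ j - app w (line1 (coords $ i))]"
  have cn: "app (coords $ l) a = a $ l" for l and a :: "real ^ 2"
    using exhaust_2[of l] by auto
  show "expands (\<lambda>x. graph_chart p r i j v (p + x)) (r * \<tau>) ((1 / (r * \<tau>)) *\<^sub>R E)"
    unfolding expands_def
  proof (intro conjI allI impI)
    show rt: "0 < r * \<tau>" using r \<tau> by simp
    fix x :: "real ^ 2" assume "norm x \<le> r * \<tau>"
    then have b: "x /\<^sub>R (r * \<tau>) \<in> bidisc 1" using scaled_in_bidisc[OF rt, of x 1] by simp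
    have v': "v (x $ i / r) = app (app w (line1 (coords $ i))) (x /\<^sub>R (r * \<tau>))"
    proof -
      have "appv (line1 (coords $ i)) (x /\<^sub>R (r * \<tau>)) = line1 (x $ i / r / \<tau>)"
        using app_zero[OF b] r \<tau> by (simp add: vec_eq_iff forall_2 cn field_simps)
      then show ?thesis using app_app[OF l b, of w] by (simp add: v)
    qed
    define \<xi> where "\<xi> = x /\<^sub>R (r * \<tau>)"
    note b = b[folded \<xi>_def] and v' = v'[folded \<xi>_def]
    have \<xi>: "(r * \<tau>) * \<xi> $ l = x $ l" for l using r \<tau> by (simp add: \<xi>_def field_simps)
    have "app (E $ 1) \<xi> = x $ i / r" using r \<xi>[of i] by (simp add: E_def app_scaleR[OF b] cn field_simps)
    moreover have "app (E $ 2) \<xi> = x $ j / r - v (x $ i / r)"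
      using r \<xi>[of j] by (simp add: E_def app_diff[OF b] app_scaleR[OF b] cn v' field_simps)
    ultimately have "appv E \<xi> = graph_chart p r i j v (p + x)"
      by (simp add: vec_eq_iff forall_2 graph_chart_def)
    then show "graph_chart p r i j v (p + x) = (r * \<tau>) *\<^sub>R appv ((1 / (r * \<tau>)) *\<^sub>R E) (x /\<^sub>R (r * \<tau>))"
      unfolding \<xi>_def[symmetric] using r \<tau> by (simp add: appv_simps[OF b])
  qed
qed

lemma graph_unchart_analytic:
  assumes v: "\<And>t. v t = app w (line1 (t / \<tau>))" and \<tau>: "0 < \<tau>" and y: "norm y < \<tau>"
  shows "ranalytic_at (graph_unchart p r i v) y"
proof (rule expands_imp_ranalytic_at)
  show "norm (y - 0) < \<tau>" using y by simp
  have l: "line1 coord1 \<in> bidisc 1" by (rule line1_in_bidisc) (simp add: norm_coord)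
  define E :: "wiener ^ 2" where
    "E = constv p + r *\<^sub>R point i (\<tau> *\<^sub>R coord1) (\<tau> *\<^sub>R coord2 + app w (line1 coord1))"
  show "expands (\<lambda>x. graph_unchart p r i v (0 + x)) \<tau> ((1 / \<tau>) *\<^sub>R E)"
    unfolding expands_def
  proof (intro conjI allI impI)
    show "0 < \<tau>" by (rule \<tau>)
    fix x :: "real ^ 2" assume "norm x \<le> \<tau>"
    then have b: "x /\<^sub>R \<tau> \<in> bidisc 1" using scaled_in_bidisc[OF \<tau>, of x 1] by simp
    have v': "app (app w (line1 coord1)) (x /\<^sub>R \<tau>) = v (x $ 1)"
    proof -
      have "appv (line1 coord1) (x /\<^sub>R \<tau>) = line1 (x $ 1 / \<tau>)"
        using app_zero[OF b] \<tau> by (simp add: vec_eq_iff forall_2 field_simps)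
      then show ?thesis using app_app[OF l b, of w] by (simp add: v)
    qed
    have "appv E (x /\<^sub>R \<tau>) = p + r *\<^sub>R point i (x $ 1) (x $ 2 + v (x $ 1))"
      using \<tau> app_add[OF b] app_scaleR[OF b]
      by (simp add: E_def appv_simps[OF b] appv_constv) (simp add: vec_eq_iff point_def v')
    then show "graph_unchart p r i v (0 + x) = \<tau> *\<^sub>R appv ((1 / \<tau>) *\<^sub>R E) (x /\<^sub>R \<tau>)"
      using \<tau> by (simp add: appv_simps[OF b] graph_unchart_def)
  qed
qed

text \<open>Where component \<open>i\<close> of the field does not vanish, the slope
  \<open>Q\<close> of the field over axis \<open>i\<close> is analytic. The curve and the analytic
  solution \<open>v\<close> obey the same equation with slope \<open>Q\<close>, so the curve is the
  graph of \<open>v\<close> near \<open>p\<close>.\<close>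

lemma analytic_point_of_tangent_field:
  fixes F :: "wiener ^ 2"
  assumes \<gamma>: "smooth_curve \<gamma>" "p \<in> \<gamma>" and \<rho>: "0 < \<rho>" and nz: "coef (F $ i) (0, 0) \<noteq> 0"
    and tan: "\<And>x. x \<in> \<gamma> \<Longrightarrow> norm (x - p) \<le> \<rho> \<Longrightarrow> tangent_to \<gamma> x (appv F ((x - p) /\<^sub>R \<rho>))"
  shows "analytic_point \<gamma> p"
proof -
  define j :: 2 where "j = (if i = 1 then 2 else 1)"
  have ij: "i \<noteq> j" "l = i \<or> l = j" for l
    using exhaust_2[of i] exhaust_2[of l] by (auto simp: j_def)
  define a where "a = coef (F $ i) (0, 0)"
  have a: "0 < \<bar>a\<bar>" using nz by (simp add: a_def)
  \<comment> \<open>On the disc shrunk by \<open>s\<close> the series \<open>A\<close> differs from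
    its constant term \<open>a\<close> by at most 8 * s * \<open>norm (F $ i)\<close> \<le>
    \<open>\<bar>a\<bar> / 2\<close>, so \<open>A\<close> divided by \<open>a\<close> is invertible
    by a Neumann series.\<close>
  define s where "s = min (1/2) (\<bar>a\<bar> / (16 * (norm (F $ i) + 1)))"
  have nF: "0 < norm (F $ i) + 1" using norm_ge_zero[of "F $ i"] by linarith
  have s: "0 < s" using a nF by (auto simp: s_def)
  have "s \<le> 1/2" unfolding s_def by (rule min.cobounded1)
  note s = s this
  define A where "A = app (F $ i) (s *\<^sub>R coords)"
  define B where "B = app (F $ j) (s *\<^sub>R coords)"
  have "norm (1 - (1 / a) *\<^sub>R A) < 1"
  proof -
    have "norm (app (F $ i) 0 - app (F $ i) (s *\<^sub>R coords)) \<le> 4 * norm (F $ i) * norm1 (0 - s *\<^sub>R coords)"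
      by (rule norm_app_diff_le) (use s in \<open>auto simp: bidisc_def norm_coord\<close>)
    also have "norm1 (0 - s *\<^sub>R coords) = 2 * s" using s norm1_minus_commute[of 0 "s *\<^sub>R coords"] by simp
    also have "4 * norm (F $ i) * (2 * s) \<le> 8 * (norm (F $ i) + 1) * s" using s by simp
    also have "\<dots> \<le> 8 * (norm (F $ i) + 1) * (\<bar>a\<bar> / (16 * (norm (F $ i) + 1)))"
      using nF by (intro mult_left_mono) (auto simp: s_def)
    also have "\<dots> = \<bar>a\<bar> / 2"
    proof -
      have "8 * n * (\<bar>a\<bar> / (16 * n)) = \<bar>a\<bar> / 2" if "0 < n" for n :: real using that by simp
      from this[OF nF] show ?thesis .
    qed
    finally have "norm (a *\<^sub>R 1 - A) \<le> \<bar>a\<bar> / 2" by (simp add: A_def app_at_0 a_def)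
    moreover have "1 - (1 / a) *\<^sub>R A = (1 / a) *\<^sub>R (a *\<^sub>R 1 - A)" using a by (simp add: scaleR_diff_right)
    then have "norm (1 - (1 / a) *\<^sub>R A) = norm (a *\<^sub>R 1 - A) / \<bar>a\<bar>" by (simp only: norm_scaleR) simp
    ultimately show ?thesis using a by (simp only: divide_less_eq) simp
  qed
  then obtain V where V: "(1 / a) *\<^sub>R A * V = 1" by (rule wiener_inverse)
  define Q where "Q = B * ((1 / a) *\<^sub>R V)"
  have Q: "app A \<xi> \<noteq> 0" "app B \<xi> = app A \<xi> * app Q \<xi>" if b: "\<xi> \<in> bidisc 1" for \<xi> :: "real ^ 2"
  proof -
    have "app A \<xi> * (1 / a * app V \<xi>) = app ((1 / a) *\<^sub>R A * V) \<xi>"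
      by (simp add: app_mult[OF b] app_scaleR[OF b])
    also have "\<dots> = 1" by (simp only: V app_one)
    finally have 1: "app A \<xi> * (1 / a * app V \<xi>) = 1" .
    then show "app A \<xi> \<noteq> 0" by auto
    have "app A \<xi> * app Q \<xi> = app B \<xi> * (app A \<xi> * (1 / a * app V \<xi>))"
      by (simp add: Q_def app_mult[OF b] app_scaleR[OF b])
    then show "app B \<xi> = app A \<xi> * app Q \<xi>" by (simp only: 1 mult_1_right)
  qed
  obtain w \<tau> where \<tau>: "0 < \<tau>" "\<tau> \<le> 1/2" and w: "norm w \<le> 1/2" "coef w (0, 0) = 0"
    and ode: "\<And>t. \<bar>t\<bar> < \<tau> \<Longrightarrow> ((\<lambda>t. app w (line1 (t / \<tau>))) has_real_derivative
        app Q (point i t (app w (line1 (t / \<tau>))))) (at t)"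
    by (rule analytic_ode_solution[of Q i]) blast
  define v where "v t = app w (line1 (t / \<tau>))" for t
  note v = v_def
  have v0: "v 0 = 0"
  proof -
    have "line1 (0 / \<tau>) = 0" by (simp add: vec_eq_iff forall_2)
    then show ?thesis using w(2) by (simp add: v_def app_at_0)
  qed
  have v_le: "\<bar>v t\<bar> \<le> 1/2" if "\<bar>t\<bar> < \<tau>" for t
    using order_trans[OF app_has_sum(3)[OF line1_in_bidisc] w(1), of "t / \<tau>"] that \<tau>(1) by (simp add: v_def)
  define r where "r = s * \<rho>"
  have r: "0 < r" "r \<le> \<rho>" using s \<rho> by (auto simp: r_def)
  obtain c c' r0 where r0: "0 < r0" and c0: "c 0 = p"
    and dc: "\<And>t. \<bar>t\<bar> < r0 \<Longrightarrow> (c has_vector_derivative c' t) (at t)"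
    and c'0: "isCont c' 0" "c' 0 \<noteq> 0"
    and c\<gamma>: "\<And>t. \<bar>t\<bar> < r0 \<Longrightarrow> c t \<in> \<gamma>"
    and cN: "\<And>d. 0 < d \<Longrightarrow> \<exists>N. open N \<and> p \<in> N \<and> \<gamma> \<inter> N \<subseteq> c ` {-d<..<d}"
    and ctan: "\<And>t v. \<bar>t\<bar> < r0 \<Longrightarrow> tangent_to \<gamma> (c t) v \<Longrightarrow> v $ 1 * c' t $ 2 = v $ 2 * c' t $ 1"
    by (rule smooth_curve_parametrization[OF \<gamma>]) blast
  define z where "z t = (c t - p) /\<^sub>R r" for t
  have z0: "z 0 = 0" by (simp add: z_def c0)
  have dz: "((\<lambda>t. z t $ l) has_real_derivative c' t $ l / r) (at t)" if "\<bar>t\<bar> < r0" for t l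
  proof -
    have "((\<lambda>t. c t $ l) has_real_derivative c' t $ l) (at t)"
      using bounded_linear.has_vector_derivative[OF bounded_linear_vec_nth dc[OF that], of l]
      by (simp add: has_real_derivative_iff_has_vector_derivative)
    then have "((\<lambda>t. (c t $ l - p $ l) / r) has_real_derivative (c' t $ l - 0) / r) (at t)"
      by (intro DERIV_cdivide DERIV_diff DERIV_const)
    then show ?thesis by (simp add: z_def divide_inverse mult.commute)
  qed
  have "isCont c 0" using has_vector_derivative_continuous[OF dc[of 0]] r0 by simp
  then have "isCont z 0" unfolding z_def by (intro continuous_intros)
  then have "\<forall>\<^sub>F t in nhds 0. dist (z t) (z 0) < \<tau>"
    using \<tau>(1) tendstoD by (auto simp: continuous_at tendsto_at_iff_tendsto_nhds)
  moreover have "\<forall>\<^sub>F t in nhds 0. dist (c' t) (c' 0) < 1"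
    using c'0(1) tendstoD[of c' "c' 0" "nhds 0" 1] by (auto simp: continuous_at tendsto_at_iff_tendsto_nhds)
  moreover have "\<forall>\<^sub>F t in nhds (0::real). \<bar>t\<bar> < r0"
    using r0 by (auto simp: eventually_nhds_metric)
  ultimately have "\<forall>\<^sub>F t in nhds 0. norm (z t) < \<tau> \<and> norm (c' t) \<le> norm (c' 0) + 1 \<and> \<bar>t\<bar> < r0"
  proof eventually_elim
    case (elim t)
    then show ?case using norm_triangle_sub[of "c' t" "c' 0"] by (simp add: z0 dist_norm)
  qed
  then obtain d where d: "0 < d" and d': "\<And>t. \<bar>t\<bar> < d \<Longrightarrow> norm (z t) < \<tau>"
      "\<And>t. \<bar>t\<bar> < d \<Longrightarrow> norm (c' t) \<le> norm (c' 0) + 1" "\<And>t. \<bar>t\<bar> < d \<Longrightarrow> \<bar>t\<bar> < r0"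
    by (auto simp: eventually_nhds_metric)
  have zl: "\<bar>z t $ l\<bar> < \<tau>" if "\<bar>t\<bar> < d" for t l
    using d'(1)[OF that] component_le_norm_cart[of "z t" l] by linarith
  have zb: "z t \<in> bidisc (3/4)" "z t \<in> bidisc 1" if "\<bar>t\<bar> < d" for t
    using d'(1)[OF that] \<tau>(2) by (auto intro!: norm_in_bidisc)
  have slope: "c' t $ j = app Q (z t) * c' t $ i" if t: "\<bar>t\<bar> < d" for t
  proof -
    let ?X = "appv F ((c t - p) /\<^sub>R \<rho>)"
    have eq: "(c t - p) /\<^sub>R \<rho> = s *\<^sub>R z t" using s \<rho> by (simp add: z_def r_def)
    have "norm (c t - p) = r * norm (z t)" using r(1) by (simp add: z_def)
    also have "\<dots> \<le> r * 1" using d'(1)[OF t] \<tau>(2) r(1) by (intro mult_left_mono) auto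
    finally have "tangent_to \<gamma> (c t) ?X" using r(2) c\<gamma>[OF d'(3)[OF t]] by (intro tan) auto
    from ctan[OF d'(3)[OF t] this] have 1: "?X $ i * c' t $ j = ?X $ j * c' t $ i"
      using exhaust_2[of i] by (auto simp: j_def)
    have sc: "s *\<^sub>R coords \<in> bidisc 1" using s by (intro scaled_coords_in_bidisc) simp
    have "?X $ i = app A (z t)" "?X $ j = app B (z t)"
      using app_app[OF sc zb(2)[OF t]] appv_scaled_coords[OF zb(2)[OF t], of s]
      by (simp_all add: eq A_def B_def)
    with 1 Q[OF zb(2)[OF t]] show ?thesis by simp
  qed
  have c'i: "c' 0 $ i \<noteq> 0"
  proof
    assume "c' 0 $ i = 0"
    moreover from this have "c' 0 $ j = 0" using slope[of 0] d by simp
    ultimately have "c' 0 $ l = 0" for l using ij(2)[of l] by blast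
    then have "c' 0 = 0" by (simp add: vec_eq_iff)
    then show False using c'0(2) by simp
  qed
  \<comment> \<open>The deviation of the curve from the graph of \<open>v\<close>. As
    \<open>Q\<close> is Lipschitz and the velocity is bounded, subtracting the two equations bounds
    \<open>\<bar>e'\<bar>\<close> by \<open>C * \<bar>e\<bar>\<close>.\<close>
  define e where "e t = z t $ j - v (z t $ i)" for t
  define e' where "e' t = c' t $ j / r - app Q (point i (z t $ i) (v (z t $ i))) * (c' t $ i / r)" for t
  define C where "C = (norm (c' 0) + 1) / r * (4 * norm Q)"
  obtain d1 where d1: "0 < d1" "d1 \<le> d" and e_zero: "\<And>t. \<bar>t\<bar> < d1 \<Longrightarrow> e t = 0"
  proof (rule linear_differential_inequality_imp_zero[OF d, of e e' C])
    show "(e has_real_derivative e' t) (at t)" if t: "\<bar>t\<bar> < d" for t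
      unfolding e_def[abs_def] e'_def
      by (intro DERIV_diff dz[OF d'(3)[OF t]] DERIV_chain2[where f = v and g = "\<lambda>t. z t $ i",
            OF ode[OF zl[OF t], folded v_def] dz[OF d'(3)[OF t]]])
    show "\<bar>e' t\<bar> \<le> C * \<bar>e t\<bar>" if t: "\<bar>t\<bar> < d" for t
    proof -
      have zp: "z t = point i (z t $ i) (z t $ j)" 
      proof -
        have "z t $ l = point i (z t $ i) (z t $ j) $ l" for l
          using ij(1) ij(2)[of l] by (elim disjE) (auto simp: point_def)
        then show ?thesis unfolding vec_eq_iff by (rule allI)
      qed
      have "point i (z t $ i) (v (z t $ i)) \<in> bidisc (3/4)"
        using zl[OF t, of i] v_le[OF zl[OF t, of i]] \<tau>(2) by (intro point_in_bidisc) auto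
      moreover have "norm1 (z t - point i (z t $ i) (v (z t $ i))) = \<bar>e t\<bar>"
        using arg_cong[OF zp, of "\<lambda>u. norm1 (u - point i (z t $ i) (v (z t $ i)))"]
        by (simp only: norm1_point_diff e_def real_norm_def)
      ultimately
      have q: "\<bar>app Q (z t) - app Q (point i (z t $ i) (v (z t $ i)))\<bar> \<le> 4 * norm Q * \<bar>e t\<bar>"
        using norm_app_diff_le[OF zb(1)[OF t], of "point i (z t $ i) (v (z t $ i))" Q] by simp
      have "e' t = (c' t $ i / r) * (app Q (z t) - app Q (point i (z t $ i) (v (z t $ i))))"
        using r(1) by (simp add: e'_def slope[OF t] field_simps)
      then have "\<bar>e' t\<bar> = (\<bar>c' t $ i\<bar> / r) * \<bar>app Q (z t) - app Q (point i (z t $ i) (v (z t $ i)))\<bar>"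
        using r(1) by (simp add: abs_mult)
      also have "\<dots> \<le> ((norm (c' 0) + 1) / r) * (4 * norm Q * \<bar>e t\<bar>)"
        using q r(1) order_trans[OF component_le_norm_cart d'(2)[OF t], of i]
        by (intro mult_mono divide_right_mono) auto
      finally show ?thesis by (simp add: C_def)
    qed
    show "e 0 = 0" by (simp add: e_def z0 v0)
    show "0 \<le> C" using r(1) by (simp add: C_def)
  qed (rule that)
  \<comment> \<open>By \<open>e_zero\<close> the curve lies on the graph. The converse needs that
    every abscissa near 0 is attained by the curve, which is what \<open>\<mu>\<close>
    provides.\<close>
  have "continuous_on {-d1<..<d1} (\<lambda>t. z t $ i)"
    by (intro continuous_at_imp_continuous_on ballI DERIV_isCont[OF dz])
      (use d1(2) d'(3) in \<open>auto simp: abs_less_iff\<close>)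
  from covers_neighbourhood[OF d1(1) this _ dz[of 0 i]]
  have "\<exists>\<mu>>0. {-\<mu><..<\<mu>} \<subseteq> (\<lambda>t. z t $ i) ` {-d1<..<d1}"
    using r0 c'i r(1) by (simp add: z0)
  then obtain \<mu> where \<mu>: "0 < \<mu>" "{-\<mu><..<\<mu>} \<subseteq> (\<lambda>t. z t $ i) ` {-d1<..<d1}" by blast
  obtain N where N: "open N" "p \<in> N" "\<gamma> \<inter> N \<subseteq> c ` {-d1<..<d1}" using cN[OF d1(1)] by blast
  let ?\<Phi> = "graph_chart p r i j v" and ?K = "graph_unchart p r i v"
  have K\<Phi>: "?K (?\<Phi> x) = x" for x
  proof -
    have "?K (?\<Phi> x) $ l = x $ l" for l
      using r(1) ij(1) ij(2)[of l] by (elim disjE) (auto simp: graph_chart_def graph_unchart_def point_def)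
    then show ?thesis by (simp add: vec_eq_iff)
  qed
  have \<Phi>K: "?\<Phi> (?K y) = y" for y
    using r(1) ij(1) by (simp add: vec_eq_iff forall_2 graph_chart_def graph_unchart_def point_def)
  have an\<Phi>: "ranalytic_at ?\<Phi> x" if "norm (x - p) < r * \<tau>" for x
    by (rule graph_chart_analytic[OF v \<tau>(1) r(1) that ij(1)])
  have anK: "ranalytic_at ?K y" if "norm y < \<tau>" for y
    by (rule graph_unchart_analytic[OF v \<tau>(1) that])
  have \<Phi>1: "?\<Phi> x $ 1 = (x - p) $ i / r" "?\<Phi> x $ 2 = (x - p) $ j / r - v ((x - p) $ i / r)" for x
    by (simp_all add: graph_chart_def)
  \<comment> \<open>\<open>M\<close> and \<open>L\<close> are neighbourhoods in source and target.
    Cutting each down by the preimage of the other makes both the chart domain and its image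
    open.\<close>
  define M where "M = N \<inter> ball p (r * \<tau>)"
  have M: "open M" "p \<in> M" using N r(1) \<tau>(1) by (auto simp: M_def)
  define L where "L = {y :: real ^ 2. norm y < \<tau> \<and> \<bar>y $ 1\<bar> < \<mu>}"
  have "L = ball 0 \<tau> \<inter> {y. \<bar>y $ 1\<bar> < \<mu>}" by (auto simp: L_def)
  moreover have "open {y :: real ^ 2. \<bar>y $ 1\<bar> < \<mu>}"
    by (intro open_Collect_less continuous_intros)
  ultimately have L: "open L" by auto
  have contM: "continuous_on M ?\<Phi>"
    by (intro continuous_at_imp_continuous_on ballI ranalytic_at_imp_isCont an\<Phi>)
      (auto simp: M_def dist_norm norm_minus_commute)
  have contL: "continuous_on L ?K"
    by (intro continuous_at_imp_continuous_on ballI ranalytic_at_imp_isCont anK) (auto simp: L_def)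
  define U where "U = M \<inter> ?\<Phi> -` L"
  have opU: "open U" unfolding U_def by (rule continuous_open_preimage[OF contM M(1) L])
  have imU: "?\<Phi> ` U = L \<inter> ?K -` M"
  proof (intro equalityI subsetI)
    fix y assume y: "y \<in> L \<inter> ?K -` M"
    then have "?K y \<in> U" by (simp add: U_def \<Phi>K)
    then show "y \<in> ?\<Phi> ` U" using \<Phi>K[of y] by (metis image_eqI)
  qed (auto simp: U_def K\<Phi>)
  show ?thesis
  proof (rule analytic_pointI[of p U ?\<Phi> ?K])
    have "?\<Phi> p = 0" by (simp add: vec_eq_iff forall_2 \<Phi>1 v0)
    then show "p \<in> U" using M \<tau>(1) \<mu>(1) by (simp add: U_def L_def)
    show "open U" by (rule opU)
    show "open (?\<Phi> ` U)" unfolding imU by (rule continuous_open_preimage[OF contL L M(1)])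
    fix x assume x: "x \<in> U"
    then show "ranalytic_at ?\<Phi> x" by (intro an\<Phi>) (auto simp: U_def M_def dist_norm norm_minus_commute)
    show "?K (?\<Phi> x) = x" by (rule K\<Phi>)
    show "ranalytic_at ?K (?\<Phi> x)" using x by (intro anK) (auto simp: U_def L_def)
    have xi: "\<bar>(x - p) $ i / r\<bar> < \<mu>" using x by (auto simp: U_def L_def \<Phi>1)
    have zc: "z t $ l = (c t - p) $ l / r" for t l by (simp add: z_def divide_inverse mult.commute)
    show "x \<in> \<gamma> \<longleftrightarrow> ?\<Phi> x $ 2 = 0"
    proof
      assume "x \<in> \<gamma>"
      then have "x \<in> c ` {-d1<..<d1}" using x N(3) by (auto simp: U_def M_def)
      then obtain t where t: "t \<in> {-d1<..<d1}" "x = c t" by blast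
      then have "\<bar>t\<bar> < d1" by auto
      note t = this t(2)
      from e_zero[OF t(1)] show "?\<Phi> x $ 2 = 0" by (simp add: \<Phi>1 e_def zc t(2))
    next
      assume 0: "?\<Phi> x $ 2 = 0"
      have "(x - p) $ i / r \<in> (\<lambda>t. z t $ i) ` {-d1<..<d1}"
      proof (rule subsetD[OF \<mu>(2)])
        show "(x - p) $ i / r \<in> {-\<mu><..<\<mu>}"
          unfolding greaterThanLessThan_iff using xi[unfolded abs_less_iff] by linarith
      qed
      then obtain t where t: "t \<in> {-d1<..<d1}" "(x - p) $ i / r = z t $ i" by blast
      then have "\<bar>t\<bar> < d1" by auto
      note t = this t(2)
      have "?\<Phi> (c t) $ 1 = ?\<Phi> x $ 1" using t(2) unfolding \<Phi>1 zc by (rule sym)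
      moreover have "?\<Phi> (c t) $ 2 = 0" using e_zero[OF t(1)] unfolding \<Phi>1 e_def zc .
      ultimately have "?\<Phi> (c t) = ?\<Phi> x" using 0 by (simp add: vec_eq_iff forall_2)
      then have "c t = x" using K\<Phi> by metis
      then show "x \<in> \<gamma>" using c\<gamma>[of t] t(1) d1(2) d'(3) by auto
    qed
  qed
qed

section \<open>Maps close to the identity and their iterates\<close>

lemma eventually_norm_less: "0 < c \<Longrightarrow> \<forall>\<^sub>F x :: real ^ 2 in nhds 0. norm x < c"
  unfolding eventually_nhds_metric by (intro exI[of _ c]) simp

lemma near_identity_displacement:
  assumes e: "expands e \<rho> E" and x: "norm x \<le> \<rho>"
  shows "norm1 (e x - x) \<le> \<rho> * norm1 (E - coords)"
proof -
  have \<rho>: "0 < \<rho>" using e by (rule expands_pos)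
  have b: "x /\<^sub>R \<rho> \<in> bidisc 1" using scaled_in_bidisc[OF \<rho>, of x 1] x by simp
  have "e x - x = \<rho> *\<^sub>R appv (E - coords) (x /\<^sub>R \<rho>)"
    using expandsD[OF e x] \<rho> by (simp add: appv_simps[OF b] scaleR_diff_right)
  then show ?thesis using norm1_appv_le[OF b, of "E - coords"] \<rho> by (simp add: mult_left_mono)
qed

lemma near_identity_lipschitz:
  assumes e: "expands e \<rho> E" and x: "norm x \<le> 3/4 * \<rho>" and y: "norm y \<le> 3/4 * \<rho>"
  shows "norm ((e x - x) - (e y - y)) \<le> 8 * norm1 (E - coords) * norm (x - y)"
proof -
  have \<rho>: "0 < \<rho>" using e by (rule expands_pos)
  have b: "x /\<^sub>R \<rho> \<in> bidisc (3/4)" "y /\<^sub>R \<rho> \<in> bidisc (3/4)"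
    using scaled_in_bidisc[OF \<rho> x] scaled_in_bidisc[OF \<rho> y] by auto
  then have b1: "x /\<^sub>R \<rho> \<in> bidisc 1" "y /\<^sub>R \<rho> \<in> bidisc 1" by (auto intro: bidisc_mono)
  have xy: "norm x \<le> \<rho>" "norm y \<le> \<rho>" using x y \<rho> by auto
  have "(e x - x) - (e y - y) = \<rho> *\<^sub>R (appv (E - coords) (x /\<^sub>R \<rho>) - appv (E - coords) (y /\<^sub>R \<rho>))"
    using expandsD[OF e xy(1)] expandsD[OF e xy(2)] \<rho>
    by (simp add: appv_simps(2)[OF b1(1)] appv_simps(2)[OF b1(2)] scaleR_diff_right)
  also have "norm \<dots> \<le> \<rho> * norm1 (appv (E - coords) (x /\<^sub>R \<rho>) - appv (E - coords) (y /\<^sub>R \<rho>))"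
    using \<rho> norm_le_norm1 by (simp add: mult_left_mono)
  also have "\<dots> \<le> \<rho> * (4 * norm1 (E - coords) * norm1 (x /\<^sub>R \<rho> - y /\<^sub>R \<rho>))"
    using norm1_appv_diff_le[OF b] \<rho> by (intro mult_left_mono) auto
  also have "x /\<^sub>R \<rho> - y /\<^sub>R \<rho> = (x - y) /\<^sub>R \<rho>" by (simp add: scaleR_diff_right)
  also have "\<rho> * (4 * norm1 (E - coords) * norm1 ((x - y) /\<^sub>R \<rho>)) = 4 * norm1 (E - coords) * norm1 (x - y)"
    using \<rho> by simp
  also have "\<dots> \<le> 4 * norm1 (E - coords) * (2 * norm (x - y))"
    by (intro mult_left_mono norm1_le_norm) auto
  finally show ?thesis by simp
qed

text \<open>Along a kernel vector of the derivative, \<open>f y - f x\<close> is at most a quarter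
  of \<open>y - x\<close> in norm, and the variation of the displacement is at most half of it.
  Since \<open>y - x\<close> is the difference of the two, it would vanish.\<close>

lemma det_jacobian_near_identity:
  fixes f :: "real ^ 2 \<Rightarrow> real ^ 2"
  assumes d: "f differentiable (at x)" and r: "0 < r"
    and lip: "\<And>y. norm (y - x) < r \<Longrightarrow> norm ((f y - y) - (f x - x)) \<le> 1/2 * norm (y - x)"
  shows "det (jacobian f (at x)) \<noteq> 0"
proof -
  obtain D where D: "(f has_derivative D) (at x)" using d by (auto simp: differentiable_def)
  have lin: "linear D" using D by (rule has_derivative_linear)
  have "v = 0" if v: "D v = 0" for v
  proof (rule ccontr)
    assume nz: "v \<noteq> 0"
    obtain s where s: "0 < s" "\<And>y. norm (y - x) < s \<Longrightarrow> norm (f y - f x - D (y - x)) \<le> 1/4 * norm (y - x)"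
      using D unfolding has_derivative_at_alt by (metis zero_less_divide_1_iff zero_less_numeral)
    define t where "t = min r s / (2 * norm v)"
    have t: "0 < t" "t * norm v < r" "t * norm v < s" using nz r s(1) by (auto simp: t_def)
    define y where "y = x + t *\<^sub>R v"
    have ny: "norm (y - x) = t * norm v" using t(1) by (simp add: y_def)
    have "D (y - x) = 0" by (simp add: y_def linear_scale[OF lin] v)
    then have 1: "norm (f y - f x) \<le> 1/4 * norm (y - x)" using s(2)[of y] ny t by simp
    have "norm (y - x) = norm ((f y - f x) - ((f y - y) - (f x - x)))" by (simp add: algebra_simps)
    also have "\<dots> \<le> norm (f y - f x) + norm ((f y - y) - (f x - x))" by (rule norm_triangle_ineq4)
    also have "\<dots> \<le> 1/4 * norm (y - x) + 1/2 * norm (y - x)" using 1 lip[of y] ny t by simp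
    finally have "norm (y - x) \<le> 0" by simp
    moreover have "0 < norm (y - x)" using t(1) nz by (simp add: ny)
    ultimately show False by simp
  qed
  then have "inj D" using linear_injective_0[OF lin] by blast
  then show ?thesis using det_nz_iff_inj[OF lin] by (simp add: jacobian_eqI[OF D])
qed

lemma appv_identity:
  assumes "\<forall>\<^sub>F x in nhds (0 :: real ^ 2). appv F x = appv H x"
  shows "F = H"
proof -
  have "F $ l = H $ l" for l
  proof (rule wiener_identity)
    show "\<forall>\<^sub>F x in nhds (0 :: real ^ 2). app (F $ l) x = app (H $ l) x"
      using assms by eventually_elim (metis appv_nth)
  qed
  then show ?thesis by (simp add: vec_eq_iff)
qed

text \<open>The displacement of the \<open>k\<close>-th iterate is the sum of the increments of the \<open>A i\<close> between
  \<open>z\<close> and its image; as all \<open>A i\<close> are close to the identity, it is comparable with \<open>k\<close> times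
  the displacement of the map itself.\<close>

lemma iterate_displacement:
  fixes z :: "'b::{comm_ring_1,real_normed_algebra_1,banach} ^ 2"
  assumes z: "z \<in> bidisc (1/2)" and A0: "A 0 = coords"
    and A: "\<And>i. i < k \<Longrightarrow> norm1 (A i - coords) \<le> 1/16" and F: "norm1 (F - coords) \<le> 1/16"
    and step: "\<And>i. i < k \<Longrightarrow> appv (A (Suc i)) z = appv (A i) (appv F z)"
  shows "real k * norm1 (appv F z - z) \<le> 2 * norm1 (appv (A k) z - z)"
    and "norm1 (appv (A k) z - z) \<le> 2 * (real k * norm1 (appv F z - z))"
proof -
  have z1: "z \<in> bidisc 1" and z34: "z \<in> bidisc (3/4)" using z by (auto intro: bidisc_mono)
  define u where "u = appv F z"
  define D where "D = norm1 (u - z)"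
  have "u - z = appv (F - coords) z" by (simp add: u_def appv_simps[OF z1])
  then have "norm1 (u - z) \<le> 1/16" using norm1_appv_le[OF z1, of "F - coords"] F by simp
  then have "norm (u $ l) \<le> 3/4" for l
    using norm1_in_bidisc[of "u - z" "1/16"] bidisc_nth[of "u - z" "1/16" l] bidisc_nth[OF z, of l]
      norm_triangle_sub[of "u $ l" "z $ l"] by simp
  then have u34: "u \<in> bidisc (3/4)" by (simp add: bidisc_iff)
  then have u1: "u \<in> bidisc 1" by (rule bidisc_mono) simp
  \<comment> \<open>The increment of \<open>A i\<close> from \<open>z\<close> to \<open>u\<close> is
    \<open>u - z\<close> plus the error \<open>R i\<close>. The Lipschitz bound 4 * 1/16 keeps the
    total error below a quarter of \<open>real k * D\<close>, which both inequalities absorb into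
    the factor 2.\<close>
  define R where "R i = appv (A i - coords) u - appv (A i - coords) z" for i
  have R: "norm1 (R i) \<le> D / 4" if "i < k" for i
  proof -
    have "norm1 (R i) \<le> 4 * norm1 (A i - coords) * norm1 (u - z)"
      unfolding R_def by (rule norm1_appv_diff_le[OF u34 z34])
    also have "\<dots> \<le> 4 * (1/16) * norm1 (u - z)" using A[OF that] by (intro mult_right_mono) auto
    finally show ?thesis by (simp add: D_def)
  qed
  have inc: "appv (A (Suc i)) z - appv (A i) z = (u - z) + R i" if "i < k" for i
    using step[OF that] by (simp add: R_def u_def[symmetric] appv_simps(2)[OF u1] appv_simps(2)[OF z1])
  have sumR: "norm1 (\<Sum>i<m. R i) \<le> real m * (D / 4)" if "m \<le> k" for m
    using that
  proof (induction m)
    case (Suc m)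
    have "norm1 (\<Sum>i<Suc m. R i) \<le> norm1 (\<Sum>i<m. R i) + norm1 (R m)"
      using norm1_triangle by simp
    also have "\<dots> \<le> real m * (D / 4) + D / 4" using Suc R[of m] by (intro add_mono) auto
    finally show ?case by (simp add: algebra_simps)
  qed (simp add: norm1_def)
  define S where "S = (\<Sum>i<k. R i)"
  have S: "norm1 S \<le> real k * (D / 4)" using sumR[of k] by (simp add: S_def)
  have "(\<Sum>i<k. appv (A (Suc i)) z - appv (A i) z) = (\<Sum>i<k. (u - z) + R i)"
    by (rule sum.cong) (use inc in auto)
  moreover have "(\<Sum>i<k. appv (A (Suc i)) z - appv (A i) z) = appv (A k) z - z"
    using sum_lessThan_telescope[of "\<lambda>i. appv (A i) z" k] by (simp only: A0 appv_coords_left)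
  moreover have "(\<Sum>i<k. (u - z) + R i) = real k *\<^sub>R (u - z) + S"
    by (simp only: sum.distrib S_def sum_constant_scaleR card_lessThan)
  ultimately have total: "appv (A k) z - z = real k *\<^sub>R (u - z) + S" by simp
  have kD: "norm1 (real k *\<^sub>R (u - z)) = real k * D" by (simp add: D_def)
  have "norm1 (real k *\<^sub>R (u - z)) \<le> norm1 (appv (A k) z - z) + norm1 S"
    using norm1_triangle[of "appv (A k) z - z" "- S"] norm1_scaleR[of "-1" S] by (simp add: total)
  then have "real k * D \<le> norm1 (appv (A k) z - z) + real k * (D / 4)" using S kD by linarith
  then have "real k * D \<le> 2 * norm1 (appv (A k) z - z)"
    using norm1_ge_zero[of "appv (A k) z - z"] unfolding times_divide_eq_right by linarith
  then show "real k * norm1 (appv F z - z) \<le> 2 * norm1 (appv (A k) z - z)"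
    by (simp add: u_def[symmetric] D_def[symmetric])
  have "norm1 (appv (A k) z - z) \<le> real k * D + norm1 S"
    unfolding total using norm1_triangle[of "real k *\<^sub>R (u - z)" S] kD by linarith
  moreover have "0 \<le> real k * D" by (simp add: D_def)
  ultimately show "norm1 (appv (A k) z - z) \<le> 2 * (real k * norm1 (appv F z - z))"
    using S by (simp add: u_def[symmetric] D_def[symmetric])
qed

section \<open>Maps close to the identity that preserve a nowhere analytic curve\<close>

locale nowhere_analytic_curve = germ_group +
  fixes \<gamma> :: "(real ^ 2) set"
  assumes closed: "closed_germs G" and uniform: "uniform_germs G" and ICP: "ICP G"
    and smooth: "smooth_curve \<gamma>" and not_analytic: "\<And>q. q \<in> \<gamma> \<Longrightarrow> \<not> analytic_point \<gamma> q"
begin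

text \<open>Coordinates are centred at \<open>p\<close>, which \<open>e\<close> moves to
  \<open>p + e 0\<close>; hence the germ in \<open>G\<close> is that of \<open>e - e 0\<close>. Its
  right inverse \<open>\<kappa>\<close> maps the curve back, so two maps with the same value at 0
  can be compared through a germ that fixes 0.\<close>

definition near :: "real ^ 2 \<Rightarrow> real \<Rightarrow> real \<Rightarrow> (real ^ 2 \<Rightarrow> real ^ 2) \<Rightarrow> wiener ^ 2 \<Rightarrow> bool" where
  "near p \<rho> \<epsilon> e E \<longleftrightarrow> expands e \<rho> E \<and> norm1 (E - coords) \<le> \<epsilon> \<and> germ (\<lambda>x. e x - e 0) \<in> G \<and>
    (\<forall>x. norm x \<le> \<rho> \<longrightarrow> p + x \<in> \<gamma> \<longrightarrow> p + e x \<in> \<gamma>) \<and>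
    (\<exists>\<kappa>. germ \<kappa> \<in> G \<and> (\<forall>\<^sub>F x in nhds 0. e (\<kappa> x) - e 0 = x) \<and>
      (\<forall>\<^sub>F y in nhds 0. p + e 0 + y \<in> \<gamma> \<longrightarrow> p + \<kappa> y \<in> \<gamma>))"

lemma nearD:
  assumes "near p \<rho> \<epsilon> e E"
  shows "expands e \<rho> E" "norm1 (E - coords) \<le> \<epsilon>" "germ (\<lambda>x. e x - e 0) \<in> G"
    "\<And>x. norm x \<le> \<rho> \<Longrightarrow> p + x \<in> \<gamma> \<Longrightarrow> p + e x \<in> \<gamma>"
  using assms by (auto simp: near_def)

lemma near_id:
  assumes "0 < \<rho>" "0 \<le> \<epsilon>"
  shows "near p \<rho> \<epsilon> (\<lambda>x. x) coords"
  unfolding near_def expands_def using assms germ_mem_id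
  by (auto simp: norm1_def intro!: exI[of _ "\<lambda>x. x"])

lemma near_mono: "near p \<rho> \<epsilon> e E \<Longrightarrow> \<epsilon> \<le> \<epsilon>' \<Longrightarrow> near p \<rho> \<epsilon>' e E"
  by (auto simp: near_def)

text \<open>Two invariant maps with the same value at \<open>0\<close> differ by a germ \<open>h\<close> fixing \<open>0\<close>, which is an
  involution by (ICP); \<open>a + b\<close> is invariant under \<open>h\<close> and injective, so \<open>h\<close> is trivial.\<close>

lemma near_unique:
  assumes p: "p \<in> \<gamma>" and a: "near p \<rho> \<epsilon> a A" and b: "germ (\<lambda>x. b x - b 0) \<in> G" "b 0 = a 0"
    and b\<gamma>: "\<forall>\<^sub>F x in nhds 0. p + x \<in> \<gamma> \<longrightarrow> p + b x \<in> \<gamma>" and r: "0 < r"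
    and lip: "\<And>x y. norm x < r \<Longrightarrow> norm y < r \<Longrightarrow> norm ((a x - x) - (a y - y)) \<le> 1/2 * norm (x - y)"
      "\<And>x y. norm x < r \<Longrightarrow> norm y < r \<Longrightarrow> norm ((b x - x) - (b y - y)) \<le> 1/2 * norm (x - y)"
  shows "\<forall>\<^sub>F x in nhds 0. a x = b x"
proof -
  obtain \<kappa> where \<kappa>: "germ \<kappa> \<in> G" "\<forall>\<^sub>F x in nhds 0. a (\<kappa> x) - a 0 = x"
    "\<forall>\<^sub>F y in nhds 0. p + a 0 + y \<in> \<gamma> \<longrightarrow> p + \<kappa> y \<in> \<gamma>"
    using a by (auto simp: near_def)
  define h where "h x = \<kappa> (b x - b 0)" for x
  have h: "germ h \<in> G" unfolding h_def[abs_def] by (rule germ_mem_compose[OF \<kappa>(1) b(1)])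
  have "\<forall>\<^sub>F x in nhds 0. p + a 0 + (b x - b 0) \<in> \<gamma> \<longrightarrow> p + \<kappa> (b x - b 0) \<in> \<gamma>"
    by (rule eventually_compose_germ[OF b(1) \<kappa>(3)])
  with b\<gamma> have "\<forall>\<^sub>F x in nhds 0. p + x \<in> \<gamma> \<longrightarrow> p + h x \<in> \<gamma>"
    by eventually_elim (simp add: h_def b(2) algebra_simps)
  then have hh: "\<forall>\<^sub>F x in nhds 0. h (h x) = x"
    using involution_of_ICP[OF smooth ICP not_analytic p h] by simp
  have ah: "\<forall>\<^sub>F x in nhds 0. a (h x) = b x"
    using eventually_compose_germ[OF b(1) \<kappa>(2)] by eventually_elim (simp add: h_def b(2))
  have small: "\<forall>\<^sub>F x :: real ^ 2 in nhds 0. norm x < r" using r by (rule eventually_norm_less)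
  show ?thesis
    using hh ah eventually_compose_germ[OF h ah] small eventually_compose_germ[OF h small]
  proof eventually_elim
    case (elim x)
    \<comment> \<open>From \<open>a (h x) = b x\<close> and \<open>h (h x) = x\<close> follows
      \<open>b (h x) = a x\<close>. Hence twice \<open>x - h x\<close> is, up to sign, the sum of
      the variations of the displacements of \<open>a\<close> and \<open>b\<close>, each at most
      half of \<open>x - h x\<close>.\<close>
    let ?y = "h x"
    have s: "a ?y + b ?y = b x + a x" using elim by simp
    have "2 *\<^sub>R (x - ?y) = - (((a x - x) - (a ?y - ?y)) + ((b x - x) - (b ?y - ?y)))"
      using s by (simp add: algebra_simps scaleR_2)
    then have "norm (2 *\<^sub>R (x - ?y)) = norm (((a x - x) - (a ?y - ?y)) + ((b x - x) - (b ?y - ?y)))"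
      by (simp only: norm_minus_cancel)
    then have "2 * norm (x - ?y) \<le> norm ((a x - x) - (a ?y - ?y)) + norm ((b x - x) - (b ?y - ?y))"
      using norm_triangle_ineq[of "(a x - x) - (a ?y - ?y)" "(b x - x) - (b ?y - ?y)"] by simp
    also have "\<dots> \<le> 1/2 * norm (x - ?y) + 1/2 * norm (x - ?y)"
      using elim(4,5) by (intro add_mono lip) auto
    finally have "norm (x - ?y) \<le> 0" by simp
    then show "a x = b x" using elim(2) by simp
  qed
qed

lemma near_lipschitz:
  assumes e: "near p \<rho> (1/64) e E" and x: "norm x \<le> 3/4 * \<rho>" and y: "norm y \<le> 3/4 * \<rho>"
  shows "norm ((e x - x) - (e y - y)) \<le> 1/8 * norm (x - y)" "norm (e x - e y) \<le> 9/8 * norm (x - y)"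
proof -
  have "8 * norm1 (E - coords) * norm (x - y) \<le> 1/8 * norm (x - y)"
    using nearD(2)[OF e] by (intro mult_right_mono) auto
  with near_identity_lipschitz[OF nearD(1)[OF e] x y]
  show 1: "norm ((e x - x) - (e y - y)) \<le> 1/8 * norm (x - y)" by linarith
  have "norm (e x - e y) = norm (((e x - x) - (e y - y)) + (x - y))" by (simp add: algebra_simps)
  also have "\<dots> \<le> norm ((e x - x) - (e y - y)) + norm (x - y)" by (rule norm_triangle_ineq)
  finally show "norm (e x - e y) \<le> 9/8 * norm (x - y)" using 1 by simp
qed

lemma near_displacement:
  assumes e: "near p \<rho> (1/64) e E" and x: "norm x \<le> 1/2 * \<rho>"
  shows "norm (e x) \<le> 3/4 * \<rho>"
proof -
  have \<rho>: "0 < \<rho>" using nearD(1)[OF e] by (rule expands_pos)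
  have "norm1 (e x - x) \<le> \<rho> * norm1 (E - coords)"
    by (rule near_identity_displacement[OF nearD(1)[OF e]]) (use x \<rho> in simp)
  also have "\<dots> \<le> \<rho> * (1/64)" using nearD(2)[OF e] \<rho> by (intro mult_left_mono) auto
  finally have "norm (e x - x) \<le> \<rho> * (1/64)" using norm_le_norm1[of "e x - x"] by linarith
  then show ?thesis using norm_triangle_sub[of "e x" x] x \<rho> by linarith
qed

text \<open>Uniformity of the group enters here: \<open>g\<close> moves 0, so the germ of
  \<open>a\<close> has to be taken at \<open>g 0\<close>. Closeness to the identity provides the
  non-vanishing Jacobian on the disc.\<close>

lemma near_compose_germ:
  assumes a: "near p \<rho> (1/64) a A" and g: "near p \<rho> (1/64) g F" and g0: "norm (g 0) < 1/2 * \<rho>"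
  shows "germ (\<lambda>x. a (g x) - a (g 0)) \<in> G"
proof -
  have \<rho>: "0 < \<rho>" using nearD(1)[OF a] by (rule expands_pos)
  have an: "ranalytic_at (\<lambda>x. a x - a 0) x" if "norm x < 1/2 * \<rho>" for x
  proof -
    have "ranalytic_at a x"
      by (rule expands_imp_ranalytic_at[where p = 0 and \<rho> = \<rho> and F = A])
        (use nearD(1)[OF a] that \<rho> in simp_all)
    from ranalytic_at_translate_left[OF this, of "- a 0"] show ?thesis by simp
  qed
  have "germ (\<lambda>x. (a (g 0 + x) - a 0) - (a (g 0) - a 0)) \<in> G"
  proof (rule germ_mem_translate[OF uniform nearD(3)[OF a] an _ g0])
    fix x :: "real ^ 2" assume x: "norm x < 1/2 * \<rho>"
    show "det (jacobian (\<lambda>x. a x - a 0) (at x)) \<noteq> 0"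
    proof (rule det_jacobian_near_identity)
      show "(\<lambda>x. a x - a 0) differentiable (at x)" by (rule ranalytic_at_imp_differentiable[OF an[OF x]])
      show "0 < 1/4 * \<rho>" using \<rho> by simp
      fix y :: "real ^ 2" assume y: "norm (y - x) < 1/4 * \<rho>"
      have "norm ((a y - y) - (a x - x)) \<le> 1/8 * norm (y - x)"
        by (rule near_lipschitz(1)[OF a]) (use x y \<rho> norm_triangle_sub[of y x] in auto)
      then show "norm ((a y - a 0 - y) - (a x - a 0 - x)) \<le> 1/2 * norm (y - x)"
        by (simp add: algebra_simps) (smt (verit) norm_ge_zero)
    qed
  qed
  then have "germ (\<lambda>x. a (g 0 + x) - a (g 0)) \<in> G" by simp
  from germ_mem_compose[OF this nearD(3)[OF g]] show ?thesis by simp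
qed

text \<open>Uniqueness identifies \<open>b\<close> with \<open>a \<circ> g\<close> near 0, and the
  identity theorem turns this into an identity of series on the disc of half radius. The composite
  thus inherits the bound that \<open>b\<close> has on the full disc.\<close>

lemma near_step:
  assumes p: "p \<in> \<gamma>" and a: "near p \<rho> (1/64) a A" and g: "near p \<rho> (1/64) g F" and g0: "norm (g 0) < 1/2 * \<rho>"
    and b: "near p \<rho> (1/64) b B" "b 0 = a (g 0)"
  shows "appv B half_coords = appv A (appv F half_coords)"
proof -
  have \<rho>: "0 < \<rho>" using nearD(1)[OF a] by (rule expands_pos)
  have "\<forall>\<^sub>F x in nhds 0. b x = a (g x)"
  proof (rule near_unique[OF p b(1), where r = "1/2 * \<rho>"])
    show "germ (\<lambda>x. a (g x) - a (g 0)) \<in> G" by (rule near_compose_germ[OF a g g0])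
    show "a (g 0) = b 0" by (simp add: b(2))
    show "0 < 1/2 * \<rho>" using \<rho> by simp
    have "\<forall>\<^sub>F x in nhds (0 :: real ^ 2). norm x < 1/2 * \<rho>" using \<rho> by (intro eventually_norm_less) simp
    then show "\<forall>\<^sub>F x in nhds 0. p + x \<in> \<gamma> \<longrightarrow> p + a (g x) \<in> \<gamma>"
    proof eventually_elim
      case (elim x)
      then have "norm x \<le> \<rho>" "norm (g x) \<le> \<rho>" using near_displacement[OF g, of x] \<rho> by auto
      then show ?case using nearD(4)[OF g] nearD(4)[OF a] by blast
    qed
    fix x y :: "real ^ 2" assume xy: "norm x < 1/2 * \<rho>" "norm y < 1/2 * \<rho>"
    have xy': "norm x \<le> 3/4 * \<rho>" "norm y \<le> 3/4 * \<rho>" using xy \<rho> by auto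
    have 1: "norm ((b x - x) - (b y - y)) \<le> 1/8 * norm (x - y)" by (rule near_lipschitz(1)[OF b(1) xy'])
    then show "norm ((b x - x) - (b y - y)) \<le> 1/2 * norm (x - y)" using norm_ge_zero[of "x - y"] by linarith
    have gb: "norm (g x) \<le> 3/4 * \<rho>" "norm (g y) \<le> 3/4 * \<rho>" using near_displacement[OF g] xy by auto
    have "norm ((a (g x) - g x) - (a (g y) - g y)) \<le> 1/8 * norm (g x - g y)"
      by (rule near_lipschitz(1)[OF a gb])
    moreover have "norm (g x - g y) \<le> 9/8 * norm (x - y)" by (rule near_lipschitz(2)[OF g xy'])
    moreover have "norm ((g x - x) - (g y - y)) \<le> 1/8 * norm (x - y)" by (rule near_lipschitz(1)[OF g xy'])
    moreover have eq: "(a (g x) - x) - (a (g y) - y) = ((a (g x) - g x) - (a (g y) - g y)) + ((g x - x) - (g y - y))"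
      by (simp add: algebra_simps)
    ultimately show "norm ((a (g x) - x) - (a (g y) - y)) \<le> 1/2 * norm (x - y)"
      unfolding eq using norm_triangle_ineq[of "(a (g x) - g x) - (a (g y) - g y)" "(g x - x) - (g y - y)"]
        norm_ge_zero[of "x - y"] by linarith
  qed
  then obtain s where s: "0 < s" "\<And>x. norm x < s \<Longrightarrow> b x = a (g x)"
    by (auto simp: eventually_nhds_metric dist_norm)
  have h1: "half_coords \<in> bidisc 1" by (rule scaled_coords_in_bidisc) simp
  have Fh: "appv F half_coords \<in> bidisc 1"
  proof -
    have "appv F half_coords - half_coords = appv (F - coords) half_coords" by (simp add: appv_simps[OF h1])
    then have "norm1 (appv F half_coords - half_coords) \<le> 1/64"
      using norm1_appv_le[OF h1, of "F - coords"] nearD(2)[OF g] by simp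
    then have "norm (appv F half_coords $ l) \<le> 1" for l
      using norm1_in_bidisc[of "appv F half_coords - half_coords" "1/64"] bidisc_nth[of "appv F half_coords - half_coords" "1/64" l]
        bidisc_nth[OF scaled_coords_in_bidisc[of "1/2" "1/2"], of l]
        norm_triangle_sub[of "appv F half_coords $ l" "half_coords $ l"] by simp
    then show ?thesis by (simp add: bidisc_iff)
  qed
  show ?thesis
  proof (rule appv_identity)
    have "\<forall>\<^sub>F \<xi> in nhds (0 :: real ^ 2). norm \<xi> < min 1 (2 * s / \<rho>)"
      using s(1) \<rho> by (intro eventually_norm_less) simp
    then show "\<forall>\<^sub>F \<xi> in nhds (0 :: real ^ 2). appv (appv B half_coords) \<xi> = appv (appv A (appv F half_coords)) \<xi>"
    proof eventually_elim
      case (elim \<xi>)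
      define x where "x = (\<rho> / 2) *\<^sub>R \<xi>"
      have \<xi>1: "\<xi> \<in> bidisc 1" using elim by (intro norm_in_bidisc) auto
      have x: "x /\<^sub>R \<rho> = (1/2) *\<^sub>R \<xi>" using \<rho> by (simp add: x_def)
      have nx: "norm x \<le> 1/2 * \<rho>" using elim \<rho> by (simp add: x_def)
      have "norm \<xi> < 2 * s / \<rho>" using elim by simp
      then have xs: "norm x < s" using \<rho> by (simp add: x_def field_simps)
      have hx: "appv half_coords \<xi> = (1/2) *\<^sub>R \<xi>" by (rule appv_scaled_coords[OF \<xi>1])
      have B: "\<rho> *\<^sub>R appv (appv B half_coords) \<xi> = b x"
        using expandsD[OF nearD(1)[OF b(1)], of x] nx \<rho> by (simp add: appv_appv[OF h1 \<xi>1] hx x)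
      have gx: "g x = \<rho> *\<^sub>R appv F ((1/2) *\<^sub>R \<xi>)"
        using expandsD[OF nearD(1)[OF g], of x] nx \<rho> by (simp add: x)
      have "norm (g x) \<le> \<rho>" using near_displacement[OF g nx] \<rho> by simp
      from expandsD[OF nearD(1)[OF a] this]
      have "a (g x) = \<rho> *\<^sub>R appv A (appv F ((1/2) *\<^sub>R \<xi>))" using \<rho> by (simp add: gx)
      also have "\<dots> = \<rho> *\<^sub>R appv (appv A (appv F half_coords)) \<xi>"
        by (simp add: appv_appv[OF Fh \<xi>1] appv_appv[OF h1 \<xi>1] hx)
      finally have "\<rho> *\<^sub>R appv (appv B half_coords) \<xi> = \<rho> *\<^sub>R appv (appv A (appv F half_coords)) \<xi>"
        using B s(2)[OF xs] by simp
      then show ?case using \<rho> by simp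
    qed
  qed
qed


text \<open>\<open>k\<close> is the first time at which the orbit of \<open>p\<close> leaves the
  disc of radius \<delta> / 2. Up to then \<open>iterate_displacement\<close> applies: at
  \<open>half_coords\<close> it yields the upper bound, at 0 the lower one.\<close>

lemma exists_power:
  assumes p: "p \<in> \<gamma>" and \<delta>: "0 < \<delta>"
    and family: "\<And>q. q \<in> \<gamma> \<Longrightarrow> norm (q - p) < \<delta> \<Longrightarrow> \<exists>e E. near p \<rho> (1/64) e E \<and> p + e 0 = q"
    and g: "near p \<rho> (1/64) g F" and g0: "g 0 \<noteq> 0" "norm (g 0) \<le> \<delta> / 4" "norm (g 0) < 1/2 * \<rho>"
  obtains k :: nat where "norm1 (real k *\<^sub>R (appv F half_coords - half_coords)) \<le> 1/16"
    "\<delta> / (4 * \<rho>) \<le> norm1 (real k *\<^sub>R appv F (0 :: real ^ 2))"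
proof -
  have \<rho>: "0 < \<rho>" using nearD(1)[OF g] by (rule expands_pos)
  \<comment> \<open>\<open>a i\<close> stands for the i-th iterate of \<open>g\<close>, but its
    successor is selected from the family by its value at 0. The choice is meaningful only while
    that value is within \<delta>, as the hypotheses of \<open>step\<close> ensure.\<close>
  define ab where "ab = rec_nat (\<lambda>x :: real ^ 2. x, coords)
    (\<lambda>_ aA. SOME eE. near p \<rho> (1/64) (fst eE) (snd eE) \<and> fst eE 0 = fst aA (g 0))"
  define a where "a i = fst (ab i)" for i
  define A where "A i = snd (ab i)" for i
  have zero: "a 0 = (\<lambda>x. x)" "A 0 = coords" by (simp_all add: a_def A_def ab_def)
  have pg: "p + g 0 \<in> \<gamma>" using nearD(4)[OF g, of 0] p \<rho> by simp
  have step: "near p \<rho> (1/64) (a (Suc i)) (A (Suc i)) \<and> a (Suc i) 0 = a i (g 0)"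
    if n: "near p \<rho> (1/64) (a i) (A i)" and s: "norm (a i 0) < \<delta> / 2" for i
  proof -
    have "norm (a i (g 0) - a i 0) \<le> 9/8 * norm (g 0 - 0)"
      by (rule near_lipschitz(2)[OF n]) (use g0 \<rho> in auto)
    then have "norm (a i (g 0)) < \<delta>"
      using norm_triangle_sub[of "a i (g 0)" "a i 0"] s g0(2) \<delta> by simp
    moreover have "p + a i (g 0) \<in> \<gamma>"
      by (rule nearD(4)[OF n _ pg]) (use g0 \<rho> in auto)
    ultimately obtain e E where "near p \<rho> (1/64) e E" "p + e 0 = p + a i (g 0)"
      using family[of "p + a i (g 0)"] by auto
    then have "\<exists>eE. near p \<rho> (1/64) (fst eE) (snd eE) \<and> fst eE 0 = fst (ab i) (g 0)"
      by (intro exI[of _ "(e, E)"]) (simp add: a_def)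
    from someI_ex[OF this] show ?thesis by (simp add: a_def A_def ab_def)
  qed
  have near: "near p \<rho> (1/64) (a k) (A k)" if "\<And>m. m < k \<Longrightarrow> norm (a m 0) < \<delta> / 2" for k
    using that
  proof (induction k)
    case 0
    show ?case using near_id[OF \<rho>, of "1/64" p] by (simp add: zero)
  next
    case (Suc k)
    then show ?case using step[of k] by simp
  qed
  have value0: "a i 0 = \<rho> *\<^sub>R appv (A i) 0" if "near p \<rho> (1/64) (a i) (A i)" for i
    using expandsD[OF nearD(1)[OF that], of 0] \<rho> by simp
  have gF: "g 0 = \<rho> *\<^sub>R appv F 0" using expandsD[OF nearD(1)[OF g], of 0] \<rho> by simp
  have F16: "norm1 (F - coords) \<le> 1/16" using nearD(2)[OF g] by simp
  have zb: "(0 :: real ^ 2) \<in> bidisc (1/2)" by (simp add: bidisc_def)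
  have zb1: "(0 :: real ^ 2) \<in> bidisc 1" by (simp add: bidisc_def)
  have hb: "half_coords \<in> bidisc (1/2)" by (rule scaled_coords_in_bidisc) simp
  have hb1: "half_coords \<in> bidisc 1" by (rule scaled_coords_in_bidisc) simp
  have b0: "real k * norm1 (appv F (0 :: real ^ 2)) \<le> 2 * norm1 (appv (A k) (0 :: real ^ 2))"
      "norm1 (appv (A k) (0 :: real ^ 2)) \<le> 2 * (real k * norm1 (appv F (0 :: real ^ 2)))"
      "real k * norm1 (appv F half_coords - half_coords) \<le> 1/32"
      "norm1 (appv (A k) (0 :: real ^ 2)) \<le> 1/64"
    if small: "\<And>m. m < k \<Longrightarrow> norm (a m 0) < \<delta> / 2" for k
  proof -
    have n: "near p \<rho> (1/64) (a i) (A i)" if "i \<le> k" for i using near[of i] small that by simp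
    have Ai: "norm1 (A i - coords) \<le> 1/16" if "i < k" for i using nearD(2)[OF n[of i]] that by simp
    have st0: "appv (A (Suc i)) (0 :: real ^ 2) = appv (A i) (appv F 0)" if i: "i < k" for i
    proof -
      have "\<rho> *\<^sub>R appv (A (Suc i)) (0 :: real ^ 2) = a i (g 0)"
        using value0[OF n[of "Suc i"]] step[OF n[of i] small[OF i]] i by simp
      also have "\<dots> = \<rho> *\<^sub>R appv (A i) (appv F 0)"
        using expandsD[OF nearD(1)[OF n[of i]], of "g 0"] i g0(3) \<rho> gF by simp
      finally show ?thesis using \<rho> by simp
    qed
    have sth: "appv (A (Suc i)) half_coords = appv (A i) (appv F half_coords)" if i: "i < k" for i
      by (rule near_step[OF p n[of i] g g0(3) n[of "Suc i"]]) (use i step[OF n[of i] small[OF i]] in auto)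
    \<comment> \<open>At 0 in the plane the estimate compares the motions of the base point; below,
      at \<open>half_coords\<close> in the algebra, it controls the whole map on the half
      disc.\<close>
    from iterate_displacement[OF zb zero(2) Ai F16 st0]
    show "real k * norm1 (appv F (0 :: real ^ 2)) \<le> 2 * norm1 (appv (A k) (0 :: real ^ 2))"
      "norm1 (appv (A k) (0 :: real ^ 2)) \<le> 2 * (real k * norm1 (appv F (0 :: real ^ 2)))" by simp_all
    have dh: "norm1 (appv (A k) half_coords - half_coords) \<le> 1/64"
      using norm1_appv_le[OF hb1, of "A k - coords"] nearD(2)[OF n[of k]] by (simp add: appv_simps(2)[OF hb1])
    have "real k * norm1 (appv F half_coords - half_coords) \<le> 2 * norm1 (appv (A k) half_coords - half_coords)"
      by (rule iterate_displacement(1)[OF hb zero(2) Ai F16 sth])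
    with dh show "real k * norm1 (appv F half_coords - half_coords) \<le> 1/32" by linarith
    show "norm1 (appv (A k) (0 :: real ^ 2)) \<le> 1/64"
      using norm1_appv_le[OF zb1, of "A k - coords"] nearD(2)[OF n[of k]] by (simp add: appv_simps(2)[OF zb1])
  qed
  \<comment> \<open>An orbit that never leaves would bound all multiples of the non-zero
    displacement at 0, against the Archimedean property.\<close>
  have "\<exists>k. \<delta> / 2 \<le> norm (a k 0)"
  proof (rule ccontr)
    assume "\<not> ?thesis"
    then have small: "norm (a m 0) < \<delta> / 2" for m by (simp add: not_le)
    have "real k * norm1 (appv F (0 :: real ^ 2)) \<le> 1" for k
      using b0(1)[of k, OF small] b0(4)[of k, OF small] by linarith
    moreover have "appv F (0 :: real ^ 2) \<noteq> 0" using g0(1) gF by auto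
    then have "0 < norm1 (appv F (0 :: real ^ 2))" using norm1_ge_zero norm1_eq_zero by (metis order_le_less)
    from reals_Archimedean3[OF this] obtain k where "1 < real k * norm1 (appv F (0 :: real ^ 2))" by blast
    ultimately show False by (smt (verit))
  qed
  define k where "k = (LEAST k. \<delta> / 2 \<le> norm (a k 0))"
  have k: "\<delta> / 2 \<le> norm (a k 0)" unfolding k_def by (rule LeastI_ex) fact
  have small: "norm (a m 0) < \<delta> / 2" if "m < k" for m
    using not_less_Least[OF that[unfolded k_def]] by simp
  show thesis
  proof (rule that[of k])
    show "norm1 (real k *\<^sub>R (appv F half_coords - half_coords)) \<le> 1/16"
      using b0(3)[of k, OF small] unfolding norm1_scaleR by simp
    have "\<delta> / 2 \<le> \<rho> * norm1 (appv (A k) (0 :: real ^ 2))"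
    proof -
      have "norm1 (a k 0) = \<rho> * norm1 (appv (A k) (0 :: real ^ 2))"
        using value0[OF near[of k, OF small]] \<rho> by simp
      then show ?thesis using k norm_le_norm1[of "a k 0"] by linarith
    qed
    also have "\<dots> \<le> \<rho> * (2 * (real k * norm1 (appv F (0 :: real ^ 2))))"
      using b0(2)[of k, OF small] \<rho> by (intro mult_left_mono) auto
    finally show "\<delta> / (4 * \<rho>) \<le> norm1 (real k *\<^sub>R appv F (0 :: real ^ 2))"
      using \<rho> unfolding norm1_scaleR by (simp add: field_simps)
  qed
qed

lemma tendsto_appv:
  assumes "(F \<longlongrightarrow> L) net" "a \<in> bidisc 1"
  shows "((\<lambda>n. appv (F n) a) \<longlongrightarrow> appv L a) net"
  by (rule vec_tendstoI)
    (simp add: bounded_linear.tendsto[OF bounded_linear_app[OF assms(2)] tendsto_vec_nth[OF assms(1)]])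

text \<open>The scaled displacements \<open>Y n\<close> are bounded on half the disc and subconverge
  after a second halving, so the limit field \<open>X\<close> lives on the disc of radius \<rho> /
  4. The lower bound from \<open>exists_power\<close> survives at 0.\<close>

lemma no_family_of_near_maps:
  assumes p: "p \<in> \<gamma>" and \<rho>: "0 < \<rho>"
    and family: "\<And>\<epsilon>. 0 < \<epsilon> \<Longrightarrow> \<exists>\<delta>>0. \<forall>q\<in>\<gamma>. norm (q - p) < \<delta> \<longrightarrow> (\<exists>e E. near p \<rho> \<epsilon> e E \<and> p + e 0 = q)"
  shows False
proof -
  obtain \<delta> where \<delta>: "0 < \<delta>" and fam: "\<And>q. q \<in> \<gamma> \<Longrightarrow> norm (q - p) < \<delta> \<Longrightarrow> \<exists>e E. near p \<rho> (1/64) e E \<and> p + e 0 = q"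
    using family[of "1/64"] by auto
  have "\<exists>g F k. near p \<rho> (1 / (64 * real (Suc n))) g F \<and>
      norm1 (real k *\<^sub>R (appv F half_coords - half_coords)) \<le> 1/16 \<and>
      \<delta> / (4 * \<rho>) \<le> norm1 (real k *\<^sub>R appv F (0 :: real ^ 2))" for n
  proof -
    let ?\<epsilon> = "1 / (64 * real (Suc n))"
    obtain \<delta>' where \<delta>': "0 < \<delta>'" "\<And>q. q \<in> \<gamma> \<Longrightarrow> norm (q - p) < \<delta>' \<Longrightarrow> \<exists>e E. near p \<rho> ?\<epsilon> e E \<and> p + e 0 = q"
      using family[of ?\<epsilon>] by auto
    define s where "s = min \<delta>' (min (\<delta> / 4) (1/2 * \<rho>))"
    have s: "0 < s" using \<delta>' \<delta> \<rho> by (simp add: s_def)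
    have "p \<in> ball p s" using s by simp
    from smooth_curve_not_isolated[OF smooth p open_ball this]
    obtain q where q: "q \<in> \<gamma>" "q \<in> ball p s" "q \<noteq> p" by blast
    then have nq: "norm (q - p) < s" by (simp add: dist_norm norm_minus_commute)
    then obtain g F where g: "near p \<rho> ?\<epsilon> g F" "p + g 0 = q" using \<delta>'(2)[OF q(1)] by (auto simp: s_def)
    have "?\<epsilon> \<le> 1/64" by (simp add: field_simps)
    with g(1) have g': "near p \<rho> (1/64) g F" by (rule near_mono)
    have gq: "g 0 = q - p" using g(2) by (simp add: algebra_simps)
    obtain k :: nat where "norm1 (real k *\<^sub>R (appv F half_coords - half_coords)) \<le> 1/16"
      "\<delta> / (4 * \<rho>) \<le> norm1 (real k *\<^sub>R appv F (0 :: real ^ 2))"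
      by (rule exists_power[OF p \<delta> fam g']) (use nq q(3) in \<open>auto simp: gq s_def\<close>)
    with g(1) show ?thesis by blast
  qed
  then obtain g F k where g: "\<And>n. near p \<rho> (1 / (64 * real (Suc n))) (g n) (F n)"
    and k: "\<And>n. norm1 (real (k n) *\<^sub>R (appv (F n) half_coords - half_coords)) \<le> 1/16"
      "\<And>n. \<delta> / (4 * \<rho>) \<le> norm1 (real (k n) *\<^sub>R appv (F n) (0 :: real ^ 2))"
    by metis
  define Y where "Y n = real (k n) *\<^sub>R (appv (F n) half_coords - half_coords)" for n
  obtain r L where r: "strict_mono r" and L: "(\<lambda>n. appv (Y (r n)) half_coords) \<longlonglongrightarrow> appv L half_coords"
    using wiener_vec_bounded_imp_convergent_subsequence[of Y, OF k(1)[folded Y_def]] by blast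
  define X where "X = appv L half_coords"
  have h1: "half_coords \<in> bidisc 1" by (rule scaled_coords_in_bidisc) simp
  have Yx: "appv (appv (Y n) half_coords) \<xi> = real (k n) *\<^sub>R (appv (F n) ((1/4) *\<^sub>R \<xi>) - (1/4) *\<^sub>R \<xi>)"
    if \<xi>: "\<xi> \<in> bidisc 1" for n and \<xi> :: "real ^ 2"
  proof -
    have hx: "appv half_coords \<xi> = (1/2) *\<^sub>R \<xi>" by (rule appv_scaled_coords[OF \<xi>])
    have b: "(1/2) *\<^sub>R \<xi> \<in> bidisc 1" using \<xi> by (simp add: bidisc_def)
    have hh: "appv half_coords ((1/2) *\<^sub>R \<xi>) = (1/4) *\<^sub>R \<xi>" using appv_scaled_coords[OF b, of "1/2"] by simp
    show ?thesis
      by (simp add: appv_appv[OF h1 \<xi>] hx Y_def appv_simps[OF b] appv_appv[OF h1 b] hh)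
  qed
  have limX: "(\<lambda>n. real (k (r n)) *\<^sub>R (appv (F (r n)) ((1/4) *\<^sub>R \<xi>) - (1/4) *\<^sub>R \<xi>)) \<longlonglongrightarrow> appv X \<xi>"
    if "\<xi> \<in> bidisc 1" for \<xi> :: "real ^ 2"
    using tendsto_appv[OF L that] by (simp add: Yx[OF that] X_def)
  have z: "(0 :: real ^ 2) \<in> bidisc 1" by (simp add: bidisc_def)
  have "(\<lambda>n. real (k (r n)) *\<^sub>R appv (F (r n)) (0 :: real ^ 2)) \<longlonglongrightarrow> appv X 0"
    using limX[OF z] by simp
  then have "(\<lambda>n. norm1 (real (k (r n)) *\<^sub>R appv (F (r n)) (0 :: real ^ 2))) \<longlonglongrightarrow> norm1 (appv X (0 :: real ^ 2))"
    unfolding norm1_def by (intro tendsto_intros)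
  then have "\<delta> / (4 * \<rho>) \<le> norm1 (appv X (0 :: real ^ 2))"
    by (rule LIMSEQ_le_const) (use k(2) in blast)
  moreover have "0 < \<delta> / (4 * \<rho>)" using \<delta> \<rho> by simp
  ultimately have "appv X (0 :: real ^ 2) \<noteq> 0" by (metis norm1_eq_zero not_le)
  then obtain i where i: "coef (X $ i) (0, 0) \<noteq> 0" by (auto simp: vec_eq_iff app_at_0)
  have "analytic_point \<gamma> p"
  proof (rule analytic_point_of_tangent_field[OF smooth p _ i])
    show r4: "0 < 1/4 * \<rho>" using \<rho> by simp
    fix x assume x: "x \<in> \<gamma>" "norm (x - p) \<le> 1/4 * \<rho>"
    define \<xi> where "\<xi> = (x - p) /\<^sub>R (1/4 * \<rho>)"
    have \<xi>: "\<xi> \<in> bidisc 1" unfolding \<xi>_def by (rule scaled_in_bidisc[OF r4]) (use x in simp)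
    have \<xi>4: "(1/4) *\<^sub>R \<xi> = (x - p) /\<^sub>R \<rho>" by (simp add: \<xi>_def inverse_eq_divide)
    have xr: "norm (x - p) \<le> \<rho>" using x(2) \<rho> by simp
    define y where "y n = p + g (r n) (x - p)" for n
    have "tangent_to \<gamma> x (appv X \<xi>)"
      unfolding tangent_to_def
    proof (intro exI conjI allI)
      show "y n \<in> \<gamma>" for n using nearD(4)[OF g xr] x(1) by (simp add: y_def)
      have yx: "y n - x = g (r n) (x - p) - (x - p)" for n by (simp add: y_def algebra_simps)
      have bound: "norm (y n - x) \<le> \<rho> / 64 * inverse (real (Suc (r n)))" for n
      proof -
        have "norm (y n - x) \<le> norm1 (g (r n) (x - p) - (x - p))" unfolding yx by (rule norm_le_norm1)
        also have "\<dots> \<le> \<rho> * norm1 (F (r n) - coords)" by (rule near_identity_displacement[OF nearD(1)[OF g] xr])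
        also have "\<dots> \<le> \<rho> * (1 / (64 * real (Suc (r n))))" using nearD(2)[OF g] \<rho> by (intro mult_left_mono) auto
        also have "\<dots> = \<rho> / 64 * inverse (real (Suc (r n)))" by (simp only: divide_inverse inverse_mult_distrib mult.assoc mult_1_left)
        finally show ?thesis .
      qed
      have "(\<lambda>n. \<rho> / 64 * inverse (real (Suc n))) \<longlonglongrightarrow> \<rho> / 64 * 0"
        by (intro tendsto_mult tendsto_const LIMSEQ_inverse_real_of_nat)
      from LIMSEQ_subseq_LIMSEQ[OF this r]
      have "(\<lambda>n. \<rho> / 64 * inverse (real (Suc (r n)))) \<longlonglongrightarrow> 0"
        unfolding o_def mult_zero_right .
      then have "(\<lambda>n. y n - x) \<longlonglongrightarrow> 0"
        by (rule Lim_null_comparison[OF always_eventually[OF allI[OF bound]]])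
      then show "y \<longlonglongrightarrow> x" by (rule LIM_zero_cancel)
      \<comment> \<open>The secant scalars are \<open>k (r n) / \<rho>\<close> because series
        describe displacements in units of \<rho>.\<close>
      have "(y n - x) /\<^sub>R \<rho> = appv (F (r n)) ((1/4) *\<^sub>R \<xi>) - (1/4) *\<^sub>R \<xi>" for n
        using expandsD[OF nearD(1)[OF g] xr, of "r n"] \<rho> unfolding yx \<xi>4
        by (simp add: scaleR_diff_right)
      moreover have "(real (k (r n)) / \<rho>) *\<^sub>R (y n - x) = real (k (r n)) *\<^sub>R ((y n - x) /\<^sub>R \<rho>)" for n
        by (simp only: divide_inverse scaleR_scaleR)
      ultimately have "(real (k (r n)) / \<rho>) *\<^sub>R (y n - x) = real (k (r n)) *\<^sub>R (appv (F (r n)) ((1/4) *\<^sub>R \<xi>) - (1/4) *\<^sub>R \<xi>)" for n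
        by (simp only:)
      then show "(\<lambda>n. (real (k (r n)) / \<rho>) *\<^sub>R (y n - x)) \<longlonglongrightarrow> appv X \<xi>"
        using limX[OF \<xi>] by (simp only:)
    qed
    then show "tangent_to \<gamma> x (appv X ((x - p) /\<^sub>R (1/4 * \<rho>)))" by (simp only: \<xi>_def)
  qed
  then show False using not_analytic[OF p] by simp
qed

end

section \<open>Bounded families of maps and Baire category\<close>

text \<open>A total function determined by its series, so that its germ can be named and limits of
  maps reduce to limits of series.\<close>

definition dilated :: "real \<Rightarrow> wiener ^ 2 \<Rightarrow> real ^ 2 \<Rightarrow> real ^ 2" where
  "dilated \<rho> F x = \<rho> *\<^sub>R appv F (x /\<^sub>R \<rho>)"

lemma expands_dilated: "0 < \<rho> \<Longrightarrow> expands (dilated \<rho> F) \<rho> F"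
  by (simp add: expands_def dilated_def)

lemma ranalytic_at_dilated: "0 < \<rho> \<Longrightarrow> norm x < \<rho> \<Longrightarrow> ranalytic_at (dilated \<rho> F) x"
  using expands_imp_ranalytic_at[where p = 0 and f = "dilated \<rho> F" and \<rho> = \<rho> and F = F and q = x] expands_dilated[of \<rho> F] by simp

lemma expands_eq_dilated: "expands f \<rho> F \<Longrightarrow> norm x \<le> \<rho> \<Longrightarrow> f x = dilated \<rho> F x"
  by (simp add: expands_def dilated_def)

abbreviation halve :: "wiener ^ 2 \<Rightarrow> wiener ^ 2" where "halve F \<equiv> appv F half_coords"

lemma half_coords_bidisc: "half_coords \<in> bidisc 1" "half_coords \<in> bidisc (1/2)"
  by (auto intro!: scaled_coords_in_bidisc)

lemma dilated_halve:
  assumes "0 < \<rho>" "norm x \<le> 1/2 * \<rho>"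
  shows "dilated \<rho> F x = dilated (1/2 * \<rho>) (2 *\<^sub>R halve F) x"
  using expands_eq_dilated[OF expands_shrink[OF expands_dilated[OF assms(1), of F], of "1/2"] assms(2)] by simp

lemma dilated_diff_le:
  assumes \<rho>: "0 < \<rho>" and x: "norm x \<le> 3/4 * \<rho>" and y: "norm y \<le> 3/4 * \<rho>"
  shows "norm (dilated \<rho> F x - dilated \<rho> F y) \<le> 8 * norm1 F * norm (x - y)"
proof -
  have "norm (dilated \<rho> F x - dilated \<rho> F y) = \<rho> * norm (appv F (x /\<^sub>R \<rho>) - appv F (y /\<^sub>R \<rho>))"
    using \<rho> by (simp add: dilated_def scaleR_diff_right[symmetric])
  also have "\<dots> \<le> \<rho> * norm1 (appv F (x /\<^sub>R \<rho>) - appv F (y /\<^sub>R \<rho>))"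
    using \<rho> norm_le_norm1 by (intro mult_left_mono) auto
  also have "\<dots> \<le> \<rho> * (4 * norm1 F * norm1 (x /\<^sub>R \<rho> - y /\<^sub>R \<rho>))"
    using \<rho> by (intro mult_left_mono norm1_appv_diff_le scaled_in_bidisc x y) auto
  also have "x /\<^sub>R \<rho> - y /\<^sub>R \<rho> = (x - y) /\<^sub>R \<rho>" by (simp add: scaleR_diff_right)
  also have "\<rho> * (4 * norm1 F * norm1 ((x - y) /\<^sub>R \<rho>)) = 4 * norm1 F * norm1 (x - y)" using \<rho> by simp
  also have "\<dots> \<le> 4 * norm1 F * (2 * norm (x - y))" by (intro mult_left_mono norm1_le_norm) auto
  finally show ?thesis by simp
qed

lemma dilated_halve_diff_le:
  assumes \<rho>: "0 < \<rho>" and x: "norm x \<le> 1/2 * \<rho>"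
  shows "norm (dilated \<rho> F x - dilated \<rho> L x) \<le> \<rho> * norm1 (halve F - halve L)"
proof -
  have r: "0 < 1/2 * \<rho>" using \<rho> by simp
  define \<xi> where "\<xi> = x /\<^sub>R (1/2 * \<rho>)"
  have \<xi>: "\<xi> \<in> bidisc 1" unfolding \<xi>_def using scaled_in_bidisc[OF r, of x 1] x by simp
  have "dilated \<rho> W x = \<rho> *\<^sub>R appv (halve W) \<xi>" for W
  proof -
    have "dilated \<rho> W x = dilated (1/2 * \<rho>) (2 *\<^sub>R halve W) x" by (rule dilated_halve[OF \<rho> x])
    also have "\<dots> = (1/2 * \<rho>) *\<^sub>R appv (2 *\<^sub>R halve W) \<xi>" by (simp only: dilated_def \<xi>_def)
    finally show ?thesis by (simp add: appv_simps(3)[OF \<xi>])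
  qed
  then have "dilated \<rho> F x - dilated \<rho> L x = \<rho> *\<^sub>R appv (halve F - halve L) \<xi>"
    by (simp add: appv_simps(2)[OF \<xi>] scaleR_diff_right)
  then show ?thesis
    using \<rho> order_trans[OF norm_le_norm1 norm1_appv_le[OF \<xi>, of "halve F - halve L"]]
    by (simp add: mult_left_mono)
qed

text \<open>The common Lipschitz constant 8 * M takes care of the moving argument; at the fixed
  argument the maps converge because their series converge on half the disc.\<close>

lemma tendsto_dilated:
  assumes \<rho>: "0 < \<rho>" and M: "\<And>n::nat. norm1 (F n) \<le> M" and F: "(\<lambda>n. halve (F n)) \<longlonglongrightarrow> halve L"
    and y: "y \<longlonglongrightarrow> x" and x: "norm x \<le> 1/2 * \<rho>"
  shows "(\<lambda>n. dilated \<rho> (F n) (y n)) \<longlonglongrightarrow> dilated \<rho> L x"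
proof (rule LIM_zero_cancel, rule Lim_null_comparison)
  have x': "norm x < 3/4 * \<rho>" using x \<rho> by linarith
  have "\<forall>\<^sub>F n in sequentially. norm (y n) < 3/4 * \<rho>"
    by (rule order_tendstoD(2)[OF tendsto_norm[OF y] x'])
  then show "\<forall>\<^sub>F n in sequentially. norm (dilated \<rho> (F n) (y n) - dilated \<rho> L x)
      \<le> 8 * M * norm (y n - x) + \<rho> * norm1 (halve (F n) - halve L)"
  proof eventually_elim
    case (elim n)
    have "norm (dilated \<rho> (F n) (y n) - dilated \<rho> (F n) x) \<le> 8 * norm1 (F n) * norm (y n - x)"
      by (rule dilated_diff_le[OF \<rho>]) (use elim x' in auto)
    also have "\<dots> \<le> 8 * M * norm (y n - x)" using M[of n] by (intro mult_right_mono) auto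
    finally show ?case
      using dilated_halve_diff_le[OF \<rho> x, of "F n" L]
        norm_triangle_ineq[of "dilated \<rho> (F n) (y n) - dilated \<rho> (F n) x" "dilated \<rho> (F n) x - dilated \<rho> L x"]
      by simp
  qed
  have "(\<lambda>n. 8 * M * norm (y n - x) + \<rho> * norm1 (halve (F n) - halve L)) \<longlonglongrightarrow> 8 * M * norm (x - x) + \<rho> * 0"
    by (intro tendsto_intros y tendsto_norm1 F)
  then show "(\<lambda>n. 8 * M * norm (y n - x) + \<rho> * norm1 (halve (F n) - halve L)) \<longlonglongrightarrow> 0" by simp
qed

section \<open>Mutually inverse maps between points of the curve, and their limits\<close>

context nowhere_analytic_curve
begin

text \<open>Formulated so as to survive limits in \<open>F\<close>, \<open>K\<close> and the base
  points: \<eta> keeps the images in a ball where \<gamma> is closed, and \<open>K\<close> is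
  required to invert only where its argument lies in the disc.\<close>

definition link :: "real \<Rightarrow> real \<Rightarrow> real ^ 2 \<Rightarrow> real ^ 2 \<Rightarrow> wiener ^ 2 \<Rightarrow> wiener ^ 2 \<Rightarrow> bool" where
  "link \<rho> \<eta> p q F K \<longleftrightarrow> (\<forall>x. norm x \<le> \<rho> \<longrightarrow> norm (dilated \<rho> F x) \<le> \<eta> \<and>
     (p + x \<in> \<gamma> \<longrightarrow> q + dilated \<rho> F x \<in> \<gamma>) \<and>
     (norm (dilated \<rho> F x) \<le> \<rho> \<longrightarrow> dilated \<rho> K (dilated \<rho> F x) = x))"

text \<open>For fixed \<rho> and \<open>M\<close> such pairs are compact up to halving the disc,
  while countably many choices of \<rho> and \<open>M\<close> cover all points of the curve. Both
  directions are kept because convergence of the inverses makes the limit invertible.\<close>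

definition linked :: "real \<Rightarrow> real \<Rightarrow> real \<Rightarrow> real ^ 2 \<Rightarrow> real ^ 2 \<Rightarrow> wiener ^ 2 \<Rightarrow> wiener ^ 2 \<Rightarrow> bool" where
  "linked \<rho> \<eta> M p q F K \<longleftrightarrow> 0 < \<rho> \<and> norm1 F \<le> M \<and> norm1 K \<le> M \<and>
     germ (dilated \<rho> F) \<in> G \<and> germ (dilated \<rho> K) \<in> G \<and> link \<rho> \<eta> p q F K \<and> link \<rho> \<eta> q p K F"

lemma link_limit:
  assumes \<rho>: "0 < \<rho>" and l: "\<And>n::nat. link \<rho> \<eta> (p n) (q n) (F n) (K n)"
    and M: "\<And>n. norm1 (F n) \<le> M" "\<And>n. norm1 (K n) \<le> M"
    and lim: "p \<longlonglongrightarrow> p'" "q \<longlonglongrightarrow> q'" "(\<lambda>n. halve (F n)) \<longlonglongrightarrow> halve F'" "(\<lambda>n. halve (K n)) \<longlonglongrightarrow> halve K'"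
    and cl: "closed (\<gamma> \<inter> cball c (2 * \<eta>))" and q: "\<And>n. q n \<in> cball c \<eta>"
  shows "link (1/2 * \<rho>) \<eta> p' q' (2 *\<^sub>R halve F') (2 *\<^sub>R halve K')"
  unfolding link_def
proof (intro allI impI)
  fix x :: "real ^ 2" assume x: "norm x \<le> 1/2 * \<rho>"
  let ?f = "dilated \<rho> F'" and ?k = "dilated \<rho> K'"
  have xr: "norm x \<le> \<rho>" using x \<rho> by linarith
  have fx: "dilated (1/2 * \<rho>) (2 *\<^sub>R halve F') x = ?f x" by (rule dilated_halve[OF \<rho> x, symmetric])
  have fn: "(\<lambda>n. dilated \<rho> (F n) x) \<longlonglongrightarrow> ?f x"
    by (rule tendsto_dilated[OF \<rho> M(1) lim(3) tendsto_const x])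
  have 1: "norm (?f x) \<le> \<eta>"
    by (rule LIMSEQ_le_const2[OF tendsto_norm[OF fn]]) (use l xr in \<open>auto simp: link_def\<close>)
  have 2: "q' + ?f x \<in> \<gamma>" if px: "p' + x \<in> \<gamma>"
  proof -
    \<comment> \<open>The base points vary with \<open>n\<close>; this correction keeps
      \<open>p n + y n\<close> at the fixed curve point \<open>p' + x\<close>.\<close>
    define y where "y n = p' + x - p n" for n
    have "y \<longlonglongrightarrow> p' + x - p'" unfolding y_def by (intro tendsto_intros lim)
    then have y: "y \<longlonglongrightarrow> x" by simp
    have "norm x < \<rho>" using x \<rho> by linarith
    from order_tendstoD(2)[OF tendsto_norm[OF y] this]
    have "\<forall>\<^sub>F n in sequentially. q n + dilated \<rho> (F n) (y n) \<in> \<gamma> \<inter> cball c (2 * \<eta>)"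
    proof eventually_elim
      case (elim n)
      have "p n + y n \<in> \<gamma>" using px by (simp add: y_def)
      then have 1: "q n + dilated \<rho> (F n) (y n) \<in> \<gamma>" "norm (dilated \<rho> (F n) (y n)) \<le> \<eta>"
        using l[of n] elim by (auto simp: link_def)
      have "dist c (q n + dilated \<rho> (F n) (y n)) \<le> dist c (q n) + norm (dilated \<rho> (F n) (y n))"
        using dist_triangle[of c "q n + dilated \<rho> (F n) (y n)" "q n"] by (simp add: dist_norm)
      then show ?case using 1 q[of n] by simp
    qed
    from Lim_in_closed_set[OF cl this trivial_limit_sequentially
        tendsto_add[OF lim(2) tendsto_dilated[OF \<rho> M(1) lim(3) y x]]]
    have "q' + ?f x \<in> \<gamma> \<inter> cball c (2 * \<eta>)" .
    then show ?thesis by simp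
  qed
  have 3: "dilated (1/2 * \<rho>) (2 *\<^sub>R halve K') (?f x) = x" if fs: "norm (?f x) \<le> 1/2 * \<rho>"
  proof -
    have "norm (?f x) < \<rho>" using fs \<rho> by linarith
    from order_tendstoD(2)[OF tendsto_norm[OF fn] this]
    have "\<forall>\<^sub>F n in sequentially. dilated \<rho> (K n) (dilated \<rho> (F n) x) = x"
      by eventually_elim (use l xr in \<open>auto simp: link_def\<close>)
    then have "(\<lambda>n. dilated \<rho> (K n) (dilated \<rho> (F n) x)) \<longlonglongrightarrow> x" by (rule tendsto_eventually)
    moreover have "(\<lambda>n. dilated \<rho> (K n) (dilated \<rho> (F n) x)) \<longlonglongrightarrow> ?k (?f x)"
      by (rule tendsto_dilated[OF \<rho> M(2) lim(4) fn fs])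
    ultimately have "?k (?f x) = x" by (rule LIMSEQ_unique[rotated])
    then show ?thesis using dilated_halve[OF \<rho> fs, of K'] by simp
  qed
  show "norm (dilated (1/2 * \<rho>) (2 *\<^sub>R halve F') x) \<le> \<eta> \<and>
      (p' + x \<in> \<gamma> \<longrightarrow> q' + dilated (1/2 * \<rho>) (2 *\<^sub>R halve F') x \<in> \<gamma>) \<and>
      (norm (dilated (1/2 * \<rho>) (2 *\<^sub>R halve F') x) \<le> 1/2 * \<rho> \<longrightarrow>
        dilated (1/2 * \<rho>) (2 *\<^sub>R halve K') (dilated (1/2 * \<rho>) (2 *\<^sub>R halve F') x) = x)"
    unfolding fx using 1 2 3 by blast
qed

text \<open>Closedness of \<open>G\<close> applies to limits that are already in
  \<open>Diff_omega\<close>; the Jacobian of the limit is non-zero because the link provides an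
  inverse.\<close>

lemma germ_limit_of_links:
  assumes \<rho>: "0 < \<rho>" and G: "\<And>n::nat. germ (dilated \<rho> (F n)) \<in> G" and M: "\<And>n. norm1 (F n) \<le> M"
    and lim: "(\<lambda>n. halve (F n)) \<longlonglongrightarrow> halve F'"
    and link: "link (1/2 * \<rho>) \<eta> p q (2 *\<^sub>R halve F') K"
  shows "germ (dilated (1/2 * \<rho>) (2 *\<^sub>R halve F')) \<in> G"
proof -
  let ?r = "1/2 * \<rho>"
  let ?f = "dilated ?r (2 *\<^sub>R halve F')"
  have r: "0 < ?r" using \<rho> by simp
  have "(\<lambda>n. dilated \<rho> (F n) 0) \<longlonglongrightarrow> dilated \<rho> F' 0"
    by (rule tendsto_dilated[OF \<rho> M lim tendsto_const]) (use \<rho> in simp)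
  moreover have "dilated \<rho> (F n) 0 = 0" for n using germ_memD(1)[OF G] .
  ultimately have "(\<lambda>n. 0) \<longlonglongrightarrow> dilated \<rho> F' 0" by simp
  from LIMSEQ_unique[OF this tendsto_const] have "dilated \<rho> F' 0 = 0" .
  then have f0: "?f 0 = 0" using dilated_halve[OF \<rho>, of 0 F'] \<rho> by simp
  have an: "ranalytic_at ?f 0" "ranalytic_at (dilated ?r K) 0" using r by (auto intro: ranalytic_at_dilated)
  have ev: "\<forall>\<^sub>F x :: real ^ 2 in nhds 0. norm x < ?r" by (rule eventually_norm_less[OF r])
  from eventually_compose_isCont[OF ranalytic_at_imp_isCont[OF an(1)] f0 this] ev
  have inv: "\<forall>\<^sub>F x in nhds 0. dilated ?r K (?f x) = x"
    by eventually_elim (use link in \<open>auto simp: link_def\<close>)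
  show ?thesis
  proof (rule germ_mem_limit[OF closed r])
    show "ranalytic_at (dilated \<rho> (F n)) x" if "norm x < ?r" for n x
      using that \<rho> by (intro ranalytic_at_dilated) auto
    show "germ (dilated \<rho> (F n)) \<in> G" for n by (rule G)
    show "ranalytic_at ?f x" if "norm x < ?r" for x using that r by (intro ranalytic_at_dilated)
    show "?f 0 = 0" by (rule f0)
    show "det (jacobian ?f (at 0)) \<noteq> 0"
      by (rule det_jacobian_neq_0I[where f = ?f and k = "dilated ?r K"])
        (use an f0 inv in \<open>auto intro: ranalytic_at_imp_differentiable\<close>)
    show "uniform_limit (ball 0 ?r) (\<lambda>n. dilated \<rho> (F n)) ?f sequentially"
      unfolding uniform_limit_iff
    proof (intro allI impI)
      fix e :: real assume e: "0 < e"
      have "(\<lambda>n. \<rho> * norm1 (halve (F n) - halve F')) \<longlonglongrightarrow> \<rho> * 0"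
        by (intro tendsto_mult tendsto_const tendsto_norm1 lim)
      then have "\<forall>\<^sub>F n in sequentially. \<rho> * norm1 (halve (F n) - halve F') < e"
        using e by (intro order_tendstoD(2)) auto
      then show "\<forall>\<^sub>F n in sequentially. \<forall>x\<in>ball 0 ?r. dist (dilated \<rho> (F n) x) (?f x) < e"
      proof eventually_elim
        case (elim n)
        have "norm (dilated \<rho> (F n) x - dilated \<rho> F' x) < e" "dilated \<rho> F' x = ?f x" if "norm x < ?r" for x
          using dilated_halve_diff_le[OF \<rho>, of x "F n" F'] elim that dilated_halve[OF \<rho>, of x F'] by auto
        then show ?case by (auto simp: dist_norm)
      qed
    qed
  qed
qed

text \<open>Subsequences are extracted first for \<open>F\<close> and then for \<open>K\<close>. The
  bound 4 * M combines 2 * M for the limit of a pair with a factor 2 for rescaling to the half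
  disc.\<close>

lemma linked_limit:
  assumes l: "\<And>n::nat. linked \<rho> \<eta> M p (q n) (F n) (K n)" and q: "q \<longlonglongrightarrow> q'"
    and cl: "closed (\<gamma> \<inter> cball c (2 * \<eta>))" and qc: "\<And>n. q n \<in> cball c \<eta>" "p \<in> cball c \<eta>"
  obtains r F' K' where "strict_mono r" "linked (1/2 * \<rho>) \<eta> (4 * M) p q' (2 *\<^sub>R halve F') (2 *\<^sub>R halve K')"
    "(\<lambda>n. halve (F (r n))) \<longlonglongrightarrow> halve F'"
proof -
  have \<rho>: "0 < \<rho>" using l[of 0] by (simp add: linked_def)
  have M: "norm1 (F n) \<le> M" "norm1 (K n) \<le> M" for n using l[of n] by (auto simp: linked_def)
  obtain r1 F' where r1: "strict_mono r1" "norm1 F' \<le> 2 * M" "(\<lambda>n. halve (F (r1 n))) \<longlonglongrightarrow> halve F'"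
    by (rule wiener_vec_bounded_imp_convergent_subsequence[of F M, OF M(1)]) blast
  obtain r2 K' where r2: "strict_mono r2" "norm1 K' \<le> 2 * M" "(\<lambda>n. halve (K (r1 (r2 n)))) \<longlonglongrightarrow> halve K'"
    by (rule wiener_vec_bounded_imp_convergent_subsequence[of "\<lambda>n. K (r1 n)" M, OF M(2)]) blast
  define r where "r = r1 \<circ> r2"
  have r: "strict_mono r" unfolding r_def by (rule strict_mono_o[OF r1(1) r2(1)])
  have F: "(\<lambda>n. halve (F (r n))) \<longlonglongrightarrow> halve F'"
    using LIMSEQ_subseq_LIMSEQ[OF r1(3) r2(1)] by (simp add: r_def o_def)
  have K: "(\<lambda>n. halve (K (r n))) \<longlonglongrightarrow> halve K'" using r2(3) by (simp add: r_def)
  have qr: "(\<lambda>n. q (r n)) \<longlonglongrightarrow> q'" using LIMSEQ_subseq_LIMSEQ[OF q r] by (simp add: o_def)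
  have lF: "link \<rho> \<eta> p (q (r n)) (F (r n)) (K (r n))" and lK: "link \<rho> \<eta> (q (r n)) p (K (r n)) (F (r n))"
    and gF: "germ (dilated \<rho> (F (r n))) \<in> G" and gK: "germ (dilated \<rho> (K (r n))) \<in> G" for n
    using l[of "r n"] by (auto simp: linked_def)
  have 1: "link (1/2 * \<rho>) \<eta> p q' (2 *\<^sub>R halve F') (2 *\<^sub>R halve K')"
    by (rule link_limit[OF \<rho> lF M(1) M(2) tendsto_const qr F K cl qc(1)])
  have 2: "link (1/2 * \<rho>) \<eta> q' p (2 *\<^sub>R halve K') (2 *\<^sub>R halve F')"
    by (rule link_limit[OF \<rho> lK M(2) M(1) qr tendsto_const K F cl qc(2)])
  have 3: "norm1 (2 *\<^sub>R halve F') \<le> 4 * M" "norm1 (2 *\<^sub>R halve K') \<le> 4 * M"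
    using norm1_appv_le[OF half_coords_bidisc(1), of F'] norm1_appv_le[OF half_coords_bidisc(1), of K'] r1(2) r2(2)
    by simp_all
  have "linked (1/2 * \<rho>) \<eta> (4 * M) p q' (2 *\<^sub>R halve F') (2 *\<^sub>R halve K')"
    unfolding linked_def
    using \<rho> 1 2 3 germ_limit_of_links[OF \<rho> gF M(1) F 1] germ_limit_of_links[OF \<rho> gK M(2) K 2] by simp
  with r show thesis using F by (rule that)
qed


lemma linkD:
  assumes "link \<rho> \<eta> p q F K" "norm x \<le> \<rho>"
  shows "norm (dilated \<rho> F x) \<le> \<eta>" "p + x \<in> \<gamma> \<Longrightarrow> q + dilated \<rho> F x \<in> \<gamma>"
    "norm (dilated \<rho> F x) \<le> \<rho> \<Longrightarrow> dilated \<rho> K (dilated \<rho> F x) = x"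
  using assms by (auto simp: link_def)

lemma linkedD:
  assumes "linked \<rho> \<eta> M p q F K"
  shows "0 < \<rho>" "norm1 F \<le> M" "norm1 K \<le> M" "germ (dilated \<rho> F) \<in> G" "germ (dilated \<rho> K) \<in> G"
    "link \<rho> \<eta> p q F K" "link \<rho> \<eta> q p K F"
  using assms by (auto simp: linked_def)

text \<open>\<open>e\<close> goes back from \<open>p\<close> to \<open>p0\<close> and on to
  \<open>q\<close>. As \<open>F1\<close> composed with the shrunk \<open>K1\<close> is
  \<open>s\<close> times the identity, \<open>E - coords\<close> contains only \<open>q - p\<close>
  and the difference of the two series, divided by \<open>s\<close>.\<close>

lemma near_of_linked:
  fixes q :: "real ^ 2"
  assumes l: "linked \<rho> \<eta> M p0 q F K" and l1: "linked \<rho>' \<eta> M' p0 p F1 K1" and \<rho>': "\<rho>' = 1/2 * \<rho>"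
    and s: "0 < s" "s \<le> 1/2" "32 * M' * s \<le> 4"
  defines "E \<equiv> (1 / s) *\<^sub>R (constv ((q - p) /\<^sub>R \<rho>') + appv (2 *\<^sub>R halve F) (appv K1 (s *\<^sub>R coords)))"
  defines "e \<equiv> \<lambda>x. (q - p) + dilated \<rho> F (dilated \<rho>' K1 x)"
  assumes \<epsilon>: "(norm1 (q - p) / \<rho>' + norm1 (2 *\<^sub>R halve F - F1)) / s \<le> \<epsilon>"
  shows "near p (s * \<rho>') \<epsilon> e E" "p + e 0 = q"
proof -
  have \<rho>: "0 < \<rho>" "0 < \<rho>'" using linkedD(1)[OF l] linkedD(1)[OF l1] by auto
  note k0 = germ_memD(1)[OF linkedD(5)[OF l1]] and f0 = germ_memD(1)[OF linkedD(4)[OF l]]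
  show e0: "p + e 0 = q" by (simp add: e_def k0 f0)
  define Ks where "Ks = appv K1 (s *\<^sub>R coords)"
  have sc: "s *\<^sub>R coords \<in> bidisc (3/4)" "s *\<^sub>R coords \<in> bidisc 1" using s by (auto intro!: scaled_coords_in_bidisc)
  \<comment> \<open>The Lipschitz factor 4 and \<open>norm1 coords = 2\<close> bound
    \<open>Ks\<close> by 8 * s * M', which the hypothesis on \<open>s\<close> makes at most 1; so
    \<open>Ks\<close> may be substituted into a series.\<close>
  have Ks: "norm1 Ks \<le> 1"
  proof -
    have "appv K1 (0 :: real ^ 2) = 0" using k0 \<rho> by (simp add: dilated_def)
    then have "appv K1 (0 :: wiener ^ 2) = 0" by (simp add: vec_eq_iff app_at_0)
    then have "norm1 Ks \<le> 4 * norm1 K1 * norm1 (s *\<^sub>R coords)"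
      using norm1_appv_diff_le[OF sc(1), of 0 K1] by (simp add: Ks_def bidisc_def)
    also have "\<dots> = (8 * s) * norm1 K1" using s by simp
    also have "\<dots> \<le> (8 * s) * M'" using linkedD(3)[OF l1] s by (intro mult_left_mono) auto
    finally show ?thesis using s(3) by (simp add: algebra_simps)
  qed
  then have Kb: "Ks \<in> bidisc 1" by (rule norm1_in_bidisc)
  have r1: "0 < s * \<rho>'" "s * \<rho>' \<le> \<rho>'" using s \<rho> by auto
  have kx: "dilated \<rho>' K1 x = \<rho>' *\<^sub>R appv Ks (x /\<^sub>R (s * \<rho>'))" "norm (dilated \<rho>' K1 x) \<le> \<rho>'"
    if x: "norm x \<le> s * \<rho>'" for x
  proof -
    define \<xi> where "\<xi> = x /\<^sub>R (s * \<rho>')"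
    have \<xi>: "\<xi> \<in> bidisc 1" unfolding \<xi>_def using scaled_in_bidisc[OF r1(1), of x 1] x by simp
    have "x /\<^sub>R \<rho>' = s *\<^sub>R \<xi>" using s \<rho> by (simp add: \<xi>_def)
    then have 1: "dilated \<rho>' K1 x = \<rho>' *\<^sub>R appv Ks \<xi>"
      using appv_appv[OF sc(2) \<xi>, of K1] appv_scaled_coords[OF \<xi>, of s] by (simp add: dilated_def Ks_def)
    then show "dilated \<rho>' K1 x = \<rho>' *\<^sub>R appv Ks (x /\<^sub>R (s * \<rho>'))" by (simp only: \<xi>_def)
    have "norm (appv Ks \<xi>) \<le> 1"
      using norm_le_norm1[of "appv Ks \<xi>"] norm1_appv_le[OF \<xi>, of Ks] Ks by linarith
    then show "norm (dilated \<rho>' K1 x) \<le> \<rho>'" using 1 \<rho> by (simp add: mult_left_le)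
  qed
  have dil: "dilated \<rho>' W (\<rho>' *\<^sub>R a) = \<rho>' *\<^sub>R appv W a" for W a using \<rho> by (simp add: dilated_def)
  have FK: "appv F1 Ks = s *\<^sub>R coords"
  proof (rule appv_identity)
    have "\<forall>\<^sub>F \<xi> :: real ^ 2 in nhds 0. norm \<xi> < 1" by (rule eventually_norm_less) simp
    then show "\<forall>\<^sub>F \<xi> :: real ^ 2 in nhds 0. appv (appv F1 Ks) \<xi> = appv (s *\<^sub>R coords) \<xi>"
    proof eventually_elim
      case (elim \<xi>)
      define x where "x = (s * \<rho>') *\<^sub>R \<xi>"
      have \<xi>: "\<xi> \<in> bidisc 1" using elim by (intro norm_in_bidisc) simp
      have "norm x \<le> s * \<rho>'" using elim s \<rho> by (simp add: x_def mult_left_le)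
      moreover have "x /\<^sub>R (s * \<rho>') = \<xi>" unfolding x_def scaleR_scaleR left_inverse[OF less_imp_neq[OF r1(1), symmetric]] by (rule scaleR_one)
      ultimately have x: "norm x \<le> s * \<rho>'" "x /\<^sub>R (s * \<rho>') = \<xi>" .
      have "norm x \<le> \<rho>'" using x(1) r1 by linarith
      from linkD(3)[OF linkedD(7)[OF l1] this kx(2)[OF x(1)]]
      have "\<rho>' *\<^sub>R appv F1 (appv Ks \<xi>) = x" unfolding kx(1)[OF x(1)] x(2) dil .
      also have "x = \<rho>' *\<^sub>R (s *\<^sub>R \<xi>)" by (simp add: x_def)
      finally have "appv F1 (appv Ks \<xi>) = s *\<^sub>R \<xi>"
        unfolding scaleR_cancel_left using \<rho> by simp
      then show ?case by (simp add: appv_appv[OF Kb \<xi>] appv_scaled_coords[OF \<xi>])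
    qed
  qed
  have exp: "expands e (s * \<rho>') E"
    unfolding expands_def
  proof (intro conjI allI impI)
    show "0 < s * \<rho>'" by (rule r1)
    fix x :: "real ^ 2" assume x: "norm x \<le> s * \<rho>'"
    define \<xi> where "\<xi> = x /\<^sub>R (s * \<rho>')"
    have \<xi>: "\<xi> \<in> bidisc 1" unfolding \<xi>_def using scaled_in_bidisc[OF r1(1), of x 1] x by simp
    have "norm (dilated \<rho>' K1 x) \<le> 1/2 * \<rho>" using kx(2)[OF x] unfolding \<rho>'[symmetric] .
    from dilated_halve[OF \<rho>(1) this, of F]
    have "dilated \<rho> F (dilated \<rho>' K1 x) = dilated \<rho>' (2 *\<^sub>R halve F) (dilated \<rho>' K1 x)"
      unfolding \<rho>'[symmetric] .
    also have "\<dots> = \<rho>' *\<^sub>R appv (2 *\<^sub>R halve F) (appv Ks \<xi>)" unfolding kx(1)[OF x] dil \<xi>_def ..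
    finally have "e x = (q - p) + \<rho>' *\<^sub>R appv (appv (2 *\<^sub>R halve F) Ks) \<xi>"
      by (simp add: e_def appv_appv[OF Kb \<xi>])
    also have "\<dots> = (s * \<rho>') *\<^sub>R appv E \<xi>"
      using s \<rho> by (simp add: E_def Ks_def[symmetric] appv_simps(1,3)[OF \<xi>] appv_constv scaleR_add_right)
    finally show "e x = (s * \<rho>') *\<^sub>R appv E (x /\<^sub>R (s * \<rho>'))" by (simp only: \<xi>_def)
  qed
  have "E - coords = (1 / s) *\<^sub>R (constv ((q - p) /\<^sub>R \<rho>') + appv (2 *\<^sub>R halve F - F1) Ks)"
    using s by (simp add: E_def Ks_def[symmetric] appv_simps(2)[OF Kb] FK algebra_simps)
  then have "norm1 (E - coords) = (1 / s) * norm1 (constv ((q - p) /\<^sub>R \<rho>') + appv (2 *\<^sub>R halve F - F1) Ks)"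
    using s by simp
  also have "\<dots> \<le> (1 / s) * (norm1 (q - p) / \<rho>' + norm1 (2 *\<^sub>R halve F - F1))"
  proof (intro mult_left_mono)
    have "norm1 (constv ((q - p) /\<^sub>R \<rho>') :: wiener ^ 2) = norm1 (q - p) / \<rho>'"
      using \<rho> by (simp add: norm1_constv divide_inverse mult.commute)
    then show "norm1 (constv ((q - p) /\<^sub>R \<rho>') + appv (2 *\<^sub>R halve F - F1) Ks) \<le> norm1 (q - p) / \<rho>' + norm1 (2 *\<^sub>R halve F - F1)"
      using norm1_triangle[of "constv ((q - p) /\<^sub>R \<rho>') :: wiener ^ 2" "appv (2 *\<^sub>R halve F - F1) Ks"]
        norm1_appv_le[OF Kb, of "2 *\<^sub>R halve F - F1"] by linarith
  qed (use s in simp)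
  also have "\<dots> \<le> \<epsilon>" using \<epsilon> by simp
  finally have nE: "norm1 (E - coords) \<le> \<epsilon>" .
  have ge: "germ (\<lambda>x. e x - e 0) \<in> G"
    using germ_mem_compose[OF linkedD(4)[OF l] linkedD(5)[OF l1]] by (simp add: e_def k0 f0)
  define \<kappa> where "\<kappa> y = dilated \<rho>' F1 (dilated \<rho> K y)" for y
  have g\<kappa>: "germ \<kappa> \<in> G" unfolding \<kappa>_def[abs_def] by (rule germ_mem_compose[OF linkedD(4)[OF l1] linkedD(5)[OF l]])
  have ev: "\<forall>\<^sub>F y :: real ^ 2 in nhds 0. norm y < \<rho>'" by (rule eventually_norm_less[OF \<rho>(2)])
  have ev1: "\<forall>\<^sub>F y in nhds 0. norm y < \<rho>' \<and> norm (dilated \<rho> K y) < \<rho>' \<and> norm (\<kappa> y) < \<rho>'"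
    using ev eventually_compose_germ[OF linkedD(5)[OF l] ev] eventually_compose_germ[OF g\<kappa> ev]
    by eventually_elim simp
  have \<rho>'\<rho>: "\<rho>' \<le> \<rho>" using \<rho> \<rho>' by simp
  have inv: "\<forall>\<^sub>F y in nhds 0. e (\<kappa> y) - e 0 = y"
    using ev1
  proof eventually_elim
    case (elim y)
    have "dilated \<rho>' K1 (\<kappa> y) = dilated \<rho> K y"
      unfolding \<kappa>_def by (rule linkD(3)[OF linkedD(6)[OF l1]]) (use elim in \<open>auto simp: \<kappa>_def\<close>)
    moreover have "dilated \<rho> F (dilated \<rho> K y) = y"
      by (rule linkD(3)[OF linkedD(7)[OF l]]) (use elim \<rho>'\<rho> in auto)
    ultimately show ?case by (simp add: e_def k0 f0)
  qed
  have inv\<gamma>: "\<forall>\<^sub>F y in nhds 0. p + e 0 + y \<in> \<gamma> \<longrightarrow> p + \<kappa> y \<in> \<gamma>"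
    using ev1
  proof eventually_elim
    case (elim y)
    show ?case
    proof
      assume "p + e 0 + y \<in> \<gamma>"
      then have "q + y \<in> \<gamma>" by (simp add: e0)
      from linkD(2)[OF linkedD(7)[OF l] _ this] have "p0 + dilated \<rho> K y \<in> \<gamma>" using elim \<rho>'\<rho> by simp
      from linkD(2)[OF linkedD(6)[OF l1] _ this] show "p + \<kappa> y \<in> \<gamma>" using elim by (simp add: \<kappa>_def)
    qed
  qed
  have e\<gamma>: "p + e x \<in> \<gamma>" if x: "norm x \<le> s * \<rho>'" "p + x \<in> \<gamma>" for x
  proof -
    have "norm x \<le> \<rho>'" using x(1) r1 by linarith
    from linkD(2)[OF linkedD(7)[OF l1] this x(2)] have "p0 + dilated \<rho>' K1 x \<in> \<gamma>" .
    from linkD(2)[OF linkedD(6)[OF l] _ this] kx(2)[OF x(1)] \<rho>'\<rho> show ?thesis by (simp add: e_def)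
  qed
  show "near p (s * \<rho>') \<epsilon> e E"
    unfolding near_def using exp nE ge e\<gamma> g\<kappa> inv inv\<gamma> by blast
qed

text \<open>If the near maps failed for some \<epsilon>, there would be points \<open>q n\<close>
  tending to \<open>p\<close> without one. Their links subconverge to a link of \<open>p\<close>,
  and two links with close series give a near map by \<open>near_of_linked\<close>.\<close>

lemma no_family_of_links:
  assumes p: "p \<in> \<gamma>" and d: "0 < d" and \<rho>: "0 < \<rho>"
    and links: "\<And>q. q \<in> \<gamma> \<Longrightarrow> norm (q - p) < d \<Longrightarrow> \<exists>F K. linked \<rho> \<eta> M p0 q F K"
    and cl: "closed (\<gamma> \<inter> cball c (2 * \<eta>))" and c: "\<And>q. q \<in> \<gamma> \<Longrightarrow> norm (q - p) < d \<Longrightarrow> q \<in> cball c \<eta>" "p0 \<in> cball c \<eta>"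
  shows False
proof -
  define s where "s = min (1/2) (1 / (32 * \<bar>M\<bar> + 1))"
  have s: "0 < s" "s \<le> 1/2"
    unfolding s_def by (auto intro: min.cobounded1 simp: add_nonneg_pos)
  have s3: "32 * (4 * M) * s \<le> 4"
  proof -
    have "(32 * \<bar>M\<bar> + 1) * s \<le> (32 * \<bar>M\<bar> + 1) * (1 / (32 * \<bar>M\<bar> + 1))" by (intro mult_left_mono) (auto simp: s_def)
    also have "\<dots> = 1"
    proof -
      have "t * (1 / t) = 1" if "0 < t" for t :: real using that by simp
      from this[of "32 * \<bar>M\<bar> + 1"] show ?thesis by simp
    qed
    finally have "32 * \<bar>M\<bar> * s \<le> 1" using s by (simp add: algebra_simps)
    moreover have "32 * M * s \<le> 32 * \<bar>M\<bar> * s" using s by (intro mult_right_mono) auto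
    ultimately show ?thesis by simp
  qed
  define \<rho>' where "\<rho>' = 1/2 * \<rho>"
  have \<rho>': "0 < \<rho>'" using \<rho> by (simp add: \<rho>'_def)
  show False
  proof (rule no_family_of_near_maps[OF p])
    show "0 < s * \<rho>'" using s \<rho>' by simp
    fix \<epsilon> :: real assume \<epsilon>: "0 < \<epsilon>"
    show "\<exists>\<delta>>0. \<forall>q\<in>\<gamma>. norm (q - p) < \<delta> \<longrightarrow> (\<exists>e E. near p (s * \<rho>') \<epsilon> e E \<and> p + e 0 = q)"
    proof (rule ccontr)
      assume neg: "\<not> ?thesis"
      have "\<exists>q. q \<in> \<gamma> \<and> norm (q - p) < min d (inverse (real (Suc n))) \<and> \<not> (\<exists>e E. near p (s * \<rho>') \<epsilon> e E \<and> p + e 0 = q)" for n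
      proof -
        have "0 < min d (inverse (real (Suc n)))" using d by simp
        with neg show ?thesis by blast
      qed
      then obtain q where q: "\<And>n. q n \<in> \<gamma>" "\<And>n. norm (q n - p) < min d (inverse (real (Suc n)))"
        "\<And>n. \<not> (\<exists>e E. near p (s * \<rho>') \<epsilon> e E \<and> p + e 0 = q n)" by metis
      have qd: "norm (q n - p) < d" for n using q(2)[of n] by simp
      have "\<exists>F K. linked \<rho> \<eta> M p0 (q n) F K" for n by (rule links[OF q(1) qd])
      then obtain F K where FK: "\<And>n. linked \<rho> \<eta> M p0 (q n) (F n) (K n)" by metis
      have "norm (q n - p) \<le> inverse (real (Suc n))" for n using q(2)[of n] by simp
      from Lim_null_comparison[OF always_eventually[OF allI[OF this]] LIMSEQ_inverse_real_of_nat]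
      have qp: "q \<longlonglongrightarrow> p" by (rule LIM_zero_cancel)
      obtain r F' K' where r: "strict_mono r" and l: "linked (1/2 * \<rho>) \<eta> (4 * M) p0 p (2 *\<^sub>R halve F') (2 *\<^sub>R halve K')"
        and F: "(\<lambda>n. halve (F (r n))) \<longlonglongrightarrow> halve F'"
        by (rule linked_limit[OF FK qp cl c(1)[OF q(1) qd] c(2)]) blast
      have "(\<lambda>n. q (r n)) \<longlonglongrightarrow> p" using LIMSEQ_subseq_LIMSEQ[OF qp r] by (simp only: o_def)
      then have "(\<lambda>n. (norm1 (q (r n) - p) / \<rho>' + norm1 (2 *\<^sub>R halve (F (r n)) - 2 *\<^sub>R halve F')) / s) \<longlonglongrightarrow> (0 / \<rho>' + 0) / s"
        by (intro tendsto_divide tendsto_add tendsto_norm1 tendsto_scaleR tendsto_const F) (use \<rho>' s in auto)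
      then have "\<forall>\<^sub>F n in sequentially. (norm1 (q (r n) - p) / \<rho>' + norm1 (2 *\<^sub>R halve (F (r n)) - 2 *\<^sub>R halve F')) / s < \<epsilon>"
        using \<epsilon> by (intro order_tendstoD(2)) auto
      then obtain n where n: "(norm1 (q (r n) - p) / \<rho>' + norm1 (2 *\<^sub>R halve (F (r n)) - 2 *\<^sub>R halve F')) / s < \<epsilon>"
        by (auto simp: eventually_sequentially)
      from near_of_linked[OF FK l[folded \<rho>'_def] \<rho>'_def s s3 less_imp_le[OF n]] q(3)[of "r n"]
      show False by blast
    qed
  qed
qed


section \<open>Homogeneity and Baire category\<close>

lemma linked_of_homogeneous:
  assumes hom: "homogeneous G \<gamma>" and p: "p \<in> \<gamma>" and q: "q \<in> \<gamma>" and \<eta>: "0 < \<eta>"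
  obtains m n :: nat and F K where "linked (inverse (real (Suc m))) \<eta> (real n) p q F K"
proof -
  obtain U \<psi> where U: "p \<in> U" "diffeo_on (real_analytic_on) \<psi> U" "\<psi> ` (U \<inter> \<gamma>) = \<gamma> \<inter> \<psi> ` U" "\<psi> p = q"
    "germ ((+) (- q) \<circ> \<psi> \<circ> (+) p) \<in> G"
    using hom p q unfolding homogeneous_def by meson
  obtain \<kappa> where \<kappa>: "open U" "open (\<psi> ` U)" "\<And>x. x \<in> U \<Longrightarrow> ranalytic_at \<psi> x"
    "\<And>x. x \<in> U \<Longrightarrow> \<kappa> (\<psi> x) = x" "\<And>x. x \<in> U \<Longrightarrow> ranalytic_at \<kappa> (\<psi> x)"
    using U(2) by (rule diffeo_onE) blast
  define f where "f x = - q + \<psi> (p + x)" for x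
  define k where "k y = - p + \<kappa> (q + y)" for y
  have gf: "germ f \<in> G" using U(5) by (simp add: f_def[abs_def] o_def)
  have anf: "ranalytic_at f 0" using gf by (rule germ_memD)
  have "ranalytic_at (\<lambda>y. \<kappa> (q + y)) 0"
    by (rule ranalytic_at_shift) (use \<kappa>(5)[OF U(1)] U(4) in simp)
  then have ank: "ranalytic_at k 0" unfolding k_def[abs_def] by (rule ranalytic_at_translate_left)
  have f0: "f 0 = 0" by (simp add: f_def U(4))
  have k0: "k 0 = 0" using \<kappa>(4)[OF U(1)] U(4) by (simp add: k_def)
  have kf: "k (f x) = x" if "p + x \<in> U" for x using \<kappa>(4)[OF that] by (simp add: f_def k_def)
  have fk: "f (k y) = y" if "q + y \<in> \<psi> ` U" for y using that \<kappa>(4) by (auto simp: f_def k_def algebra_simps)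
  have f\<gamma>: "q + f x \<in> \<gamma>" if "p + x \<in> U" "p + x \<in> \<gamma>" for x
    using that U(3) by (auto simp: f_def)
  have k\<gamma>: "p + k y \<in> \<gamma>" if "q + y \<in> \<psi> ` U" "q + y \<in> \<gamma>" for y
  proof -
    have "q + y \<in> \<psi> ` (U \<inter> \<gamma>)" using that U(3) by blast
    then show ?thesis using \<kappa>(4) by (auto simp: k_def)
  qed
  have U0: "open ((\<lambda>x. - p + x) ` U)" "open ((\<lambda>x. - q + x) ` \<psi> ` U)"
    using \<kappa>(1,2) by (auto simp only: open_translation)
  have ev: "\<forall>\<^sub>F x in nhds 0. p + x \<in> U \<and> q + x \<in> \<psi> ` U \<and> norm (f x) < \<eta> \<and> norm (k x) < \<eta>"
  proof -
    have mem: "a + x \<in> A" if "x \<in> (\<lambda>x. - a + x) ` A" for a x :: "real ^ 2" and A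
      using that by auto
    have "\<forall>\<^sub>F x in nhds 0. x \<in> (\<lambda>x. - p + x) ` U"
      by (rule eventually_nhds_in_open[OF U0(1)], rule image_eqI[of _ _ p]) (use U(1) in simp_all)
    moreover have "\<forall>\<^sub>F x in nhds 0. x \<in> (\<lambda>x. - q + x) ` \<psi> ` U"
      by (rule eventually_nhds_in_open[OF U0(2)], rule image_eqI[of _ _ q]) (use U(1,4) in auto)
    moreover have "\<forall>\<^sub>F x in nhds 0. norm (f x) < \<eta>" "\<forall>\<^sub>F x in nhds 0. norm (k x) < \<eta>"
      using eventually_compose_isCont[OF ranalytic_at_imp_isCont[OF anf] f0 eventually_norm_less[OF \<eta>]]
        eventually_compose_isCont[OF ranalytic_at_imp_isCont[OF ank] k0 eventually_norm_less[OF \<eta>]] by auto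
    ultimately show ?thesis by eventually_elim (use mem in blast)
  qed
  have evU: "\<forall>\<^sub>F x in nhds 0. k (f x) = x" "\<forall>\<^sub>F x in nhds 0. f (k x) = x"
    by (rule eventually_mono[OF ev], simp add: kf fk)+
  have gk: "germ k \<in> G" by (rule germ_mem_inverse[OF gf ank k0 evU])
  obtain \<rho>1 F1 where F1: "expands f \<rho>1 F1" using anf by (auto simp: ranalytic_at_def)
  obtain \<rho>2 K1 where K1: "expands k \<rho>2 K1" using ank by (auto simp: ranalytic_at_def)
  obtain r where r: "0 < r" "\<And>x. norm x < r \<Longrightarrow> p + x \<in> U \<and> q + x \<in> \<psi> ` U \<and> norm (f x) < \<eta> \<and> norm (k x) < \<eta>"
    using ev unfolding eventually_nhds_metric dist_0_norm dist_norm diff_zero by blast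
  have pos: "0 < \<rho>1" "0 < \<rho>2" using F1 K1 by (auto dest: expands_pos)
  then have "0 < min r (min \<rho>1 \<rho>2)" using r(1) by simp
  from reals_Archimedean[OF this] obtain m where m: "inverse (real (Suc m)) < min r (min \<rho>1 \<rho>2)" by blast
  define \<rho> where "\<rho> = inverse (real (Suc m))"
  have \<rho>: "0 < \<rho>" "\<rho> < r" "\<rho> \<le> \<rho>1" "\<rho> \<le> \<rho>2" using m by (auto simp: \<rho>_def)
  define F where "F = (1 / (\<rho> / \<rho>1)) *\<^sub>R appv F1 ((\<rho> / \<rho>1) *\<^sub>R coords)"
  define K where "K = (1 / (\<rho> / \<rho>2)) *\<^sub>R appv K1 ((\<rho> / \<rho>2) *\<^sub>R coords)"
  have eF: "expands f \<rho> F" using expands_shrink[OF F1, of "\<rho> / \<rho>1"] \<rho> pos by (simp add: F_def)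
  have eK: "expands k \<rho> K" using expands_shrink[OF K1, of "\<rho> / \<rho>2"] \<rho> pos by (simp add: K_def)
  note dF = expands_eq_dilated[OF eF] and dK = expands_eq_dilated[OF eK]
  have evr: "\<forall>\<^sub>F x :: real ^ 2 in nhds 0. norm x < \<rho>" by (rule eventually_norm_less[OF \<rho>(1)])
  have "germ (dilated \<rho> F) \<in> G"
    by (rule germ_mem_cong[OF gf]) (use evr in \<open>eventually_elim, simp add: dF\<close>)
  moreover have "germ (dilated \<rho> K) \<in> G"
    by (rule germ_mem_cong[OF gk]) (use evr in \<open>eventually_elim, simp add: dK\<close>)
  moreover have "link \<rho> \<eta> p q F K"
    unfolding link_def
  proof (intro allI impI)
    fix x :: "real ^ 2" assume x: "norm x \<le> \<rho>"
    then have x': "p + x \<in> U" "norm (f x) \<le> \<eta>" using r(2)[of x] \<rho>(2) by auto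
    show "norm (dilated \<rho> F x) \<le> \<eta> \<and> (p + x \<in> \<gamma> \<longrightarrow> q + dilated \<rho> F x \<in> \<gamma>) \<and>
        (norm (dilated \<rho> F x) \<le> \<rho> \<longrightarrow> dilated \<rho> K (dilated \<rho> F x) = x)"
      using x' f\<gamma>[OF x'(1)] kf[OF x'(1)] dK[of "f x"] by (simp add: dF[OF x, symmetric])
  qed
  moreover have "link \<rho> \<eta> q p K F"
    unfolding link_def
  proof (intro allI impI)
    fix x :: "real ^ 2" assume x: "norm x \<le> \<rho>"
    then have x': "q + x \<in> \<psi> ` U" "norm (k x) \<le> \<eta>" using r(2)[of x] \<rho>(2) by auto
    show "norm (dilated \<rho> K x) \<le> \<eta> \<and> (q + x \<in> \<gamma> \<longrightarrow> p + dilated \<rho> K x \<in> \<gamma>) \<and>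
        (norm (dilated \<rho> K x) \<le> \<rho> \<longrightarrow> dilated \<rho> F (dilated \<rho> K x) = x)"
      using x' k\<gamma>[OF x'(1)] fk[OF x'(1)] dF[of "k x"] by (simp add: dK[OF x, symmetric])
  qed
  moreover obtain n :: nat where "max (norm1 F) (norm1 K) \<le> real n" using real_arch_simple by blast
  ultimately have "linked \<rho> \<eta> (real n) p q F K" using \<rho>(1) by (simp add: linked_def)
  then show thesis unfolding \<rho>_def by (rule that)
qed

text \<open>By homogeneity the sets \<open>T (m, n)\<close> cover the curve near \<open>p0\<close>,
  so by Baire one of them is dense near some point \<open>p\<close>. Passing to its closure costs
  only constants, by \<open>linked_limit\<close>, and links all curve points near \<open>p\<close>
  uniformly.\<close>

lemma not_homogeneous:
  assumes hom: "homogeneous G \<gamma>" and p0: "p0 \<in> \<gamma>"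
  shows False
proof -
  obtain W where W: "open W" "\<gamma> \<subseteq> W" "closedin (top_of_set W) \<gamma>"
    using smooth_curve_locally_closed[OF smooth] by blast
  obtain C where C: "closed C" "\<gamma> = W \<inter> C" using W(3) by (auto simp: closedin_closed)
  obtain e where e: "0 < e" "cball p0 e \<subseteq> W" using W(1,2) p0 open_contains_cball by blast
  \<comment> \<open>Base points stay within \<eta> of \<open>p0\<close> and displacements are at
    most \<eta>, so all images lie in the ball of radius 2 * \<eta> = e, in which \<gamma> is
    closed.\<close>
  define \<eta> where "\<eta> = e / 2"
  have \<eta>: "0 < \<eta>" using e(1) by (simp add: \<eta>_def)
  have "\<gamma> \<inter> cball p0 (2 * \<eta>) = C \<inter> cball p0 (2 * \<eta>)" using C(2) e(2) by (auto simp: \<eta>_def)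
  then have cl: "closed (\<gamma> \<inter> cball p0 (2 * \<eta>))" using C(1) by auto
  define V where "V = \<gamma> \<inter> ball p0 \<eta>"
  have p0V: "p0 \<in> V" using p0 \<eta> by (simp add: V_def)
  have "closure V \<subseteq> \<gamma> \<inter> cball p0 (2 * \<eta>)"
    by (rule closure_minimal[OF _ cl]) (use \<eta> in \<open>auto simp: V_def\<close>)
  \<comment> \<open>Baire's theorem will be applied in the closed set \<open>closure V\<close>;
    \<open>V\<close> is relatively open and dense there and serves as one of the sets.\<close>
  then have Vop: "V = closure V \<inter> ball p0 \<eta>" using closure_subset[of V] by (auto simp: V_def)
  define T where "T = (\<lambda>(m, n). {q \<in> V. \<exists>F K. linked (inverse (real (Suc m))) \<eta> (real n) p0 q F K})"
  have TV: "\<exists>mn. q \<in> T mn" if "q \<in> V" for q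
  proof -
    have "q \<in> \<gamma>" using that by (simp add: V_def)
    from linked_of_homogeneous[OF hom p0 this \<eta>]
    obtain m n F K where "linked (inverse (real (Suc m))) \<eta> (real n) p0 q F K" by blast
    with that show ?thesis by (intro exI[of _ "(m, n)"]) (auto simp: T_def)
  qed
  \<comment> \<open>Otherwise the complements of the closures of all \<open>T mn\<close> would be
    dense and relatively open, and together with \<open>V\<close> they have empty intersection since
    the \<open>T mn\<close> cover \<open>V\<close>.\<close>
  have "\<exists>mn x. x \<in> V \<and> x \<notin> closure (closure V - closure (T mn))"
  proof (rule ccontr)
    assume "\<not> ?thesis"
    then have dense: "V \<subseteq> closure (closure V - closure (T mn))" for mn by blast
    let ?\<G> = "insert V (range (\<lambda>mn. closure V - closure (T mn)))"
    have "closure V \<subseteq> closure (\<Inter>?\<G>)"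
    proof (rule Baire)
      show "closed (closure V)" by simp
      show "countable ?\<G>" by simp
      fix S assume "S \<in> ?\<G>"
      then consider "S = V" | mn where "S = closure V - closure (T mn)" by blast
      then show "openin (top_of_set (closure V)) S \<and> closure V \<subseteq> closure S"
      proof cases
        case 1
        then show ?thesis using Vop openin_open_Int[of "ball p0 \<eta>" "closure V"] by auto
      next
        case 2
        have "closure V - closure (T mn) = closure V \<inter> (- closure (T mn))" by auto
        then have "openin (top_of_set (closure V)) S"
          using 2 openin_open_Int[of "- closure (T mn)" "closure V"] by auto
        moreover have "closure V \<subseteq> closure S" using 2 closure_minimal[OF dense[of mn]] by auto
        ultimately show ?thesis by simp
      qed
    qed
    moreover have "\<Inter>?\<G> = {}"
    proof (rule equals0I)
      fix x assume x: "x \<in> \<Inter>?\<G>"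
      then have "x \<in> V" by blast
      from TV[OF this] obtain mn where "x \<in> T mn" by blast
      then have "x \<in> closure (T mn)" using closure_subset[of "T mn"] by blast
      then show False using x by blast
    qed
    ultimately show False using p0V closure_subset[of V] by auto
  qed
  then obtain m n p where p: "p \<in> V" "p \<notin> closure (closure V - closure (T (m, n)))" by auto
  have "open (ball p0 \<eta> \<inter> - closure (closure V - closure (T (m, n))))" by auto
  moreover have "p \<in> ball p0 \<eta> \<inter> - closure (closure V - closure (T (m, n)))" using p by (simp add: V_def)
  ultimately obtain d where d: "0 < d" "ball p d \<subseteq> ball p0 \<eta> \<inter> - closure (closure V - closure (T (m, n)))"
    by (meson open_contains_ball)
  have near_p: "q \<in> V" "q \<in> closure (T (m, n))" if "q \<in> \<gamma>" "norm (q - p) < d" for q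
  proof -
    have "q \<in> ball p d" using that by (simp add: dist_norm norm_minus_commute)
    then have q: "q \<in> ball p0 \<eta>" "q \<notin> closure (closure V - closure (T (m, n)))" using d(2) by auto
    then show V: "q \<in> V" using that by (simp add: V_def)
    have "q \<notin> closure V - closure (T (m, n))" using q(2) closure_subset[of "closure V - closure (T (m, n))"] by blast
    then show "q \<in> closure (T (m, n))" using V closure_subset[of V] by blast
  qed
  let ?\<rho> = "inverse (real (Suc m))"
  show False
  proof (rule no_family_of_links[OF _ d(1), where p = p and p0 = p0 and c = p0 and \<eta> = \<eta> and \<rho> = "1/2 * ?\<rho>" and M = "4 * real n"])
    show "p \<in> \<gamma>" using p by (simp add: V_def)
    show "0 < 1/2 * ?\<rho>" by simp
    show "closed (\<gamma> \<inter> cball p0 (2 * \<eta>))" by (rule cl)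
    show "p0 \<in> cball p0 \<eta>" using \<eta> by simp
    fix q assume q: "q \<in> \<gamma>" "norm (q - p) < d"
    show "q \<in> cball p0 \<eta>" using near_p(1)[OF q] by (simp add: V_def)
    obtain x where x: "\<And>k. x k \<in> T (m, n)" "x \<longlonglongrightarrow> q"
      using near_p(2)[OF q] unfolding closure_sequential by blast
    have xl: "\<exists>F K. linked ?\<rho> \<eta> (real n) p0 (x k) F K" "x k \<in> cball p0 \<eta>" for k
      using x(1)[of k] by (auto simp: T_def V_def)
    then obtain F K where FK: "\<And>k. linked ?\<rho> \<eta> (real n) p0 (x k) (F k) (K k)" by metis
    have "p0 \<in> cball p0 \<eta>" using \<eta> by simp
    then show "\<exists>F K. linked (1/2 * ?\<rho>) \<eta> (4 * real n) p0 q F K"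
      by (rule linked_limit[OF FK x(2) cl xl(2)]) blast
  qed
qed

end

theorem proposition1p3:
  fixes G :: "germ set" and \<gamma> :: "(real^2) set"
  assumes "subgroup G Diff_omega"
    and "closed_germs G"
    and "uniform_germs G"
    and "ICP G"
    and "smooth_curve \<gamma>"
    and "homogeneous G \<gamma>"
  shows "real_analytic_curve \<gamma>"
proof (rule ccontr)
  assume "\<not> ?thesis"
  then obtain p where p: "p \<in> \<gamma>" "\<not> analytic_point \<gamma> p"
    by (auto simp: curve_of_class_def analytic_point_def)
  have na: "\<not> analytic_point \<gamma> q" if q: "q \<in> \<gamma>" for q
  proof
    assume an: "analytic_point \<gamma> q"
    obtain U \<psi> where U: "q \<in> U" "diffeo_on (real_analytic_on) \<psi> U" "\<psi> ` (U \<inter> \<gamma>) = \<gamma> \<inter> \<psi> ` U" "\<psi> q = p"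
      using assms(6) p(1) q unfolding homogeneous_def by meson
    have "\<psi> x \<in> \<gamma> \<longleftrightarrow> x \<in> \<gamma>" if x: "x \<in> U" for x
    proof
      assume "\<psi> x \<in> \<gamma>"
      then have "\<psi> x \<in> \<psi> ` (U \<inter> \<gamma>)" using x U(3) by blast
      then show "x \<in> \<gamma>" using x U(2) by (auto simp: diffeo_on_def dest: inj_onD)
    qed (use x U(3) in blast)
    from analytic_point_image[OF an U(1,2) this] show False using U(4) p(2) by simp
  qed
  interpret nowhere_analytic_curve G \<gamma>
    by (rule nowhere_analytic_curve.intro[OF germ_group.intro[OF assms(1)]
          nowhere_analytic_curve_axioms.intro[OF assms(2-5) na]])
  show False using not_homogeneous[OF assms(6) p(1)] .
qed

end
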